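(* Let $p$ be a prime, let $(\mathcal L,\Delta,S)$ be a locality of objective characteristic $p$ and let $Q\le S$ be a large subgroup of $\mathcal L$ such that $\mathcal L$ is $Q$-replete. Let $L\le\mathcal L$ be a parabolic subgroup. Then the following hold. (a) There exist $M\in\mathfrak M_{\mathcal L}(S)$ and a parabolic subgroup $L^*\le\mathcal L$ such that $$L^*\le M,\qquad LC_{\mathcal L}(Y_L)=L^*C_{\mathcal L}(Y_L)\qquad\text{and}\qquad Y_L=Y_{L^*}\le Y_M.$$ Moreover, $L^\circ=(L^* )^\circ\le M^\circ$. (b) Suppose $Q\not\trianglelefteq L$ and pick $M$ and $L^*$ as in (a). Then $Q\not\trianglelefteq L^*$ and $Q\not\trianglelefteq M$. (c) One of the following holds: (i) $\mathcal M_{\mathcal L}(S)=\{N_{\mathcal L}(Q)\}$, or (ii) there exists $M\in\mathfrak M_{\mathcal L}(S)$ such that $Q\not\trianglelefteq M$.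
   Context: Partial groups. For a set $X$, $\mathbb W(X)$ is the free monoid of words on $X$, with concatenation $\circ$. A partial group is a quadruple $(\mathcal L,D,\Pi,i)$ with $\mathcal L$ a non-empty set, $\mathcal L\subseteq D\subseteq\mathbb W(\mathcal L)$ (elements being words of length 1), $\Pi\colon D\to\mathcal L$ and $i\colon\mathcal L\to\mathcal L$, $x\mapsto x^{-1}$, an involutory bijection, such that: $\Pi|_{\mathcal L}=\mathrm{id}$; $u\circ v\in D$ implies $u,v\in D$; $u\circ v\circ w\in D$ implies $u\circ\Pi(v)\circ w\in D$ and $\Pi(u\circ v\circ w)=\Pi(u\circ \Pi(v)\circ w)$; for $u=(u_1,\dots,u_k)\in D$ and $u^{-1}:=(u_k^{-1},\dots,u_1^{-1})$, $u\circ u^{-1}\in D$ and $\Pi(u\circ u^{-1})=\Pi(\,(\,)\,)=:1$. A subgroup $H\le\mathcal L$ is a subset closed under inversion and products with $\mathbb W(H)\subseteq D$ (so it is a group). For $x\in\mathcal L$, $D(x)=\{y:(x^{-1},y,x)\in D\}$ and $y^x=\Pi(x^{-1},y,x)$; writing $U^x$ presupposes $U\subseteq D(x)$ (and, if $U$ is a subgroup, that $c_x\colon U\to U^x$ is a homomorphism). $N_{\mathcal L}(U)=\{x:U^x=U\}$, $C_{\mathcal L}(U)=\{x: u^x=u\ \forall u\in U\}$. For subsets $A,B$, $AB=\{\Pi(a,b):a\in A,b\in B,(a,b)\in D\}$. Localities. A (finite) locality over a finite $p$-group $S$ is a triple $(\mathcal L,\Delta,S)$ where $\mathcal L$ is a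 finite partial group, $S$ is a subgroup of $\mathcal L$ maximal among $p$-subgroups, and $\Delta$ is a non-empty set of subgroups of $S$, closed under $\mathcal L$-conjugation (within $S$) and under overgroups in $S$, such that $(u_1,\dots,u_k)\in D$ if and only if there are $P_0,\dots,P_k\in\Delta$ with $P_{i-1}^{u_i}=P_i$ for all $i$. A finite group $G$ is of characteristic $p$ if $C_G(O_p(G))\le O_p(G)$. $\mathcal L$ is of objective characteristic $p$ if $N_{\mathcal L}(P)$ (a group) is of characteristic $p$ for every $P\in\Delta$. A parabolic subgroup of $\mathcal L$ is a subgroup containing $S$. $Q\le S$ is large in $\mathcal L$ if $C_{\mathcal L}(Q)\subseteq Q$ and $N_{\mathcal L}(U)\subseteq N_{\mathcal L}(Q)$ for all subgroups $1\ne U\le Z(Q)$. $\mathcal L$ is $Q$-replete if $Q\trianglelefteq S$ and every non-trivial subgroup of $C_S(Q)$ is in $\Delta$. For a subgroup $K\le\mathcal L$ containing $Q$, $K^\circ:=\langle Q^K\rangle$. For a finite group $G$, a normal subgroup $A$ is $p$-reduced if $O_p(G/C_G(A))=1$; $Y_G$ denotes the unique largest elementary abelian normal $p$-reduced $p$-subgroup of $G$. $\mathcal C_{\mathcal L}$ is the set of subgroups $H\le\mathcal L$ with $C_{\mathcal L}(O_p(H))\subseteq O_p(H)$; $\mathcal M_{\mathcal L}$ is the set of maximal elements (under inclusion) of $\mathcal C_{\mathcal L}$ and $\mathcal M_{\mathcal L}(S)$ the set of those containing $S$. For $M\in\mathcal C_{\mathcal L}$ put $M^\dagger:=MC_{\mathcal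 L}(Y_M)$. $\mathfrak M_{\mathcal L}(S)$ is the set of $M\in\mathcal C_{\mathcal L}$ with $S\le M$ such that: (1) $M^\dagger$ is the unique element of $\mathcal M_{\mathcal L}$ containing $M$, and $Y_M=Y_{M^\dagger}$; (2) $C_M(Y_M)$ has a unique Sylow $p$-subgroup and $C_M(Y_M)/O_p(M)\le\Phi(M/O_p(M))$ (Frattini subgroup). *)

theory Defs
  imports "HOL-Algebra.Generated_Groups" "HOL-Computational_Algebra.Primes"
begin

section \<open>Finite groups\<close>

definition p_subgroup :: "nat \<Rightarrow> ('a, 'b) monoid_scheme \<Rightarrow> 'a set \<Rightarrow> bool" where
  "p_subgroup p G P \<longleftrightarrow> subgroup P G \<and> (\<exists>n. card P = p ^ n)"

definition sylow_subgroup :: "nat \<Rightarrow> ('a, 'b) monoid_scheme \<Rightarrow> 'a set \<Rightarrow> bool" where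
  "sylow_subgroup p G P \<longleftrightarrow> subgroup P G \<and> card P = p ^ multiplicity p (order G)"

definition group_centralizer :: "('a, 'b) monoid_scheme \<Rightarrow> 'a set \<Rightarrow> 'a set" where
  "group_centralizer G A = {g \<in> carrier G. \<forall>a\<in>A. g \<otimes>\<^bsub>G\<^esub> a = a \<otimes>\<^bsub>G\<^esub> g}"

definition group_center :: "('a, 'b) monoid_scheme \<Rightarrow> 'a set" where
  "group_center G = group_centralizer G (carrier G)"

text \<open>\<open>O\<^sub>p(G)\<close>, the largest normal \<open>p\<close>-subgroup. Here and in the definition of \<open>Y\<^sub>G\<close> below,
  the order used by \<open>GREATEST\<close> is set inclusion; the greatest element exists if \<open>G\<close> is a
  finite group and \<open>p\<close> is a prime.\<close>

definition p_core :: "nat \<Rightarrow> ('a, 'b) monoid_scheme \<Rightarrow> 'a set" where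
  "p_core p G = (GREATEST P. P \<lhd> G \<and> p_subgroup p G P)"

definition characteristic_p :: "nat \<Rightarrow> ('a, 'b) monoid_scheme \<Rightarrow> bool" where
  "characteristic_p p G \<longleftrightarrow> group_centralizer G (p_core p G) \<subseteq> p_core p G"

definition elementary_abelian :: "nat \<Rightarrow> ('a, 'b) monoid_scheme \<Rightarrow> bool" where
  "elementary_abelian p G \<longleftrightarrow> comm_group G \<and> (\<forall>a\<in>carrier G. a [^]\<^bsub>G\<^esub> p = \<one>\<^bsub>G\<^esub>)"

definition p_reduced :: "nat \<Rightarrow> ('a, 'b) monoid_scheme \<Rightarrow> 'a set \<Rightarrow> bool" where
  "p_reduced p G A \<longleftrightarrow> A \<lhd> G \<and>
     p_core p (G Mod group_centralizer G A) = {\<one>\<^bsub>G Mod group_centralizer G A\<^esub>}"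

text \<open>The subgroup \<open>Y\<^sub>G\<close>.\<close>

definition Y_sub :: "nat \<Rightarrow> ('a, 'b) monoid_scheme \<Rightarrow> 'a set" where
  "Y_sub p G = (GREATEST A. A \<lhd> G \<and> p_subgroup p G A \<and>
      elementary_abelian p (G\<lparr>carrier := A\<rparr>) \<and> p_reduced p G A)"

definition maximal_subgroup :: "('a, 'b) monoid_scheme \<Rightarrow> 'a set \<Rightarrow> bool" where
  "maximal_subgroup G M \<longleftrightarrow> subgroup M G \<and> M \<noteq> carrier G \<and>
     (\<forall>K. subgroup K G \<and> M \<subseteq> K \<longrightarrow> K = M \<or> K = carrier G)"

definition frattini :: "('a, 'b) monoid_scheme \<Rightarrow> 'a set" where
  "frattini G = carrier G \<inter> \<Inter>{M. maximal_subgroup G M}"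


section \<open>Partial groups\<close>

record 'a partial_group =
  pg_carrier :: "'a set"
  pg_dom :: "'a list set"
  pg_prod :: "'a list \<Rightarrow> 'a"
  pg_inv :: "'a \<Rightarrow> 'a"

locale partial_group =
  fixes \<L> :: "'a partial_group"
  assumes carrier_nonempty: "pg_carrier \<L> \<noteq> {}"
    and dom_words: "pg_dom \<L> \<subseteq> lists (pg_carrier \<L>)"
    and singleton_dom: "x \<in> pg_carrier \<L> \<Longrightarrow> [x] \<in> pg_dom \<L>"
    and prod_closed: "w \<in> pg_dom \<L> \<Longrightarrow> pg_prod \<L> w \<in> pg_carrier \<L>"
    and inv_closed: "x \<in> pg_carrier \<L> \<Longrightarrow> pg_inv \<L> x \<in> pg_carrier \<L>"
    and inv_inv: "x \<in> pg_carrier \<L> \<Longrightarrow> pg_inv \<L> (pg_inv \<L> x) = x"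
    and prod_singleton: "x \<in> pg_carrier \<L> \<Longrightarrow> pg_prod \<L> [x] = x"
    and dom_append: "u @ v \<in> pg_dom \<L> \<Longrightarrow> u \<in> pg_dom \<L> \<and> v \<in> pg_dom \<L>"
    and dom_assoc: "u @ v @ w \<in> pg_dom \<L> \<Longrightarrow> u @ [pg_prod \<L> v] @ w \<in> pg_dom \<L>"
    and prod_assoc: "u @ v @ w \<in> pg_dom \<L> \<Longrightarrow>
          pg_prod \<L> (u @ v @ w) = pg_prod \<L> (u @ [pg_prod \<L> v] @ w)"
    and dom_inv: "u \<in> pg_dom \<L> \<Longrightarrow> u @ rev (map (pg_inv \<L>) u) \<in> pg_dom \<L>"
    and prod_inv: "u \<in> pg_dom \<L> \<Longrightarrow>
          pg_prod \<L> (u @ rev (map (pg_inv \<L>) u)) = pg_prod \<L> []"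

text \<open>The empty word is among the words in \<^term>\<open>lists H\<close>, so a subgroup contains the identity
  \<^term>\<open>pg_prod \<L> []\<close>.\<close>

definition pg_subgroup :: "'a partial_group \<Rightarrow> 'a set \<Rightarrow> bool" where
  "pg_subgroup \<L> H \<longleftrightarrow> H \<subseteq> pg_carrier \<L> \<and> lists H \<subseteq> pg_dom \<L> \<and>
     (\<forall>x\<in>H. pg_inv \<L> x \<in> H) \<and> (\<forall>w\<in>lists H. pg_prod \<L> w \<in> H)"

text \<open>A subgroup of a partial group, as a group in the sense of HOL-Algebra.\<close>

definition pg_group :: "'a partial_group \<Rightarrow> 'a set \<Rightarrow> 'a monoid" where
  "pg_group \<L> H = \<lparr>carrier = H, monoid.mult = (\<lambda>x y. pg_prod \<L> [x, y]), one = pg_prod \<L> []\<rparr>"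

lemma (in partial_group) pg_subgroup_is_group:
  assumes "pg_subgroup \<L> H"
  shows "group (pg_group \<L> H)"
proof -
  let ?P = "pg_prod \<L>"
  have H: "H \<subseteq> pg_carrier \<L>" "lists H \<subseteq> pg_dom \<L>" "\<And>x. x \<in> H \<Longrightarrow> pg_inv \<L> x \<in> H"
    and cl: "\<And>w. w \<in> lists H \<Longrightarrow> ?P w \<in> H"
    using assms by (auto simp: pg_subgroup_def)
  show ?thesis
  proof (rule groupI; simp add: pg_group_def)
    fix x y assume "x \<in> H" "y \<in> H" then show "?P [x, y] \<in> H" by (intro cl) auto
  next
    show "?P [] \<in> H" by (intro cl) auto
  next
    fix x y z assume xyz: "x \<in> H" "y \<in> H" "z \<in> H"
    then have "[x, y, z] \<in> pg_dom \<L>" using H(2) by auto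
    then show "?P [?P [x, y], z] = ?P [x, ?P [y, z]]"
      using prod_assoc[of "[]" "[x, y]" "[z]"] prod_assoc[of "[x]" "[y, z]" "[]"] by simp
  next
    fix x assume x: "x \<in> H"
    then have "[x] \<in> pg_dom \<L>" "x \<in> pg_carrier \<L>" using H by auto
    then show "?P [?P [], x] = x"
      using prod_assoc[of "[]" "[]" "[x]"] prod_singleton by simp
  next
    fix x assume x: "x \<in> H"
    then have i: "pg_inv \<L> x \<in> H" "x \<in> pg_carrier \<L>" using H by auto
    then have "[pg_inv \<L> x] \<in> pg_dom \<L>" using H(2) by auto
    from prod_inv[OF this] have "?P [pg_inv \<L> x, x] = ?P []"
      using i by (simp add: inv_inv)
    with i show "\<exists>y\<in>H. ?P [y, x] = ?P []" by blast
  qed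
qed

definition conj_dom :: "'a partial_group \<Rightarrow> 'a \<Rightarrow> 'a set" where
  "conj_dom \<L> x = {y \<in> pg_carrier \<L>. [pg_inv \<L> x, y, x] \<in> pg_dom \<L>}"

text \<open>\<^term>\<open>pg_conj \<L> x y\<close> is \<open>y\<^sup>x = \<Pi>(x\<^sup>-\<^sup>1, y, x)\<close>; the conjugating element comes first.\<close>

definition pg_conj :: "'a partial_group \<Rightarrow> 'a \<Rightarrow> 'a \<Rightarrow> 'a" where
  "pg_conj \<L> x y = pg_prod \<L> [pg_inv \<L> x, y, x]"

text \<open>\<^term>\<open>conj_eq \<L> U x V\<close> means that \<open>U\<^sup>x\<close> is defined and equals \<open>V\<close>. If \<open>U\<close> is a subgroup,
  this includes that conjugation by \<open>x\<close> is a homomorphism (of partial groups) on \<open>U\<close>; then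
  \<open>V\<close> is a subgroup, too.\<close>

definition conj_eq :: "'a partial_group \<Rightarrow> 'a set \<Rightarrow> 'a \<Rightarrow> 'a set \<Rightarrow> bool" where
  "conj_eq \<L> U x V \<longleftrightarrow> U \<subseteq> conj_dom \<L> x \<and> pg_conj \<L> x ` U = V \<and>
     (pg_subgroup \<L> U \<longrightarrow>
       (\<forall>w\<in>lists U. map (pg_conj \<L> x) w \<in> pg_dom \<L> \<and>
          pg_prod \<L> (map (pg_conj \<L> x) w) = pg_conj \<L> x (pg_prod \<L> w)))"

definition pg_normalizer :: "'a partial_group \<Rightarrow> 'a set \<Rightarrow> 'a set" where
  "pg_normalizer \<L> U = {x \<in> pg_carrier \<L>. conj_eq \<L> U x U}"

definition pg_centralizer :: "'a partial_group \<Rightarrow> 'a set \<Rightarrow> 'a set" where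
  "pg_centralizer \<L> U = {x \<in> pg_carrier \<L>. \<forall>u\<in>U. u \<in> conj_dom \<L> x \<and> pg_conj \<L> x u = u}"

definition pg_set_mult :: "'a partial_group \<Rightarrow> 'a set \<Rightarrow> 'a set \<Rightarrow> 'a set" where
  "pg_set_mult \<L> A B = {pg_prod \<L> [a, b] | a b. a \<in> A \<and> b \<in> B \<and> [a, b] \<in> pg_dom \<L>}"

definition pg_p_subgroup :: "nat \<Rightarrow> 'a partial_group \<Rightarrow> 'a set \<Rightarrow> bool" where
  "pg_p_subgroup p \<L> H \<longleftrightarrow> pg_subgroup \<L> H \<and> (\<exists>n. card H = p ^ n)"


section \<open>Localities\<close>

locale locality = partial_group \<L>
  for p :: nat and \<L> :: "'a partial_group" and \<Delta> :: "'a set set" and S :: "'a set" +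
  assumes finite_carrier: "finite (pg_carrier \<L>)"
    and S_p_subgroup: "pg_p_subgroup p \<L> S"
    and S_maximal: "pg_p_subgroup p \<L> R \<Longrightarrow> S \<subseteq> R \<Longrightarrow> R = S"
    and objects_nonempty: "\<Delta> \<noteq> {}"
    and objects_subgroups: "P \<in> \<Delta> \<Longrightarrow> pg_subgroup \<L> P \<and> P \<subseteq> S"
    and objects_conj_closed:
      "P \<in> \<Delta> \<Longrightarrow> x \<in> pg_carrier \<L> \<Longrightarrow> conj_eq \<L> P x R \<Longrightarrow> R \<subseteq> S \<Longrightarrow> R \<in> \<Delta>"
    and objects_overgroup_closed:
      "P \<in> \<Delta> \<Longrightarrow> pg_subgroup \<L> R \<Longrightarrow> P \<subseteq> R \<Longrightarrow> R \<subseteq> S \<Longrightarrow> R \<in> \<Delta>"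
    and dom_iff_objects:
      "u \<in> lists (pg_carrier \<L>) \<Longrightarrow> u \<in> pg_dom \<L> \<longleftrightarrow>
         (\<exists>P :: nat \<Rightarrow> 'a set. (\<forall>i\<le>length u. P i \<in> \<Delta>) \<and>
            (\<forall>i<length u. conj_eq \<L> (P i) (u ! i) (P (Suc i))))"

definition objective_characteristic :: "nat \<Rightarrow> 'a partial_group \<Rightarrow> 'a set set \<Rightarrow> bool" where
  "objective_characteristic p \<L> \<Delta> \<longleftrightarrow>
     (\<forall>P\<in>\<Delta>. characteristic_p p (pg_group \<L> (pg_normalizer \<L> P)))"

definition parabolic :: "'a partial_group \<Rightarrow> 'a set \<Rightarrow> 'a set \<Rightarrow> bool" where
  "parabolic \<L> S H \<longleftrightarrow> pg_subgroup \<L> H \<and> S \<subseteq> H"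

definition large :: "'a partial_group \<Rightarrow> 'a set \<Rightarrow> bool" where
  "large \<L> Q \<longleftrightarrow> pg_centralizer \<L> Q \<subseteq> Q \<and>
     (\<forall>U. pg_subgroup \<L> U \<and> U \<noteq> {pg_prod \<L> []} \<and> U \<subseteq> group_center (pg_group \<L> Q) \<longrightarrow>
        pg_normalizer \<L> U \<subseteq> pg_normalizer \<L> Q)"

definition replete :: "'a partial_group \<Rightarrow> 'a set set \<Rightarrow> 'a set \<Rightarrow> 'a set \<Rightarrow> bool" where
  "replete \<L> \<Delta> S Q \<longleftrightarrow> Q \<lhd> pg_group \<L> S \<and>
     (\<forall>U. pg_subgroup \<L> U \<and> U \<noteq> {pg_prod \<L> []} \<and> U \<subseteq> group_centralizer (pg_group \<L> S) Q \<longrightarrow>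
        U \<in> \<Delta>)"

text \<open>\<open>K\<^sup>\<circ> = \<langle>Q\<^sup>K\<rangle>\<close>, for a subgroup \<open>K\<close> containing \<open>Q\<close>.\<close>

definition conj_closure :: "'a partial_group \<Rightarrow> 'a set \<Rightarrow> 'a set \<Rightarrow> 'a set" where
  "conj_closure \<L> Q K = generate (pg_group \<L> K) (\<Union>k\<in>K. pg_conj \<L> k ` Q)"

text \<open>For a subgroup \<open>H\<close> of \<open>\<L>\<close>: \<open>O\<^sub>p(H)\<close> and \<open>Y\<^sub>H\<close>.\<close>

abbreviation pg_p_core :: "nat \<Rightarrow> 'a partial_group \<Rightarrow> 'a set \<Rightarrow> 'a set" where
  "pg_p_core p \<L> H \<equiv> p_core p (pg_group \<L> H)"

abbreviation pg_Y :: "nat \<Rightarrow> 'a partial_group \<Rightarrow> 'a set \<Rightarrow> 'a set" where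
  "pg_Y p \<L> H \<equiv> Y_sub p (pg_group \<L> H)"

text \<open>The sets \<open>\<C>\<^sub>\<L>\<close>, \<open>\<M>\<^sub>\<L>\<close> and \<open>\<M>\<^sub>\<L>(S)\<close>.\<close>

definition char_p_subgroups :: "nat \<Rightarrow> 'a partial_group \<Rightarrow> 'a set set" where
  "char_p_subgroups p \<L> =
     {H. pg_subgroup \<L> H \<and> pg_centralizer \<L> (pg_p_core p \<L> H) \<subseteq> pg_p_core p \<L> H}"

definition max_char_p_subgroups :: "nat \<Rightarrow> 'a partial_group \<Rightarrow> 'a set set" where
  "max_char_p_subgroups p \<L> =
     {M \<in> char_p_subgroups p \<L>. \<forall>H\<in>char_p_subgroups p \<L>. M \<subseteq> H \<longrightarrow> H = M}"

definition max_char_p_over :: "nat \<Rightarrow> 'a partial_group \<Rightarrow> 'a set \<Rightarrow> 'a set set" where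
  "max_char_p_over p \<L> S = {M \<in> max_char_p_subgroups p \<L>. S \<subseteq> M}"

text \<open>\<open>M\<^sup>\<dagger> = M C\<^sub>\<L>(Y\<^sub>M)\<close>\<close>

definition dagger :: "nat \<Rightarrow> 'a partial_group \<Rightarrow> 'a set \<Rightarrow> 'a set" where
  "dagger p \<L> M = pg_set_mult \<L> M (pg_centralizer \<L> (pg_Y p \<L> M))"

text \<open>The set \<open>\<MM>\<^sub>\<L>(S)\<close>.\<close>

definition frakM :: "nat \<Rightarrow> 'a partial_group \<Rightarrow> 'a set \<Rightarrow> 'a set set" where
  "frakM p \<L> S = {M \<in> char_p_subgroups p \<L>. S \<subseteq> M \<and>
     {N \<in> max_char_p_subgroups p \<L>. M \<subseteq> N} = {dagger p \<L> M} \<and>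
     pg_Y p \<L> M = pg_Y p \<L> (dagger p \<L> M) \<and>
     (let C = group_centralizer (pg_group \<L> M) (pg_Y p \<L> M);
          B = pg_p_core p \<L> M
      in (\<exists>!P. sylow_subgroup p (pg_group \<L> C) P) \<and>
         carrier (pg_group \<L> C Mod B) \<subseteq> frattini (pg_group \<L> M Mod B))}"

end

(*
The statement is about the finite groups N_L(P), P an object.

A parabolic subgroup H is contained in such a normalizer: testing membership in D of a word that
runs through H and its inverses yields an object P all of whose H-conjugates lie in S, so O_p(H)
is an object. Hence H has characteristic p. Repleteness makes Y_S, a non-trivial central subgroup
of S contained in every Y_H, an object; so each Y_H is an object and largeness gives
C(Y_H) <= C(Y_S) <= N(Q). Consequently conjugates of Q do not change if H is modified inside
H C(Y_H), which is what the statements on H-circle and on the normality of Q need.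

For the existence of M, choose H among all parabolic subgroups that contain some L* equivalent to
L modulo C(Y_L), with |Y_H| maximal, and put N = N(Y_H). Then Y_N = Y_H, and maximality of |Y_H|
makes N the only maximal member of C_L over any parabolic M <= N with Y_M = Y_N. Taking M minimal
with M C_N(Y_N) = N, the Frattini argument gives the conditions on C_M(Y_M); finally L* is replaced
by the intersection of M and L* C_N(Y_N).
*)
theory Submission
  imports Defs "HOL-Algebra.Group_Action" "HOL-Algebra.Sylow" "HOL-Algebra.SndIsomorphismGrp"
    "HOL-Algebra.Multiplicative_Group"
begin

section \<open>Sylow subgroups\<close>

text \<open>Two parabolic subgroups need not lie in a common subgroup, and the quotient G/C_G(A)
  behind p-reducedness changes with G. So p-reducedness is first rewritten through subgroups of S
  and equations k x k^-1 = y c with c centralizing A. In this form it can be followed from one group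
  to another: Y grows with the group when the larger group has characteristic p, and a candidate for
  K remains one for H if H and K agree modulo its centralizer.

  Monotonicity is also why |Y_H| is the quantity to maximize. The condition on H passes to every
  larger parabolic subgroup K, so Y_H <= Y_K forces Y_K = Y_H; since K normalizes Y_K, every
  competitor above H lies in N(Y_H).

  A minimal supplement M of C = C_N(Y_N) in N need not contain the subgroup \<open>Ls\<close> found
  in H. The Dedekind argument repairs this: (M \<inter> Ls C) C = Ls C, because M C = N. Products
  with C(Y_L), which need not lie in N, are compared in N(Y_L), again a group because Y_L is an
  object.\<close>

lemma (in group) inv_mult_cancel:
  assumes "x \<in> carrier G" "y \<in> carrier G"
  shows "inv x \<otimes> (x \<otimes> y) = y" "x \<otimes> (inv x \<otimes> y) = y"
  using assms by (simp_all add: m_assoc[symmetric])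

lemma (in group) inv_conj_mult:
  assumes "x \<in> carrier G" "y \<in> carrier G" "z \<in> carrier G"
  shows "inv x \<otimes> y \<otimes> x \<otimes> (inv x \<otimes> z \<otimes> x) = inv x \<otimes> (y \<otimes> z) \<otimes> x"
  using assms by (simp add: m_assoc inv_mult_cancel)

lemma (in group) carrier_normal: "carrier G \<lhd> G"
  using normal_invI[OF subgroup_self] by simp

text \<open>\<open>group_action\<close> wants values in \<open>BijGroup E\<close>, whose elements
  are extensional functions; the \<open>restrict\<close> lets an action be given by an ordinary
  function. Bijectivity comes from the action of the inverse element.\<close>

lemma group_actionI:
  fixes G (structure)
  assumes "group G"
    and cl: "\<And>g x. g \<in> carrier G \<Longrightarrow> x \<in> E \<Longrightarrow> \<phi> g x \<in> E"
    and one: "\<And>x. x \<in> E \<Longrightarrow> \<phi> \<one>\<^bsub>G\<^esub> x = x"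
    and mult: "\<And>g h x. g \<in> carrier G \<Longrightarrow> h \<in> carrier G \<Longrightarrow> x \<in> E \<Longrightarrow>
      \<phi> (g \<otimes>\<^bsub>G\<^esub> h) x = \<phi> g (\<phi> h x)"
  shows "group_action G E (\<lambda>g. restrict (\<phi> g) E)"
proof -
  interpret group G by fact
  have bij: "restrict (\<phi> g) E \<in> carrier (BijGroup E)" if g: "g \<in> carrier G" for g
  proof -
    have "\<phi> (inv g) (\<phi> g x) = x" "\<phi> g (\<phi> (inv g) x) = x" if "x \<in> E" for x
      using mult[of "inv g" g x] mult[of g "inv g" x] one g that by simp_all
    then have "bij_betw (\<phi> g) E E"
      using cl g by (intro bij_betwI[where g = "\<phi> (inv g)"]) auto
    then show ?thesis
      by (simp add: BijGroup_def Bij_def)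
  qed
  have "(\<lambda>g. restrict (\<phi> g) E) \<in> hom G (BijGroup E)"
  proof (rule homI)
    fix g h assume gh: "g \<in> carrier G" "h \<in> carrier G"
    have "restrict (\<phi> (g \<otimes> h)) E = compose E (restrict (\<phi> g) E) (restrict (\<phi> h) E)"
      by (rule ext) (auto simp: compose_def mult cl gh)
    then show "restrict (\<phi> (g \<otimes> h)) E =
        restrict (\<phi> g) E \<otimes>\<^bsub>BijGroup E\<^esub> restrict (\<phi> h) E"
      using bij[OF gh(1)] bij[OF gh(2)] by (simp add: BijGroup_def)
  qed (rule bij)
  then show ?thesis
    by (simp add: group_action_def group_hom_def group_hom_axioms_def group_BijGroup)
qed

text \<open>Orbit lengths divide p^n and their sum is prime to \<open>p\<close>. So some orbit has
  length prime to \<open>p\<close>, which for a power of \<open>p\<close> means length 1.\<close>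

lemma p_group_fixed_point:
  assumes "group G" and "prime p" and ord: "order G = p ^ n"
    and fin: "finite E" and ndvd: "\<not> p dvd card E"
    and cl: "\<And>g x. g \<in> carrier G \<Longrightarrow> x \<in> E \<Longrightarrow> \<phi> g x \<in> E"
    and one: "\<And>x. x \<in> E \<Longrightarrow> \<phi> \<one>\<^bsub>G\<^esub> x = x"
    and mult: "\<And>g h x. g \<in> carrier G \<Longrightarrow> h \<in> carrier G \<Longrightarrow> x \<in> E \<Longrightarrow>
      \<phi> (g \<otimes>\<^bsub>G\<^esub> h) x = \<phi> g (\<phi> h x)"
  obtains x where "x \<in> E" "\<And>g. g \<in> carrier G \<Longrightarrow> \<phi> g x = x"
proof -
  define \<psi> where "\<psi> = (\<lambda>g. restrict (\<phi> g) E)"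
  interpret group_action G E \<psi>
    unfolding \<psi>_def by (rule group_actionI) (use assms in auto)
  interpret partition E "orbits G E \<psi>"
    by (rule orbit_partition)
  have "\<exists>b\<in>orbits G E \<psi>. \<not> p dvd card b"
  proof (rule ccontr)
    assume "\<not> ?thesis"
    then have "p dvd (\<Sum>b\<in>orbits G E \<psi>. card b)"
      by (intro dvd_sum) auto
    moreover have "(\<Sum>b\<in>orbits G E \<psi>. card b) = card E"
      using disjoint_sum[OF fin, of "\<lambda>_. 1 :: nat"] by simp
    ultimately show False using ndvd by simp
  qed
  then obtain x where x: "x \<in> E" "\<not> p dvd card (orbit G \<psi> x)"
    by (auto simp: orbits_def)
  have "card (orbit G \<psi> x) dvd p ^ n"
    using orbit_stabilizer_theorem[OF x(1)] ord by (metis dvd_triv_left)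
  then obtain k where "card (orbit G \<psi> x) = p ^ k"
    using divides_primepow_nat[OF \<open>prime p\<close>] by blast
  with x(2) have "card (orbit G \<psi> x) = 1"
    by (cases k) auto
  then obtain y where "orbit G \<psi> x = {y}"
    using card_1_singletonE by blast
  with orbit_refl[OF x(1)] have "orbit G \<psi> x = {x}" by auto
  then have "\<phi> g x = x" if "g \<in> carrier G" for g
    using that x(1) unfolding orbit_def \<psi>_def by auto
  with x(1) that show thesis by blast
qed

locale finite_group_prime = group G for G (structure) +
  fixes p :: nat
  assumes finite_carrier: "finite (carrier G)" and prime: "prime p"
begin

lemma finite_group_prime_subgroup:
  "subgroup K G \<Longrightarrow> finite_group_prime (G\<lparr>carrier := K\<rparr>) p"
  using prime subgroup_imp_group[of K] finite_subset[OF subgroup.subset finite_carrier]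
  by (auto simp: finite_group_prime_def finite_group_prime_axioms_def)

lemma finite_group_prime_Mod: "N \<lhd> G \<Longrightarrow> finite_group_prime (G Mod N) p"
  using finite_carrier prime normal.factorgroup_is_group[of N G]
  by (simp add: finite_group_prime_def finite_group_prime_axioms_def FactGroup_def RCOSETS_def)

lemma finite_subgroup: "subgroup K G \<Longrightarrow> finite K"
  using finite_carrier subgroup.subset finite_subset by metis

lemma card_subgroup_dvd:
  assumes "subgroup K G" "subgroup H G" "K \<subseteq> H"
  shows "card K dvd card H"
proof -
  have "card (rcosets\<^bsub>G\<lparr>carrier := H\<rparr>\<^esub> K) * card K = order (G\<lparr>carrier := H\<rparr>)"
    by (rule group.lagrange[OF subgroup_imp_group[OF assms(2)] subgroup_incl[OF assms]])
  then have "card H = card (rcosets\<^bsub>G\<lparr>carrier := H\<rparr>\<^esub> K) * card K"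
    by (simp add: order_def)
  then show ?thesis by simp
qed

lemma p_subgroup_mono:
  assumes "p_subgroup p G P" "subgroup R G" "R \<subseteq> P"
  shows "p_subgroup p G R"
proof -
  have "card R dvd card P" using assms card_subgroup_dvd p_subgroup_def by metis
  then show ?thesis
    using assms divides_primepow_nat[OF prime] unfolding p_subgroup_def by metis
qed

lemma p_subgroup_conj:
  assumes P: "p_subgroup p G P" and g: "g \<in> carrier G"
  shows "p_subgroup p G ((\<lambda>x. g \<otimes> x \<otimes> inv g) ` P)"
proof -
  have sub: "subgroup P G" using P by (simp add: p_subgroup_def)
  have "inj_on (\<lambda>x. g \<otimes> x \<otimes> inv g) P"
    using conjugation_is_inj[OF g] subgroup.subset[OF sub] by (intro inj_onI) blast
  moreover have "(\<lambda>x. g \<otimes> x \<otimes> inv g) ` P = g <# P #> inv g"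
    by (auto simp: l_coset_def r_coset_def)
  ultimately show ?thesis
    using P subgroup_conjugation_is_surj2[OF g sub] unfolding p_subgroup_def by (metis card_image)
qed

lemma sylow_imp_p_subgroup: "sylow_subgroup p G S \<Longrightarrow> p_subgroup p G S"
  by (auto simp: sylow_subgroup_def p_subgroup_def)

lemma order_pos: "order G > 0"
  using order_gt_0_iff_finite finite_carrier by blast

lemma p_power_dvd_order:
  assumes "subgroup K G" "card K = p ^ n"
  shows "n \<le> multiplicity p (order G)"
proof -
  have "p ^ n dvd order G"
    using assms card_subgroup_dvd[OF assms(1) subgroup_self] subgroup.subset
    by (metis order_def)
  then show ?thesis
    using order_pos prime by (intro multiplicity_geI) (auto simp: prime_gt_0_nat)
qed

lemma sylow_index:
  assumes "sylow_subgroup p G S"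
  shows "\<not> p dvd card (rcosets S)"
proof
  assume "p dvd card (rcosets S)"
  then have "p ^ Suc (multiplicity p (order G)) dvd card (rcosets S) * card S"
    using assms by (auto simp: sylow_subgroup_def intro: mult_dvd_mono)
  also have "card (rcosets S) * card S = order G"
    using assms lagrange unfolding sylow_subgroup_def by metis
  finally show False
    using order_pos prime by (metis multiplicity_geI not_less_eq_eq order_refl
        not_prime_unit neq0_conv)
qed

lemma sylow_exists: "\<exists>S. sylow_subgroup p G S"
proof -
  obtain m where "order G = p ^ multiplicity p (order G) * m"
    using multiplicity_dvd[of p "order G"] by (auto elim: dvdE)
  then show ?thesis
    using sylow_thm[OF prime is_group _ finite_carrier] by (simp add: sylow_subgroup_def)
qed

text \<open>Right multiplication by inverses makes \<open>P\<close> act on the right cosets of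
  \<open>S\<close>; a fixed coset \<open>S #> a\<close> says that a P a^-1 lies in \<open>S\<close>.
  The restriction is on the index of \<open>S\<close> and not on its order, because the lemma is
  later applied to the preimage of a maximal subgroup as well as to Sylow subgroups.\<close>

lemma p_subgroup_conj_into:
  assumes S: "subgroup S G" and ind: "\<not> p dvd card (rcosets S)" and P: "p_subgroup p G P"
  obtains g where "g \<in> carrier G" "\<And>x. x \<in> P \<Longrightarrow> g \<otimes> x \<otimes> inv g \<in> S"
proof -
  have Psub: "subgroup P G" using P by (simp add: p_subgroup_def)
  note [simp] = subgroup.mem_carrier[OF Psub] subgroup.m_inv_closed[OF Psub]
  obtain n where n: "order (G\<lparr>carrier := P\<rparr>) = p ^ n"
    using P by (auto simp: p_subgroup_def order_def)
  have car: "X \<subseteq> carrier G" if "X \<in> rcosets S" for X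
    using subgroup.rcosets_carrier[OF S is_group that] .
  obtain X where X: "X \<in> rcosets S"
    and fixX: "\<And>g. g \<in> carrier (G\<lparr>carrier := P\<rparr>) \<Longrightarrow> X #> inv g = X"
  proof (rule p_group_fixed_point[OF subgroup_imp_group[OF Psub] prime n _ ind,
        where \<phi> = "\<lambda>g X. X #> inv g"])
    show "finite (rcosets S)"
      using finite_carrier by (simp add: RCOSETS_def)
    fix g X assume "g \<in> carrier (G\<lparr>carrier := P\<rparr>)" and X: "X \<in> rcosets S"
    then have g: "g \<in> P" by simp
    obtain a where "a \<in> carrier G" "X = S #> a"
      using X by (auto simp: RCOSETS_def)
    then have "X #> inv g = S #> (a \<otimes> inv g)"
      using g coset_mult_assoc[OF subgroup.subset[OF S]] by simp
    then show "X #> inv g \<in> rcosets S"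
      using g \<open>a \<in> carrier G\<close> subgroup.subset[OF S] by (auto intro!: rcosetsI)
  next
    fix X assume "X \<in> rcosets S"
    then show "X #> inv \<one>\<^bsub>G\<lparr>carrier := P\<rparr>\<^esub> = X" using car by simp
  next
    fix g h X assume "g \<in> carrier (G\<lparr>carrier := P\<rparr>)" "h \<in> carrier (G\<lparr>carrier := P\<rparr>)"
      and "X \<in> rcosets S"
    then show "X #> inv (g \<otimes>\<^bsub>G\<lparr>carrier := P\<rparr>\<^esub> h) = (X #> inv h) #> inv g"
      using car by (simp add: inv_mult_group coset_mult_assoc)
  qed blast
  obtain a where a: "a \<in> carrier G" "X = S #> a"
    using X by (auto simp: RCOSETS_def)
  have "a \<otimes> x \<otimes> inv a \<in> S" if x: "x \<in> P" for x
  proof -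
    have "S #> (a \<otimes> x) = S #> a"
      using fixX[of "inv x"] x a coset_mult_assoc[OF subgroup.subset[OF S] a(1), of x] by simp
    then have "a \<otimes> x \<in> S #> a"
      using rcos_self[OF _ S, of "a \<otimes> x"] a(1) x by simp
    then show ?thesis
      using subgroup.rcos_module_imp[OF S is_group a(1)] by blast
  qed
  with a(1) that show thesis by blast
qed

lemma sylow_conj:
  assumes "sylow_subgroup p G S" and "p_subgroup p G P"
  obtains g where "g \<in> carrier G" "\<And>x. x \<in> P \<Longrightarrow> g \<otimes> x \<otimes> inv g \<in> S"
  using p_subgroup_conj_into[OF _ sylow_index] assms by (metis sylow_subgroup_def)

text \<open>Some conjugate of \<open>S\<close> lies in a Sylow subgroup \<open>T\<close>; conjugated
  back, \<open>T\<close> becomes a \<open>p\<close>-subgroup above \<open>S\<close> and so equals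
  it. This converts the maximality of \<open>S\<close> in a locality into the Sylow condition in
  every parabolic subgroup.\<close>

lemma maximal_p_subgroup_sylow:
  assumes S: "p_subgroup p G S"
    and max: "\<And>P. p_subgroup p G P \<Longrightarrow> S \<subseteq> P \<Longrightarrow> P = S"
  shows "sylow_subgroup p G S"
proof -
  obtain T where T: "sylow_subgroup p G T" using sylow_exists by blast
  obtain g where g: "g \<in> carrier G" "\<And>x. x \<in> S \<Longrightarrow> g \<otimes> x \<otimes> inv g \<in> T"
    using sylow_conj[OF T S] by blast
  define T' where "T' = (\<lambda>x. inv g \<otimes> x \<otimes> inv (inv g)) ` T"
  have "x \<in> T'" if "x \<in> S" for x
  proof -
    have "x \<in> carrier G" using that S subgroup.mem_carrier p_subgroup_def by metis
    then have "x = inv g \<otimes> (g \<otimes> x \<otimes> inv g) \<otimes> inv (inv g)"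
      using g(1) by (simp add: m_assoc) (metis inv_closed l_inv l_one m_assoc)
    then show ?thesis using g(2)[OF that] unfolding T'_def by blast
  qed
  then have "T' = S"
    using max[of T'] p_subgroup_conj[OF sylow_imp_p_subgroup[OF T], of "inv g"] g(1)
    unfolding T'_def by blast
  moreover have "card T' = card T"
    unfolding T'_def
    using conjugation_is_inj[of "inv g"] g(1) T subgroup.subset[of T G]
    by (intro card_image inj_onI) (metis sylow_subgroup_def inv_closed subsetD)
  ultimately show ?thesis
    using T S by (simp add: sylow_subgroup_def p_subgroup_def)
qed

lemma sylow_maximal:
  assumes S: "sylow_subgroup p G S" and P: "p_subgroup p G P" and "S \<subseteq> P"
  shows "P = S"
proof -
  obtain n where "card P = p ^ n" using P by (auto simp: p_subgroup_def)
  then have "card P \<le> card S"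
    using p_power_dvd_order[of P n] P S power_increasing[OF _ prime_ge_1_nat[OF prime]]
    by (metis sylow_subgroup_def p_subgroup_def)
  moreover have "finite P" using P finite_subgroup p_subgroup_def by metis
  ultimately show ?thesis using \<open>S \<subseteq> P\<close> card_seteq by metis
qed

lemma normal_p_subgroup_subset_sylow:
  assumes S: "sylow_subgroup p G S" and P: "p_subgroup p G P" and N: "P \<lhd> G"
  shows "P \<subseteq> S"
proof
  obtain g where g: "g \<in> carrier G" "\<And>x. x \<in> P \<Longrightarrow> g \<otimes> x \<otimes> inv g \<in> S"
    using sylow_conj[OF S P] by blast
  fix x assume x: "x \<in> P"
  then have xc: "x \<in> carrier G" using P subgroup.mem_carrier p_subgroup_def by metis
  have "inv g \<otimes> x \<otimes> g \<in> P" using normal.inv_op_closed1[OF N g(1) x] .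
  from g(2)[OF this] have "g \<otimes> (inv g \<otimes> x \<otimes> g) \<otimes> inv g \<in> S" .
  then show "x \<in> S" using conjugation_is_surj[OF g(1) xc] by simp
qed

section \<open>The subgroup \<open>O\<^sub>p(G)\<close>\<close>

lemma set_mult_normal_subgroup:
  assumes "subgroup P G" "C \<lhd> G" shows "subgroup (P <#> C) G"
proof -
  interpret second_isomorphism_grp C G P
    using assms by (simp add: second_isomorphism_grp_def second_isomorphism_grp_axioms_def)
  show ?thesis using normal_set_mult_subgroup commut_normal[OF assms] by simp
qed

lemma set_mult_normal:
  assumes "P \<lhd> G" "C \<lhd> G" shows "P <#> C \<lhd> G"
proof (rule normal_invI[OF set_mult_normal_subgroup])
  show "subgroup P G" "C \<lhd> G" using assms normal_imp_subgroup by auto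
  fix x h assume x: "x \<in> carrier G" and "h \<in> P <#> C"
  then obtain a c where ac: "a \<in> P" "c \<in> C" "h = a \<otimes> c" by (auto simp: set_mult_def)
  have [simp]: "a \<in> carrier G" "c \<in> carrier G"
    using ac assms normal_imp_subgroup subgroup.mem_carrier by metis+
  have "x \<otimes> h \<otimes> inv x = (x \<otimes> a \<otimes> inv x) \<otimes> (x \<otimes> c \<otimes> inv x)"
    using x ac(3) by (simp add: m_assoc) (metis \<open>c \<in> carrier G\<close> inv_closed l_inv l_one m_assoc m_closed)
  then show "x \<otimes> h \<otimes> inv x \<in> P <#> C"
    using normal.inv_op_closed2[OF assms(1) x ac(1)] normal.inv_op_closed2[OF assms(2) x ac(2)]
    by (auto simp: set_mult_def)
qed

text \<open>That the product is a \<open>p\<close>-group needs no counting: a Sylow subgroup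
  contains every normal \<open>p\<close>-subgroup, hence both factors.\<close>

lemma normal_p_subgroup_mult:
  assumes "P \<lhd> G" "p_subgroup p G P" "R \<lhd> G" "p_subgroup p G R"
  shows "P <#> R \<lhd> G" "p_subgroup p G (P <#> R)" "P \<subseteq> P <#> R" "R \<subseteq> P <#> R"
proof -
  obtain S where S: "sylow_subgroup p G S" using sylow_exists by blast
  have sub: "subgroup P G" "subgroup R G" "subgroup S G"
    using assms S by (auto simp: p_subgroup_def sylow_subgroup_def)
  show n: "P <#> R \<lhd> G" using set_mult_normal assms by blast
  have "P <#> R \<subseteq> S"
    using normal_p_subgroup_subset_sylow[OF S] assms subgroup.m_closed[OF sub(3)]
    by (fastforce simp: set_mult_def)
  then show "p_subgroup p G (P <#> R)"
    using p_subgroup_mono[OF sylow_imp_p_subgroup[OF S] normal_imp_subgroup[OF n]] by simp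
  show "P \<subseteq> P <#> R"
    using subgroup.one_closed[OF sub(2)] r_one[OF subgroup.mem_carrier[OF sub(1)]]
    by (force simp: set_mult_def)
  show "R \<subseteq> P <#> R"
    using subgroup.one_closed[OF sub(1)] l_one[OF subgroup.mem_carrier[OF sub(2)]]
    by (force simp: set_mult_def)
qed

text \<open>\<open>GREATEST\<close> is meaningful only once a greatest element exists. In a finite
  group a member of largest cardinality already equals any upper bound that it shares with another
  member. Serves both O_p and Y.\<close>

lemma Greatest_by_join:
  assumes ex: "A0 \<subseteq> carrier G" "Pr A0"
    and car: "\<And>A. Pr A \<Longrightarrow> A \<subseteq> carrier G"
    and join: "\<And>A B. Pr A \<Longrightarrow> Pr B \<Longrightarrow> \<exists>D. Pr D \<and> A \<subseteq> D \<and> B \<subseteq> D"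
  shows "Pr (GREATEST A. Pr A) \<and> (\<forall>B. Pr B \<longrightarrow> B \<subseteq> (GREATEST A. Pr A))"
proof -
  have bnd: "\<forall>A. Pr A \<longrightarrow> card A \<le> card (carrier G)"
    using car card_mono[OF finite_carrier] by blast
  obtain A where A: "Pr A" "\<And>B. Pr B \<Longrightarrow> card B \<le> card A"
    using ex_has_greatest_nat[of Pr A0 card, OF ex(2)] bnd by (metis less_Suc_eq_le)
  have "B \<subseteq> A" if B: "Pr B" for B
  proof -
    obtain D where D: "Pr D" "A \<subseteq> D" "B \<subseteq> D" using join[OF A(1) B] by blast
    then have "A = D"
      using A(2)[OF D(1)] car[OF D(1)] finite_subset[OF _ finite_carrier] card_seteq by metis
    with D show ?thesis by simp
  qed
  then have "(GREATEST A. Pr A) = A" using A(1) by (intro Greatest_equality)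
  with A(1) \<open>\<And>B. Pr B \<Longrightarrow> B \<subseteq> A\<close> show ?thesis by simp
qed

lemma one_p_subgroup: "p_subgroup p G {\<one>}"
  by (auto simp: p_subgroup_def triv_subgroup intro: exI[of _ 0])

lemma p_core_greatest:
  "(p_core p G \<lhd> G \<and> p_subgroup p G (p_core p G)) \<and>
     (\<forall>P. P \<lhd> G \<and> p_subgroup p G P \<longrightarrow> P \<subseteq> p_core p G)"
  unfolding p_core_def
proof (rule Greatest_by_join)
  show "{\<one>} \<lhd> G \<and> p_subgroup p G {\<one>}"
    using one_is_normal one_p_subgroup by blast
next
  fix A assume "A \<lhd> G \<and> p_subgroup p G A"
  then show "A \<subseteq> carrier G" by (metis normal_imp_subgroup subgroup.subset)
next
  fix A B assume "A \<lhd> G \<and> p_subgroup p G A" "B \<lhd> G \<and> p_subgroup p G B"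
  then show "\<exists>D. (D \<lhd> G \<and> p_subgroup p G D) \<and> A \<subseteq> D \<and> B \<subseteq> D"
    using normal_p_subgroup_mult[of A B] by metis
qed simp

lemma p_core_normal: "p_core p G \<lhd> G"
  and p_core_p_subgroup: "p_subgroup p G (p_core p G)"
  and p_core_upper: "P \<lhd> G \<Longrightarrow> p_subgroup p G P \<Longrightarrow> P \<subseteq> p_core p G"
  using p_core_greatest by metis+

lemma p_core_subset_sylow: "sylow_subgroup p G S \<Longrightarrow> p_core p G \<subseteq> S"
  using normal_p_subgroup_subset_sylow p_core_normal p_core_p_subgroup by blast

end

section \<open>Homomorphic images, and normality and centralizers relative to a subgroup\<close>

lemma p_subgroup_hom_image:
  assumes h: "group_hom G H h" and "prime p" and P: "p_subgroup p G P"
  shows "p_subgroup p H (h ` P)"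
proof -
  interpret group_hom G H h by fact
  have sub: "subgroup P G" using P by (simp add: p_subgroup_def)
  have im: "subgroup (h ` P) H" using subgroup_img_is_subgroup[OF sub] .
  have gh: "group_hom (G\<lparr>carrier := P\<rparr>) (H\<lparr>carrier := h ` P\<rparr>) h"
    using G.subgroup_imp_group[OF sub] H.subgroup_imp_group[OF im] subgroup.mem_carrier[OF sub]
    by (auto simp: group_hom_def group_hom_axioms_def hom_def)
  let ?K = "kernel (G\<lparr>carrier := P\<rparr>) (H\<lparr>carrier := h ` P\<rparr>) h"
  have "(\<lambda>X. the_elem (h ` X)) \<in> iso (G\<lparr>carrier := P\<rparr> Mod ?K) (H\<lparr>carrier := h ` P\<rparr>)"
    by (rule group_hom.FactGroup_iso_set[OF gh]) simp
  then have "card (rcosets\<^bsub>G\<lparr>carrier := P\<rparr>\<^esub> ?K) = card (h ` P)"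
    by (auto simp: iso_def FactGroup_def dest: bij_betw_same_card)
  moreover have "card (rcosets\<^bsub>G\<lparr>carrier := P\<rparr>\<^esub> ?K) * card ?K = card P"
    using group.lagrange[OF G.subgroup_imp_group[OF sub] group_hom.subgroup_kernel[OF gh]]
    by (simp add: order_def)
  ultimately have "card (h ` P) dvd card P" by (metis dvd_triv_left)
  then show ?thesis
    using P im divides_primepow_nat[OF \<open>prime p\<close>] unfolding p_subgroup_def by metis
qed

lemma normal_hom_Mod:
  assumes "N \<lhd> G" shows "group_hom G (G Mod N) (\<lambda>x. N #>\<^bsub>G\<^esub> x)"
  using assms normal.factorgroup_is_group[OF assms] normal.r_coset_hom_Mod[OF assms]
  by (simp add: group_hom_def group_hom_axioms_def normal_def)

context group begin

lemma normal_in_subgroup_iff: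
  assumes K: "subgroup K G"
  shows "A \<lhd> G\<lparr>carrier := K\<rparr> \<longleftrightarrow>
    subgroup A G \<and> A \<subseteq> K \<and> (\<forall>k\<in>K. \<forall>a\<in>A. k \<otimes> a \<otimes> inv k \<in> A)"
proof -
  have "subgroup A (G\<lparr>carrier := K\<rparr>) \<longleftrightarrow> subgroup A G \<and> A \<subseteq> K"
    using incl_subgroup[OF K, of A] subgroup_incl[OF _ K, of A]
      subgroup.subset[of A "G\<lparr>carrier := K\<rparr>"] by auto
  then show ?thesis
    using m_inv_consistent[OF K]
    unfolding group.normal_inv_iff[OF subgroup_imp_group[OF K], of A] by simp
qed

lemma group_centralizer_subgroup:
  assumes "A \<subseteq> carrier G" shows "subgroup (group_centralizer G A) G"
proof (rule subgroupI)
  show "group_centralizer G A \<subseteq> carrier G" by (auto simp: group_centralizer_def)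
  have "\<one> \<in> group_centralizer G A" using assms by (auto simp: group_centralizer_def subset_iff)
  then show "group_centralizer G A \<noteq> {}" by blast
  fix a assume "a \<in> group_centralizer G A"
  then have a: "a \<in> carrier G" "\<And>x. x \<in> A \<Longrightarrow> a \<otimes> x = x \<otimes> a"
    by (auto simp: group_centralizer_def)
  have "inv a \<otimes> x = x \<otimes> inv a" if "x \<in> A" for x
  proof -
    have xc: "x \<in> carrier G" using assms that by blast
    have "a \<otimes> (x \<otimes> inv a) = (a \<otimes> x) \<otimes> inv a" using a(1) xc by (simp add: m_assoc)
    also have "\<dots> = x" using a xc that by (simp add: m_assoc)
    finally show ?thesis using a(1) xc by (metis inv_closed inv_solve_left m_closed)
  qed
  with a show "inv a \<in> group_centralizer G A" by (simp add: group_centralizer_def)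
next
  fix a b assume "a \<in> group_centralizer G A" "b \<in> group_centralizer G A"
  then have ab: "a \<in> carrier G" "\<And>x. x \<in> A \<Longrightarrow> a \<otimes> x = x \<otimes> a"
    "b \<in> carrier G" "\<And>x. x \<in> A \<Longrightarrow> b \<otimes> x = x \<otimes> b"
    by (auto simp: group_centralizer_def)
  have "a \<otimes> b \<otimes> x = x \<otimes> (a \<otimes> b)" if "x \<in> A" for x
  proof -
    have xc: "x \<in> carrier G" using assms that by blast
    have "a \<otimes> b \<otimes> x = a \<otimes> (x \<otimes> b)" using ab that xc by (simp add: m_assoc)
    also have "\<dots> = (a \<otimes> x) \<otimes> b" using ab(1,3) xc by (simp add: m_assoc)
    also have "\<dots> = x \<otimes> (a \<otimes> b)" using ab(1,3) ab(2)[OF that] xc by (simp add: m_assoc)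
    finally show ?thesis .
  qed
  with ab show "a \<otimes> b \<in> group_centralizer G A" by (simp add: group_centralizer_def)
qed

text \<open>Stated for a single element normalizing \<open>A\<close>, because \<open>A\<close> is
  not assumed normal in the ambient group when two of its subgroups are compared.\<close>

lemma conj_centralizer:
  assumes A: "subgroup A G" and k: "k \<in> carrier G"
    and norm: "\<And>a. a \<in> A \<Longrightarrow> inv k \<otimes> a \<otimes> k \<in> A" and c: "c \<in> group_centralizer G A"
  shows "k \<otimes> c \<otimes> inv k \<in> group_centralizer G A"
proof -
  have cc: "c \<in> carrier G" using c by (simp add: group_centralizer_def)
  have "k \<otimes> c \<otimes> inv k \<otimes> a = a \<otimes> (k \<otimes> c \<otimes> inv k)" if a: "a \<in> A" for a
  proof -
    have ac: "a \<in> carrier G" using a subgroup.mem_carrier[OF A] by blast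
    have "c \<otimes> (inv k \<otimes> a \<otimes> k) = (inv k \<otimes> a \<otimes> k) \<otimes> c"
      using c norm[OF a] by (simp add: group_centralizer_def)
    then have "k \<otimes> (c \<otimes> (inv k \<otimes> a \<otimes> k)) \<otimes> inv k = k \<otimes> ((inv k \<otimes> a \<otimes> k) \<otimes> c) \<otimes> inv k"
      by simp
    moreover have "k \<otimes> (c \<otimes> (inv k \<otimes> a \<otimes> k)) \<otimes> inv k = k \<otimes> c \<otimes> inv k \<otimes> a"
      using k ac cc by (simp add: m_assoc)
    moreover have "k \<otimes> ((inv k \<otimes> a \<otimes> k) \<otimes> c) \<otimes> inv k = a \<otimes> (k \<otimes> c \<otimes> inv k)"
      using k ac cc by (simp add: m_assoc) (metis inv_closed m_assoc m_closed r_inv l_one)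
    ultimately show ?thesis by simp
  qed
  with k cc show ?thesis by (simp add: group_centralizer_def)
qed

lemma group_centralizer_normal:
  assumes "A \<lhd> G" shows "group_centralizer G A \<lhd> G"
proof (rule normal_invI)
  have A: "subgroup A G" using assms normal_imp_subgroup by blast
  then show "subgroup (group_centralizer G A) G"
    using group_centralizer_subgroup subgroup.subset by metis
  fix x h assume "x \<in> carrier G" "h \<in> group_centralizer G A"
  then show "x \<otimes> h \<otimes> inv x \<in> group_centralizer G A"
    using conj_centralizer[OF A] normal.inv_op_closed1[OF assms] by blast
qed

lemma elementary_abelian_iff:
  fixes p :: nat
  assumes A: "subgroup A G"
  shows "elementary_abelian p (G\<lparr>carrier := A\<rparr>) \<longleftrightarrow>
    (\<forall>a\<in>A. \<forall>b\<in>A. a \<otimes> b = b \<otimes> a) \<and> (\<forall>a\<in>A. a [^] p = \<one>)"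
proof -
  have "comm_group (G\<lparr>carrier := A\<rparr>) \<longleftrightarrow> (\<forall>a\<in>A. \<forall>b\<in>A. a \<otimes> b = b \<otimes> a)"
  proof
    assume "comm_group (G\<lparr>carrier := A\<rparr>)"
    then interpret C: comm_group "G\<lparr>carrier := A\<rparr>" .
    show "\<forall>a\<in>A. \<forall>b\<in>A. a \<otimes> b = b \<otimes> a" using C.m_comm by simp
  next
    assume "\<forall>a\<in>A. \<forall>b\<in>A. a \<otimes> b = b \<otimes> a"
    then show "comm_group (G\<lparr>carrier := A\<rparr>)"
      by (intro group.group_comm_groupI[OF subgroup_imp_group[OF A]]) auto
  qed
  then show ?thesis
    using nat_pow_consistent[symmetric, where n = p and H = A] by (auto simp: elementary_abelian_def)
qed

lemma group_centralizer_restrict: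
  "K \<subseteq> carrier G \<Longrightarrow> group_centralizer (G\<lparr>carrier := K\<rparr>) A = K \<inter> group_centralizer G A"
  by (auto simp: group_centralizer_def)

end

context finite_group_prime begin

lemma p_subgroup_restrict_iff:
  assumes K: "subgroup K G"
  shows "p_subgroup p (G\<lparr>carrier := K\<rparr>) P \<longleftrightarrow> p_subgroup p G P \<and> P \<subseteq> K"
  using incl_subgroup[OF K, of P] subgroup_incl[OF _ K, of P]
    subgroup.subset[of P "G\<lparr>carrier := K\<rparr>"]
  by (auto simp: p_subgroup_def)

lemma sylow_restrict:
  assumes K: "subgroup K G" and S: "sylow_subgroup p G S" and "S \<subseteq> K"
  shows "sylow_subgroup p (G\<lparr>carrier := K\<rparr>) S"
proof -
  interpret K: finite_group_prime "G\<lparr>carrier := K\<rparr>" p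
    by (rule finite_group_prime_subgroup[OF K])
  show ?thesis
  proof (rule K.maximal_p_subgroup_sylow)
    show "p_subgroup p (G\<lparr>carrier := K\<rparr>) S"
      using p_subgroup_restrict_iff[OF K] sylow_imp_p_subgroup[OF S] assms(3) by simp
    fix P assume "p_subgroup p (G\<lparr>carrier := K\<rparr>) P" "S \<subseteq> P"
    then show "P = S"
      using p_subgroup_restrict_iff[OF K] sylow_maximal[OF S] by simp
  qed
qed

text \<open>A Sylow subgroup of \<open>N\<close> has a conjugate inside \<open>S\<close>, which
  stays in \<open>N\<close> by normality. So S \<inter> N is at least as large, and being a
  \<open>p\<close>-subgroup of \<open>N\<close> it cannot be larger.\<close>

lemma normal_inter_sylow:
  assumes N: "N \<lhd> G" and S: "sylow_subgroup p G S"
  shows "sylow_subgroup p (G\<lparr>carrier := N\<rparr>) (S \<inter> N)"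
proof -
  have Ns: "subgroup N G" and Ss: "subgroup S G"
    using N S normal_imp_subgroup by (auto simp: sylow_subgroup_def)
  interpret N: finite_group_prime "G\<lparr>carrier := N\<rparr>" p
    by (rule finite_group_prime_subgroup[OF Ns])
  have SN: "p_subgroup p (G\<lparr>carrier := N\<rparr>) (S \<inter> N)"
    using p_subgroup_restrict_iff[OF Ns] subgroups_Inter_pair[OF Ss Ns]
      p_subgroup_mono[OF sylow_imp_p_subgroup[OF S]] by simp
  obtain T where T: "sylow_subgroup p (G\<lparr>carrier := N\<rparr>) T" using N.sylow_exists by blast
  have TG: "p_subgroup p G T" "T \<subseteq> N"
    using N.sylow_imp_p_subgroup[OF T] p_subgroup_restrict_iff[OF Ns] by auto
  obtain g where g: "g \<in> carrier G" "\<And>x. x \<in> T \<Longrightarrow> g \<otimes> x \<otimes> inv g \<in> S"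
    using sylow_conj[OF S TG(1)] by blast
  have "(\<lambda>x. g \<otimes> x \<otimes> inv g) ` T \<subseteq> S \<inter> N"
    using g normal.inv_op_closed2[OF N g(1)] TG(2) by blast
  moreover have "inj_on (\<lambda>x. g \<otimes> x \<otimes> inv g) T"
    using conjugation_is_inj[OF g(1)] TG(2) subgroup.subset[OF Ns] by (intro inj_onI) blast
  ultimately have le: "card T \<le> card (S \<inter> N)"
    using finite_subgroup[OF Ns] by (metis card_inj_on_le finite_Int)
  obtain n where n: "card (S \<inter> N) = p ^ n" using SN by (auto simp: p_subgroup_def)
  then have "n \<le> multiplicity p (order (G\<lparr>carrier := N\<rparr>))"
    using SN N.p_power_dvd_order by (auto simp: p_subgroup_def)
  then have "card (S \<inter> N) \<le> card T"
    using T n power_increasing[OF _ prime_ge_1_nat[OF prime]] by (auto simp: sylow_subgroup_def)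
  with le SN T show ?thesis by (simp add: sylow_subgroup_def p_subgroup_def)
qed

section \<open>The subgroup \<open>Y\<^sub>G\<close>\<close>

text \<open>Let D = (S \<inter> R) C. The index |R : D| divides |R : C| = p^n, so it is a power of
  \<open>p\<close>; it is also prime to \<open>p\<close>, because D contains the Sylow subgroup S
  \<inter> R of \<open>R\<close>. Hence D = R. This lifts the \<open>p\<close>-group R/C to a
  subgroup of \<open>S\<close>.\<close>

lemma p_subgroup_normal_supplement:
  assumes S: "sylow_subgroup p G S" and C: "C \<lhd> G" and R: "R \<lhd> G" and CR: "C \<subseteq> R"
    and card: "card R = p ^ n * card C"
  shows "(S \<inter> R) <#> C = R"
proof -
  have Rs: "subgroup R G" and Cs: "subgroup C G"
    using R C normal_imp_subgroup by auto
  let ?P = "S \<inter> R"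
  have P: "sylow_subgroup p (G\<lparr>carrier := R\<rparr>) ?P" by (rule normal_inter_sylow[OF R S])
  then have Ps: "subgroup ?P G"
    using incl_subgroup[OF Rs] by (simp add: sylow_subgroup_def)
  let ?D = "?P <#> C"
  have D: "subgroup ?D G" by (rule set_mult_normal_subgroup[OF Ps C])
  have DR: "?D \<subseteq> R" using CR subgroup.m_closed[OF Rs] by (auto simp: set_mult_def)
  have PD: "?P \<subseteq> ?D"
    using subgroup.one_closed[OF Cs] r_one[OF subgroup.mem_carrier[OF Ps]]
    by (force simp: set_mult_def)
  have CD: "C \<subseteq> ?D"
    using subgroup.one_closed[OF Ps] l_one[OF subgroup.mem_carrier[OF Cs]]
    by (force simp: set_mult_def)
  obtain i where i: "card R = i * card ?D"
    using card_subgroup_dvd[OF D Rs DR] by (metis dvd_def mult.commute)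
  obtain j where j: "card ?D = j * card ?P"
    using card_subgroup_dvd[OF Ps D PD] by (metis dvd_def mult.commute)
  obtain l where l: "card ?D = l * card C"
    using card_subgroup_dvd[OF Cs D CD] by (metis dvd_def mult.commute)
  have "card C > 0" using finite_subgroup[OF Cs] subgroup.one_closed[OF Cs] card_gt_0_iff by blast
  then have "p ^ n = i * l" using i l card by simp
  then obtain m where m: "i = p ^ m"
    using divides_primepow_nat[OF prime] by (metis dvd_triv_left)
  have "m = 0"
  proof (rule ccontr)
    assume "m \<noteq> 0"
    then have "p ^ Suc (multiplicity p (card R)) dvd i * (j * card ?P)"
      using m P by (cases m) (auto simp: sylow_subgroup_def order_def)
    then have "p ^ Suc (multiplicity p (card R)) dvd card R"
      using i j by simp
    moreover have "card R > 0"
      using finite_subgroup[OF Rs] subgroup.one_closed[OF Rs] card_gt_0_iff by blast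
    ultimately show False
      using prime by (metis multiplicity_geI not_less_eq_eq order_refl
        not_prime_unit neq0_conv)
  qed
  then have "card R = card ?D" using i m by simp
  then show ?thesis using DR finite_subgroup[OF Rs] card_subset_eq by metis
qed

text \<open>A normal \<open>p\<close>-subgroup of \<open>G / C\<close>, \<open>C = C\<^sub>G(A)\<close>, has the form \<open>PC / C\<close> with \<open>P \<le> S\<close>, and \<open>PC\<close> is
  normal iff \<open>P\<^sup>k \<subseteq> PC\<close> for all \<open>k\<close>. This criterion involves no quotient, so it can be compared for
  different subgroups containing \<open>S\<close>.\<close>

lemma p_reduced_iff:
  assumes S: "sylow_subgroup p G S"
  shows "p_reduced p G A \<longleftrightarrow> A \<lhd> G \<and>
    (\<forall>P. subgroup P G \<longrightarrow> P \<subseteq> S \<longrightarrow>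
      (\<forall>k\<in>carrier G. \<forall>x\<in>P. \<exists>y\<in>P. \<exists>c\<in>group_centralizer G A. k \<otimes> x \<otimes> inv k = y \<otimes> c) \<longrightarrow>
      P \<subseteq> group_centralizer G A)"
proof (cases "A \<lhd> G")
  case A: True
  let ?C = "group_centralizer G A"
  have C: "?C \<lhd> G" by (rule group_centralizer_normal[OF A])
  then have Cs: "subgroup ?C G" by (rule normal_imp_subgroup)
  interpret Q: finite_group_prime "G Mod ?C" p by (rule finite_group_prime_Mod[OF C])
  interpret h: group_hom G "G Mod ?C" "\<lambda>x. ?C #> x" by (rule normal_hom_Mod[OF C])
  have one: "\<one>\<^bsub>G Mod ?C\<^esub> = ?C" by (simp add: FactGroup_def)
  have carQ: "carrier (G Mod ?C) = (\<lambda>x. ?C #> x) ` carrier G"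
    by (auto simp: FactGroup_def RCOSETS_def)
  show ?thesis
  proof (intro iffI conjI A allI impI)
    fix P assume red: "p_reduced p G A" and P: "subgroup P G" "P \<subseteq> S"
      and cond: "\<forall>k\<in>carrier G. \<forall>x\<in>P. \<exists>y\<in>P. \<exists>c\<in>?C. k \<otimes> x \<otimes> inv k = y \<otimes> c"
    have "p_subgroup p G P"
      using p_subgroup_mono[OF sylow_imp_p_subgroup[OF S] P] .
    then have pP: "p_subgroup p (G Mod ?C) ((\<lambda>x. ?C #> x) ` P)"
      by (rule p_subgroup_hom_image[OF h.group_hom_axioms prime])
    \<comment> \<open>Modulo the centralizer the factor \<open>c\<close> disappears, so the
      hypothesis says that conjugation maps the image of \<open>P\<close> into itself.\<close>
    moreover have "(\<lambda>x. ?C #> x) ` P \<lhd> G Mod ?C"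
    proof (rule Q.normal_invI)
      show "subgroup ((\<lambda>x. ?C #> x) ` P) (G Mod ?C)" using pP by (simp add: p_subgroup_def)
      fix X Y assume X: "X \<in> carrier (G Mod ?C)" and "Y \<in> (\<lambda>x. ?C #> x) ` P"
      then obtain k x where k: "k \<in> carrier G" "X = ?C #> k" and x: "x \<in> P" "Y = ?C #> x"
        using carQ by auto
      have xc: "x \<in> carrier G" using x P subgroup.mem_carrier by metis
      obtain y c where yc: "y \<in> P" "c \<in> ?C" "k \<otimes> x \<otimes> inv k = y \<otimes> c"
        using cond k x by metis
      have ycc: "y \<in> carrier G" "c \<in> carrier G"
        using yc P Cs subgroup.mem_carrier by metis+
      have "X \<otimes>\<^bsub>G Mod ?C\<^esub> Y \<otimes>\<^bsub>G Mod ?C\<^esub> inv\<^bsub>G Mod ?C\<^esub> X = ?C #> (k \<otimes> x \<otimes> inv k)"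
        using k x xc by simp
      also have "\<dots> = (?C #> y) \<otimes>\<^bsub>G Mod ?C\<^esub> (?C #> c)"
        using yc ycc by simp
      also have "?C #> c = \<one>\<^bsub>G Mod ?C\<^esub>"
        using yc(2) ycc(2) Cs one coset_join2 by simp
      also have "(?C #> y) \<otimes>\<^bsub>G Mod ?C\<^esub> \<one>\<^bsub>G Mod ?C\<^esub> = ?C #> y"
        by (rule Q.r_one[OF h.hom_closed[OF ycc(1)]])
      finally show "X \<otimes>\<^bsub>G Mod ?C\<^esub> Y \<otimes>\<^bsub>G Mod ?C\<^esub> inv\<^bsub>G Mod ?C\<^esub> X \<in> (\<lambda>x. ?C #> x) ` P"
        using yc ycc by simp
    qed
    ultimately have "(\<lambda>x. ?C #> x) ` P \<subseteq> {?C}"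
      using Q.p_core_upper red one by (auto simp: p_reduced_def)
    then have "?C #> x = ?C" if "x \<in> P" for x
      using that by blast
    then show "P \<subseteq> ?C"
      using coset_join1[OF _ subgroup.mem_carrier[OF P(1)] Cs] by blast
  next
    assume "A \<lhd> G \<and> (\<forall>P. subgroup P G \<longrightarrow> P \<subseteq> S \<longrightarrow>
      (\<forall>k\<in>carrier G. \<forall>x\<in>P. \<exists>y\<in>P. \<exists>c\<in>?C. k \<otimes> x \<otimes> inv k = y \<otimes> c) \<longrightarrow> P \<subseteq> ?C)"
    then have cond: "P \<subseteq> ?C" if "subgroup P G" "P \<subseteq> S"
      "\<forall>k\<in>carrier G. \<forall>x\<in>P. \<exists>y\<in>P. \<exists>c\<in>?C. k \<otimes> x \<otimes> inv k = y \<otimes> c" for P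
      using that by blast
    let ?O = "p_core p (G Mod ?C)"
    \<comment> \<open>The union of the cosets in O_p(G/C) is its full preimage R in
      \<open>G\<close>. It equals (S \<inter> R) C, and the criterion applied to S \<inter> R pushes
      it into C.\<close>
    let ?R = "\<Union>?O"
    have O: "subgroup ?O (G Mod ?C)" using Q.p_core_normal normal_imp_subgroup by blast
    have R: "?R \<lhd> G" by (rule normal.factgroup_subgroup_union_normal[OF C Q.p_core_normal])
    then have Rs: "subgroup ?R G" by (rule normal_imp_subgroup)
    have OR: "?O = rcosets\<^bsub>G\<lparr>carrier := ?R\<rparr>\<^esub> ?C"
      by (rule normal.factgroup_subgroup_union_factor[OF C O])
    have CR: "?C \<subseteq> ?R" using subgroup.one_closed[OF O] one by auto
    obtain n where n: "card ?O = p ^ n"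
      using Q.p_core_p_subgroup by (auto simp: p_subgroup_def)
    have "card ?R = p ^ n * card ?C"
      using group.lagrange[OF subgroup_imp_group[OF Rs] subgroup_incl[OF Cs Rs CR]] OR n
      by (simp add: order_def)
    then have sup: "(S \<inter> ?R) <#> ?C = ?R"
      by (rule p_subgroup_normal_supplement[OF S C R CR])
    have Ss: "subgroup S G" using S by (simp add: sylow_subgroup_def)
    have SRC: "S \<inter> ?R \<subseteq> ?C"
    proof (rule cond)
      show "subgroup (S \<inter> ?R) G" by (rule subgroups_Inter_pair[OF Ss Rs])
      show "\<forall>k\<in>carrier G. \<forall>x\<in>S \<inter> ?R. \<exists>y\<in>S \<inter> ?R. \<exists>c\<in>?C. k \<otimes> x \<otimes> inv k = y \<otimes> c"
      proof (intro ballI)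
        fix k x assume "k \<in> carrier G" "x \<in> S \<inter> ?R"
        then have "k \<otimes> x \<otimes> inv k \<in> (S \<inter> ?R) <#> ?C"
          using normal.inv_op_closed2[OF R] sup by blast
        then show "\<exists>y\<in>S \<inter> ?R. \<exists>c\<in>?C. k \<otimes> x \<otimes> inv k = y \<otimes> c"
          by (auto simp: set_mult_def)
      qed
    qed blast
    have "(S \<inter> ?R) <#> ?C \<subseteq> ?C"
      using SRC subgroup.m_closed[OF Cs] unfolding set_mult_def by blast
    then have RC: "?R \<subseteq> ?C" using sup by simp
    have "X = ?C" if "X \<in> ?O" for X
    proof -
      have "X \<in> rcosets\<^bsub>G\<lparr>carrier := ?R\<rparr>\<^esub> ?C" using that OR by metis
      then obtain x where "x \<in> ?R" "X = ?C #> x" unfolding RCOSETS_def by auto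
      then show ?thesis using RC Cs coset_join2 subgroup.mem_carrier[OF Cs] by blast
    qed
    then have "?O = {\<one>\<^bsub>G Mod ?C\<^esub>}"
      using subgroup.one_closed[OF O] one by auto
    then show "p_reduced p G A" using A by (simp add: p_reduced_def)
  qed
qed (simp add: p_reduced_def)

end

section \<open>Candidates for \<open>Y_sub\<close>, and their behaviour under products and change of
  group\<close>

definition Y_candidate :: "nat \<Rightarrow> ('a, 'b) monoid_scheme \<Rightarrow> 'a set \<Rightarrow> bool" where
  "Y_candidate p G A \<longleftrightarrow> A \<lhd> G \<and> p_subgroup p G A \<and>
      elementary_abelian p (G\<lparr>carrier := A\<rparr>) \<and> p_reduced p G A"

context finite_group_prime begin

text \<open>For normal \<open>A\<close>, being a \<open>p\<close>-subgroup is the same as lying in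
  \<open>S\<close>. No quotient and no restricted structure is left on the right, which is what
  makes candidates in different groups comparable.\<close>

lemma Y_candidate_iff:
  assumes S: "sylow_subgroup p G S"
  shows "Y_candidate p G A \<longleftrightarrow> A \<lhd> G \<and> A \<subseteq> S \<and>
    (\<forall>a\<in>A. \<forall>b\<in>A. a \<otimes> b = b \<otimes> a) \<and> (\<forall>a\<in>A. a [^] p = \<one>) \<and>
    (\<forall>P. subgroup P G \<longrightarrow> P \<subseteq> S \<longrightarrow>
      (\<forall>k\<in>carrier G. \<forall>x\<in>P. \<exists>y\<in>P. \<exists>c\<in>group_centralizer G A. k \<otimes> x \<otimes> inv k = y \<otimes> c) \<longrightarrow>
      P \<subseteq> group_centralizer G A)"
proof (cases "A \<lhd> G")
  case True
  then have A: "subgroup A G" by (rule normal_imp_subgroup)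
  have "p_subgroup p G A \<longleftrightarrow> A \<subseteq> S"
    using normal_p_subgroup_subset_sylow[OF S _ True]
      p_subgroup_mono[OF sylow_imp_p_subgroup[OF S] A] by blast
  then show ?thesis
    unfolding Y_candidate_def elementary_abelian_iff[OF A] p_reduced_iff[OF S] by blast
qed (simp add: Y_candidate_def)

text \<open>A normal \<open>P\<close> meets the criterion with c = 1: its image in G/C_G(A) is a
  normal \<open>p\<close>-subgroup, hence trivial. Applied to cores O_p, to a second candidate, and
  to a whole \<open>p\<close>-group.\<close>

lemma Y_candidate_centralizes:
  assumes S: "sylow_subgroup p G S" and A: "Y_candidate p G A"
    and P: "P \<lhd> G" "P \<subseteq> S"
  shows "P \<subseteq> group_centralizer G A"
proof -
  have Ps: "subgroup P G" using P normal_imp_subgroup by blast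
  have "A \<subseteq> carrier G" using A normal_imp_subgroup subgroup.subset Y_candidate_def by metis
  then have one: "\<one> \<in> group_centralizer G A"
    using subgroup.one_closed[OF group_centralizer_subgroup] by blast
  have "\<exists>y\<in>P. \<exists>c\<in>group_centralizer G A. k \<otimes> x \<otimes> inv k = y \<otimes> c"
    if "k \<in> carrier G" "x \<in> P" for k x
  proof (intro bexI)
    show "k \<otimes> x \<otimes> inv k \<in> P" by (rule normal.inv_op_closed2[OF P(1) that])
    then have "k \<otimes> x \<otimes> inv k \<in> carrier G" by (rule subgroup.mem_carrier[OF Ps])
    then show "k \<otimes> x \<otimes> inv k = (k \<otimes> x \<otimes> inv k) \<otimes> \<one>" by (rule r_one[symmetric])
  qed (rule one)
  then show ?thesis using A P Ps unfolding Y_candidate_iff[OF S] by blast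
qed

text \<open>Two candidates centralize each other by \<open>Y_candidate_centralizes\<close>, so their
  product is again elementary abelian. Since C_G(AB) is the intersection of C_G(A) and C_G(B), a
  subgroup that meets the criterion for AB meets it for both factors.\<close>

lemma Y_candidate_mult:
  assumes A: "Y_candidate p G A" and B: "Y_candidate p G B"
  shows "Y_candidate p G (A <#> B)"
proof -
  obtain S where S: "sylow_subgroup p G S" using sylow_exists by blast
  have nA: "A \<lhd> G" "p_subgroup p G A" "subgroup A G" and nB: "B \<lhd> G" "p_subgroup p G B" "subgroup B G"
    using A B by (auto simp: Y_candidate_def normal_imp_subgroup)
  note D = normal_p_subgroup_mult[OF nA(1,2) nB(1,2)]
  have "A \<subseteq> S" "B \<subseteq> S" using normal_p_subgroup_subset_sylow[OF S] nA nB by auto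
  have BC: "B \<subseteq> group_centralizer G A"
    by (rule Y_candidate_centralizes[OF S A nB(1) \<open>B \<subseteq> S\<close>])
  then have ba: "b \<otimes> a = a \<otimes> b" if "a \<in> A" "b \<in> B" for a b
    using that by (auto simp: group_centralizer_def)
  have Ac: "A \<subseteq> carrier G" and Bc: "B \<subseteq> carrier G"
    using nA nB subgroup.subset by auto
  have comA: "a \<otimes> b = b \<otimes> a" if "a \<in> A" "b \<in> A" for a b
    using A that unfolding Y_candidate_iff[OF S] by blast
  have comB: "a \<otimes> b = b \<otimes> a" if "a \<in> B" "b \<in> B" for a b
    using B that unfolding Y_candidate_iff[OF S] by blast
  have cent: "group_centralizer G (A <#> B) \<subseteq> group_centralizer G A"
    "group_centralizer G (A <#> B) \<subseteq> group_centralizer G B"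
    using D(3,4) by (auto simp: group_centralizer_def)
  have cent2: "c \<in> group_centralizer G (A <#> B)"
    if c: "c \<in> group_centralizer G A" "c \<in> group_centralizer G B" for c
  proof -
    have cc: "c \<in> carrier G" using c by (simp add: group_centralizer_def)
    have "c \<otimes> (a \<otimes> b) = a \<otimes> b \<otimes> c" if "a \<in> A" "b \<in> B" for a b
    proof -
      have ab: "a \<in> carrier G" "b \<in> carrier G" using that Ac Bc by auto
      have "c \<otimes> (a \<otimes> b) = (c \<otimes> a) \<otimes> b" using ab cc by (simp add: m_assoc)
      also have "\<dots> = a \<otimes> (c \<otimes> b)"
        using that c ab cc by (simp add: group_centralizer_def m_assoc)
      also have "\<dots> = a \<otimes> b \<otimes> c"
        using that c ab cc by (simp add: group_centralizer_def m_assoc)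
      finally show ?thesis .
    qed
    with cc show ?thesis by (auto simp: group_centralizer_def set_mult_def)
  qed
  have com: "x \<otimes> y = y \<otimes> x" if "x \<in> A <#> B" "y \<in> A <#> B" for x y
  proof -
    have "a \<in> group_centralizer G A" "a \<in> group_centralizer G B" if "a \<in> A" for a
      using that comA ba[OF that, symmetric] Ac unfolding group_centralizer_def by blast+
    moreover have "b \<in> group_centralizer G A" "b \<in> group_centralizer G B" if "b \<in> B" for b
      using that comB ba Bc by (auto simp: group_centralizer_def)
    ultimately have "A \<subseteq> group_centralizer G (A <#> B)" "B \<subseteq> group_centralizer G (A <#> B)"
      using cent2 by auto
    moreover have "A <#> B \<subseteq> carrier G" by (rule set_mult_closed[OF Ac Bc])
    ultimately have "A <#> B \<subseteq> group_centralizer G (A <#> B)"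
      using subgroup.m_closed[OF group_centralizer_subgroup] unfolding set_mult_def by blast
    then show ?thesis using that by (auto simp: group_centralizer_def)
  qed
  have exp: "x [^] p = \<one>" if x: "x \<in> A <#> B" for x
  proof -
    obtain a b where ab: "a \<in> A" "b \<in> B" "x = a \<otimes> b" using x by (auto simp: set_mult_def)
    have "a [^] p = \<one>" "b [^] p = \<one>"
      using A B ab unfolding Y_candidate_iff[OF S] by auto
    moreover have "x [^] p = a [^] p \<otimes> b [^] p"
      using pow_mult_distrib[of a b p] ba[OF ab(1,2)] ab Ac Bc by auto
    ultimately show ?thesis by simp
  qed
  have red: "P \<subseteq> group_centralizer G (A <#> B)" if P: "subgroup P G" "P \<subseteq> S" and
    c: "\<forall>k\<in>carrier G. \<forall>x\<in>P. \<exists>y\<in>P. \<exists>c\<in>group_centralizer G (A <#> B). k \<otimes> x \<otimes> inv k = y \<otimes> c"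
    for P
  proof -
    have "P \<subseteq> group_centralizer G A"
      using A P c cent(1) unfolding Y_candidate_iff[OF S] by (meson subsetD)
    moreover have "P \<subseteq> group_centralizer G B"
      using B P c cent(2) unfolding Y_candidate_iff[OF S] by (meson subsetD)
    ultimately show ?thesis using cent2 by blast
  qed
  have "A <#> B \<subseteq> S" by (rule normal_p_subgroup_subset_sylow[OF S D(2,1)])
  then show ?thesis
    unfolding Y_candidate_iff[OF S] using D(1) com exp red by blast
qed

lemma Y_candidate_one: "Y_candidate p G {\<one>}"
proof -
  obtain S where S: "sylow_subgroup p G S" using sylow_exists by blast
  then have "\<one> \<in> S" by (simp add: sylow_subgroup_def subgroup.one_closed)
  moreover have "P \<subseteq> group_centralizer G {\<one>}" if "subgroup P G" for P
    using subgroup.subset[OF that] by (auto simp: group_centralizer_def)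
  ultimately show ?thesis
    unfolding Y_candidate_iff[OF S] using one_is_normal by (auto simp: nat_pow_one)
qed

lemma Y_sub_greatest:
  "Y_candidate p G (Y_sub p G) \<and> (\<forall>A. Y_candidate p G A \<longrightarrow> A \<subseteq> Y_sub p G)"
proof -
  have "Y_sub p G = (GREATEST A. Y_candidate p G A)"
    by (simp add: Y_sub_def Y_candidate_def)
  moreover have "Y_candidate p G (GREATEST A. Y_candidate p G A) \<and>
    (\<forall>B. Y_candidate p G B \<longrightarrow> B \<subseteq> (GREATEST A. Y_candidate p G A))"
  proof (rule Greatest_by_join)
    show "Y_candidate p G {\<one>}" by (rule Y_candidate_one)
  next
    fix A assume "Y_candidate p G A"
    then show "A \<subseteq> carrier G" using normal_imp_subgroup subgroup.subset Y_candidate_def by metis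
  next
    fix A B assume AB: "Y_candidate p G A" "Y_candidate p G B"
    then have "A \<subseteq> A <#> B" "B \<subseteq> A <#> B"
      using normal_p_subgroup_mult[of A B] by (auto simp: Y_candidate_def)
    with Y_candidate_mult[OF AB] show "\<exists>D. Y_candidate p G D \<and> A \<subseteq> D \<and> B \<subseteq> D" by blast
  qed simp
  ultimately show ?thesis by simp
qed

lemma Y_sub_candidate: "Y_candidate p G (Y_sub p G)"
  and Y_sub_upper: "Y_candidate p G A \<Longrightarrow> A \<subseteq> Y_sub p G"
  using Y_sub_greatest by blast+

text \<open>All data on the right are taken in \<open>G\<close>; \<open>K\<close> occurs only as the
  range of the conjugating elements. Candidates for two subgroups with the same Sylow subgroup
  \<open>S\<close> then differ in this range alone.\<close>

lemma Y_candidate_subgroup_iff: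
  assumes K: "subgroup K G" and S: "sylow_subgroup p (G\<lparr>carrier := K\<rparr>) S"
  shows "Y_candidate p (G\<lparr>carrier := K\<rparr>) A \<longleftrightarrow>
    subgroup A G \<and> (\<forall>k\<in>K. \<forall>a\<in>A. k \<otimes> a \<otimes> inv k \<in> A) \<and> A \<subseteq> S \<and>
    (\<forall>a\<in>A. \<forall>b\<in>A. a \<otimes> b = b \<otimes> a) \<and> (\<forall>a\<in>A. a [^] p = \<one>) \<and>
    (\<forall>P. subgroup P G \<longrightarrow> P \<subseteq> S \<longrightarrow>
      (\<forall>k\<in>K. \<forall>x\<in>P. \<exists>y\<in>P. \<exists>c\<in>group_centralizer G A. k \<otimes> x \<otimes> inv k = y \<otimes> c) \<longrightarrow>
      P \<subseteq> group_centralizer G A)"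
proof -
  interpret K: finite_group_prime "G\<lparr>carrier := K\<rparr>" p
    by (rule finite_group_prime_subgroup[OF K])
  have SK: "S \<subseteq> K" using S subgroup.subset by (fastforce simp: sylow_subgroup_def)
  have Kc: "K \<subseteq> carrier G" by (rule subgroup.subset[OF K])
  have cond: "(\<forall>k\<in>K. \<forall>x\<in>P. \<exists>y\<in>P. \<exists>c\<in>K \<inter> group_centralizer G A.
        k \<otimes> x \<otimes> inv\<^bsub>G\<lparr>carrier := K\<rparr>\<^esub> k = y \<otimes> c) \<longleftrightarrow>
      (\<forall>k\<in>K. \<forall>x\<in>P. \<exists>y\<in>P. \<exists>c\<in>group_centralizer G A. k \<otimes> x \<otimes> inv k = y \<otimes> c)"
    if PK: "P \<subseteq> K" for P
  proof (rule ball_cong[OF refl], rule ball_cong[OF refl], rule bex_cong[OF refl])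
    fix k x y assume kxy: "k \<in> K" "x \<in> P" "y \<in> P"
    \<comment> \<open>Replacing C_K(A) by C_G(A) changes nothing: the equation itself puts
      \<open>c\<close> into \<open>K\<close>.\<close>
    have "c \<in> K" if "c \<in> carrier G" "k \<otimes> x \<otimes> inv k = y \<otimes> c" for c
    proof -
      have "y \<in> carrier G" "y \<in> K" "x \<in> K" using kxy PK Kc by auto
      then have "c = inv y \<otimes> (k \<otimes> x \<otimes> inv k)"
        using that kxy(1) Kc by (simp add: m_assoc[symmetric])
      then show ?thesis
        using kxy(1) \<open>y \<in> K\<close> \<open>x \<in> K\<close> K by (simp add: subgroup.m_closed subgroup.m_inv_closed)
    qed
    then show "(\<exists>c\<in>K \<inter> group_centralizer G A. k \<otimes> x \<otimes> inv\<^bsub>G\<lparr>carrier := K\<rparr>\<^esub> k = y \<otimes> c) \<longleftrightarrow>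
      (\<exists>c\<in>group_centralizer G A. k \<otimes> x \<otimes> inv k = y \<otimes> c)"
      using m_inv_consistent[OF K kxy(1)] by (auto simp: group_centralizer_def)
  qed
  have sub: "subgroup P (G\<lparr>carrier := K\<rparr>) \<longleftrightarrow> subgroup P G" if "P \<subseteq> S" for P
    using incl_subgroup[OF K, of P] subgroup_incl[OF _ K, of P] that SK by blast
  have pow: "a [^]\<^bsub>G\<lparr>carrier := K\<rparr>\<^esub> p = a [^] p" for a
    by (rule nat_pow_consistent[symmetric])
  have "(\<forall>P. subgroup P (G\<lparr>carrier := K\<rparr>) \<longrightarrow> P \<subseteq> S \<longrightarrow>
      (\<forall>k\<in>carrier (G\<lparr>carrier := K\<rparr>). \<forall>x\<in>P. \<exists>y\<in>P. \<exists>c\<in>group_centralizer (G\<lparr>carrier := K\<rparr>) A.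
        k \<otimes>\<^bsub>G\<lparr>carrier := K\<rparr>\<^esub> x \<otimes>\<^bsub>G\<lparr>carrier := K\<rparr>\<^esub> inv\<^bsub>G\<lparr>carrier := K\<rparr>\<^esub> k =
          y \<otimes>\<^bsub>G\<lparr>carrier := K\<rparr>\<^esub> c) \<longrightarrow>
      P \<subseteq> group_centralizer (G\<lparr>carrier := K\<rparr>) A) \<longleftrightarrow>
    (\<forall>P. subgroup P G \<longrightarrow> P \<subseteq> S \<longrightarrow>
      (\<forall>k\<in>K. \<forall>x\<in>P. \<exists>y\<in>P. \<exists>c\<in>group_centralizer G A. k \<otimes> x \<otimes> inv k = y \<otimes> c) \<longrightarrow>
      P \<subseteq> group_centralizer G A)" (is "(\<forall>P. ?L P) \<longleftrightarrow> (\<forall>P. ?R P)")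
  proof (intro iff_allI)
    fix P show "?L P \<longleftrightarrow> ?R P"
    proof (cases "P \<subseteq> S")
      case True
      then have PK: "P \<subseteq> K" using SK by blast
      show ?thesis
        using sub[OF True] cond[OF PK] PK
        by (simp add: group_centralizer_restrict[OF Kc])
    qed simp
  qed
  note red = this
  have "A \<lhd> G\<lparr>carrier := K\<rparr> \<and> A \<subseteq> S \<longleftrightarrow>
    subgroup A G \<and> (\<forall>k\<in>K. \<forall>a\<in>A. k \<otimes> a \<otimes> inv k \<in> A) \<and> A \<subseteq> S"
    unfolding normal_in_subgroup_iff[OF K] using SK by blast
  then show ?thesis
    unfolding K.Y_candidate_iff[OF S] pow red conj_assoc[symmetric] by simp
qed

text \<open>O_p(G) lies in \<open>S\<close>, so it is normal in \<open>K\<close> and centralized by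
  Y_K; characteristic \<open>p\<close> then puts Y_K into Z(O_p(G)). This is the point of the
  hypothesis: it makes all \<open>G\<close>-conjugates of Y_K commute, so that the subgroup they
  generate can be a candidate for \<open>G\<close>.\<close>

lemma Y_sub_mono:
  assumes char: "characteristic_p p G" and S: "sylow_subgroup p G S"
    and K: "subgroup K G" and SK: "S \<subseteq> K"
  shows "Y_sub p (G\<lparr>carrier := K\<rparr>) \<subseteq> Y_sub p G"
proof -
  interpret K: finite_group_prime "G\<lparr>carrier := K\<rparr>" p
    by (rule finite_group_prime_subgroup[OF K])
  have SK': "sylow_subgroup p (G\<lparr>carrier := K\<rparr>) S" by (rule sylow_restrict[OF K S SK])
  have GG: "G\<lparr>carrier := carrier G\<rparr> = G" by simp
  note YG = Y_candidate_subgroup_iff[OF subgroup_self, unfolded GG, OF S]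
  note YK = Y_candidate_subgroup_iff[OF K SK']
  let ?A = "Y_sub p (G\<lparr>carrier := K\<rparr>)"
  let ?Q = "p_core p G"
  have A: "Y_candidate p (G\<lparr>carrier := K\<rparr>) ?A" by (rule K.Y_sub_candidate)
  have As: "subgroup ?A G" and AS: "?A \<subseteq> S" and Aexp: "\<And>a. a \<in> ?A \<Longrightarrow> a [^] p = \<one>"
    using A unfolding YK by auto
  note Ared = A[unfolded YK, THEN conjunct2, THEN conjunct2, THEN conjunct2, THEN conjunct2, THEN conjunct2]
  have Ac: "?A \<subseteq> carrier G" by (rule subgroup.subset[OF As])
  have Q: "?Q \<lhd> G" by (rule p_core_normal)
  have Qs: "subgroup ?Q G" by (rule normal_imp_subgroup[OF Q])
  have Qc: "?Q \<subseteq> carrier G" by (rule subgroup.subset[OF Qs])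
  have QS: "?Q \<subseteq> S" by (rule p_core_subset_sylow[OF S])
  have "?Q \<lhd> G\<lparr>carrier := K\<rparr>"
    using normal_restrict_supergroup[OF K Q] QS SK by blast
  then have "?Q \<subseteq> group_centralizer G ?A"
    using K.Y_candidate_centralizes[OF SK' A _ QS]
    by (simp add: group_centralizer_restrict[OF subgroup.subset[OF K]])
  then have "?A \<subseteq> group_centralizer G ?Q"
    using Ac by (auto simp: group_centralizer_def)
  then have AQ: "?A \<subseteq> ?Q" using char by (auto simp: characteristic_p_def)
  define W where "W = {x \<in> ?Q. x \<in> group_centralizer G ?Q \<and> x [^] p = \<one>}"
  have CQ: "subgroup (group_centralizer G ?Q) G" by (rule group_centralizer_subgroup[OF Qc])
  have CQn: "group_centralizer G ?Q \<lhd> G" by (rule group_centralizer_normal[OF Q])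
  have Wcom: "x \<otimes> y = y \<otimes> x" if xy: "x \<in> W" "y \<in> W" for x y
    using xy unfolding W_def group_centralizer_def by blast
  have Ws: "subgroup W G"
  proof (rule subgroupI)
    show "W \<subseteq> carrier G" using Qc by (auto simp: W_def)
    have "\<one> \<in> W" using subgroup.one_closed[OF Qs] subgroup.one_closed[OF CQ]
      by (simp add: W_def)
    then show "W \<noteq> {}" by blast
    fix a assume a: "a \<in> W"
    then have "a \<in> carrier G" using Qc by (auto simp: W_def)
    with a show "inv a \<in> W"
      using subgroup.m_inv_closed[OF Qs] subgroup.m_inv_closed[OF CQ]
      by (simp add: W_def nat_pow_inv)
    fix b assume b: "b \<in> W"
    then have "b \<in> carrier G" using Qc by (auto simp: W_def)
    with a b \<open>a \<in> carrier G\<close> show "a \<otimes> b \<in> W"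
      using subgroup.m_closed[OF Qs] subgroup.m_closed[OF CQ] pow_mult_distrib[OF Wcom[OF a b]]
      by (simp add: W_def)
  qed
  have Wn: "W \<lhd> G"
  proof (rule normal_invI[OF Ws])
    fix x h assume x: "x \<in> carrier G" and h: "h \<in> W"
    then have hc: "h \<in> carrier G" using Qc by (auto simp: W_def)
    have "(x \<otimes> h \<otimes> inv x) [^] n = x \<otimes> h [^] n \<otimes> inv x" for n :: nat
    proof (induction n)
      case (Suc n)
      have "(x \<otimes> h \<otimes> inv x) [^] Suc n = (x \<otimes> h [^] n \<otimes> inv x) \<otimes> (x \<otimes> h \<otimes> inv x)"
        using Suc by simp
      also have "\<dots> = x \<otimes> (h [^] n \<otimes> h) \<otimes> inv x"
        using x hc by (simp add: m_assoc) (metis inv_closed l_inv l_one m_assoc m_closed)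
      finally show ?case by simp
    qed (use x in simp)
    then show "x \<otimes> h \<otimes> inv x \<in> W"
      using h x normal.inv_op_closed2[OF Q x] normal.inv_op_closed2[OF CQn x]
      by (simp add: W_def)
  qed
  have AW: "?A \<subseteq> W"
    using AQ \<open>?A \<subseteq> group_centralizer G ?Q\<close> Aexp by (auto simp: W_def)
  \<comment> \<open>The normal closure \<open>V\<close> of \<open>Y\<^sub>K\<close> lies in \<open>W = \<Omega>\<^sub>1(Z(O\<^sub>p(G)))\<close> and is again \<open>p\<close>-reduced.\<close>
  define X where "X = (\<Union>k\<in>carrier G. (\<lambda>a. k \<otimes> a \<otimes> inv k) ` ?A)"
  define V where "V = generate G X"
  have XW: "X \<subseteq> W"
    using AW normal.inv_op_closed2[OF Wn] by (auto simp: X_def)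
  then have Xc: "X \<subseteq> carrier G" using subgroup.subset[OF Ws] by blast
  have Vn: "V \<lhd> G"
    unfolding V_def
  proof (rule normal_generateI[OF Xc])
    fix h g assume "h \<in> X" and g: "g \<in> carrier G"
    then obtain k a where k: "k \<in> carrier G" "a \<in> ?A" "h = k \<otimes> a \<otimes> inv k"
      by (auto simp: X_def)
    have "g \<otimes> h \<otimes> inv g = (g \<otimes> k) \<otimes> a \<otimes> inv (g \<otimes> k)"
      using k g Ac by (auto simp: m_assoc inv_mult_group)
    then show "g \<otimes> h \<otimes> inv g \<in> X"
      using k(1,2) g by (auto simp: X_def)
  qed
  have Vs: "subgroup V G" by (rule normal_imp_subgroup[OF Vn])
  have VW: "V \<subseteq> W" unfolding V_def by (rule generate_subgroup_incl[OF XW Ws])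
  have AX: "?A \<subseteq> X"
  proof
    fix a assume a: "a \<in> ?A"
    then have "a = \<one> \<otimes> a \<otimes> inv \<one>" using Ac by auto
    then show "a \<in> X" unfolding X_def by (rule UN_I[OF one_closed image_eqI[OF _ a]])
  qed
  have "X \<subseteq> V" unfolding V_def by (rule subsetI) (rule generate.incl)
  with AX have AV: "?A \<subseteq> V" by (rule subset_trans)
  then have CVA: "group_centralizer G V \<subseteq> group_centralizer G ?A"
    by (auto simp: group_centralizer_def)
  have red: "P \<subseteq> group_centralizer G V" if P: "subgroup P G" "P \<subseteq> S" and
    c: "\<forall>k\<in>carrier G. \<forall>x\<in>P. \<exists>y\<in>P. \<exists>c\<in>group_centralizer G V. k \<otimes> x \<otimes> inv k = y \<otimes> c"
    for P
  proof
    fix x assume x: "x \<in> P"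
    \<comment> \<open>As C_G(V) is contained in the centralizer of Y_K, the criterion for
      \<open>V\<close> in \<open>G\<close> implies the one for Y_K in \<open>K\<close>, where Y_K is
      p-reduced.\<close>
    have "\<forall>k\<in>K. \<forall>x\<in>P. \<exists>y\<in>P. \<exists>c\<in>group_centralizer G ?A. k \<otimes> x \<otimes> inv k = y \<otimes> c"
      using c subgroup.subset[OF K] CVA by (meson subsetD)
    then have PA: "P \<subseteq> group_centralizer G ?A"
      by (rule Ared[THEN spec, THEN mp, THEN mp, THEN mp, OF P])
    have xc: "x \<in> carrier G" using x P subgroup.mem_carrier by metis
    \<comment> \<open>For h = k a k^-1, \<open>x\<close> commutes with \<open>h\<close> as soon as
      k^-1 x k commutes with \<open>a\<close>. The criterion writes k^-1 x k as y d with
      \<open>y\<close> in \<open>P\<close> and \<open>d\<close> in C_G(V), and both centralize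
      Y_K.\<close>
    have Xx: "h \<in> group_centralizer G {x}" if h: "h \<in> X" for h
    proof -
      obtain k a where k: "k \<in> carrier G" "a \<in> ?A" "h = k \<otimes> a \<otimes> inv k"
        using h by (auto simp: X_def)
      obtain y d where yd: "y \<in> P" "d \<in> group_centralizer G V"
        "inv k \<otimes> x \<otimes> inv (inv k) = y \<otimes> d"
        using c[rule_format, OF inv_closed[OF k(1)] x] by blast
      then have "inv k \<otimes> x \<otimes> inv (inv k) \<in> group_centralizer G ?A"
        using PA CVA subgroup.m_closed[OF group_centralizer_subgroup[OF Ac], of y d] by auto
      then have *: "(inv k \<otimes> x \<otimes> k) \<otimes> a = a \<otimes> (inv k \<otimes> x \<otimes> k)"
        using k by (simp add: group_centralizer_def)
      have ac: "a \<in> carrier G" using k Ac by blast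
      have "x \<otimes> h = k \<otimes> ((inv k \<otimes> x \<otimes> k) \<otimes> a) \<otimes> inv k"
        using k(1,3) ac xc by (simp add: m_assoc[symmetric])
      also have "\<dots> = k \<otimes> (a \<otimes> (inv k \<otimes> x \<otimes> k)) \<otimes> inv k" by (simp only: *)
      also have "\<dots> = h \<otimes> x"
        using k(1,3) ac xc by (simp add: m_assoc)
      finally show ?thesis using h Xc by (auto simp: group_centralizer_def)
    qed
    have "V \<subseteq> group_centralizer G {x}"
      unfolding V_def
      by (rule generate_subgroup_incl[OF _ group_centralizer_subgroup]) (use xc Xx in auto)
    then show "x \<in> group_centralizer G V"
      using xc by (auto simp: group_centralizer_def)
  qed
  have "Y_candidate p G V"
    unfolding Y_candidate_iff[OF S]
  proof (intro conjI Vn)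
    show "V \<subseteq> S" using VW QS by (auto simp: W_def)
    show "\<forall>a\<in>V. \<forall>b\<in>V. a \<otimes> b = b \<otimes> a" using VW Wcom by blast
    show "\<forall>a\<in>V. a [^] p = \<one>" using VW by (auto simp: W_def)
  qed (use red in blast)
  then show ?thesis using Y_sub_upper AV by blast
qed

text \<open>\<open>H\<close> and \<open>K\<close> induce the same action on \<open>A\<close>. For
  p-reducedness write k = h d with \<open>d\<close> in C_G(A): then k x k^-1 = (h x h^-1) f with f =
  h (x^-1 d x d^-1) h^-1 in C_G(A). So the criterion over \<open>H\<close> gives the criterion over
  \<open>K\<close>.\<close>

lemma Y_candidate_transfer:
  assumes K: "subgroup K G" and H: "subgroup H G"
    and SK: "sylow_subgroup p (G\<lparr>carrier := K\<rparr>) S" and SH: "sylow_subgroup p (G\<lparr>carrier := H\<rparr>) S"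
    and A: "Y_candidate p (G\<lparr>carrier := K\<rparr>) A"
    and HK: "H \<subseteq> K <#> group_centralizer G A" and KH: "K \<subseteq> H <#> group_centralizer G A"
  shows "Y_candidate p (G\<lparr>carrier := H\<rparr>) A"
proof -
  note YK = Y_candidate_subgroup_iff[OF K SK]
  note YH = Y_candidate_subgroup_iff[OF H SH]
  let ?C = "group_centralizer G A"
  have As: "subgroup A G" and AK: "\<And>k a. k \<in> K \<Longrightarrow> a \<in> A \<Longrightarrow> k \<otimes> a \<otimes> inv k \<in> A"
    and AS: "A \<subseteq> S"
    using A unfolding YK by auto
  note Ared = A[unfolded YK, THEN conjunct2, THEN conjunct2, THEN conjunct2, THEN conjunct2, THEN conjunct2]
  have Ac: "A \<subseteq> carrier G" by (rule subgroup.subset[OF As])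
  have Cs: "subgroup ?C G" by (rule group_centralizer_subgroup[OF Ac])
  have HC: "H \<subseteq> carrier G" and KC: "K \<subseteq> carrier G" using H K subgroup.subset by auto
  have SKs: "S \<subseteq> K"
    using SK subgroup.subset by (fastforce simp: sylow_subgroup_def)
  have AH: "h \<otimes> a \<otimes> inv h \<in> A" if ha: "h \<in> H" "a \<in> A" for h a
  proof -
    obtain k c where kc: "k \<in> K" "c \<in> ?C" "h = k \<otimes> c"
      using HK ha by (auto simp: set_mult_def)
    have cc: "k \<in> carrier G" "c \<in> carrier G" "a \<in> carrier G"
      using kc KC Cs ha Ac by (auto simp: group_centralizer_def)
    have ca: "c \<otimes> a = a \<otimes> c" using kc ha by (simp add: group_centralizer_def)
    have "h \<otimes> a \<otimes> inv h = k \<otimes> (c \<otimes> a) \<otimes> inv c \<otimes> inv k"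
      using kc cc by (simp add: m_assoc inv_mult_group)
    also have "\<dots> = k \<otimes> a \<otimes> inv k"
      unfolding ca using cc by (simp add: m_assoc)
    finally show ?thesis using AK kc ha by simp
  qed
  have red: "P \<subseteq> ?C" if P: "subgroup P G" "P \<subseteq> S" and
    cnd: "\<forall>k\<in>H. \<forall>x\<in>P. \<exists>y\<in>P. \<exists>c\<in>?C. k \<otimes> x \<otimes> inv k = y \<otimes> c" for P
  proof -
    have "\<exists>y\<in>P. \<exists>c\<in>?C. k \<otimes> x \<otimes> inv k = y \<otimes> c" if kx: "k \<in> K" "x \<in> P" for k x
    proof -
      obtain h d where hd: "h \<in> H" "d \<in> ?C" "k = h \<otimes> d"
        using KH kx by (auto simp: set_mult_def)
      obtain y c where yc: "y \<in> P" "c \<in> ?C" "h \<otimes> x \<otimes> inv h = y \<otimes> c"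
        using cnd hd kx by blast
      have cc: "h \<in> carrier G" "d \<in> carrier G" "x \<in> carrier G" "y \<in> carrier G" "c \<in> carrier G"
        using hd yc kx HC subgroup.mem_carrier[OF P(1)] by (auto simp: group_centralizer_def)
      let ?e = "inv x \<otimes> d \<otimes> x"
      \<comment> \<open>Here \<open>x\<close> normalizes \<open>A\<close> because P \<subseteq> S
        \<subseteq> K. The double inverse is what \<open>conj_centralizer\<close> produces for the
        conjugating element x^-1.\<close>
      have "inv x \<otimes> d \<otimes> inv (inv x) \<in> ?C"
      proof (rule conj_centralizer[OF As _ _ hd(2)])
        fix a assume "a \<in> A"
        then show "inv (inv x) \<otimes> a \<otimes> inv x \<in> A" using AK[of x a] kx P SKs cc by auto
      qed (use cc in simp)
      then have "?e \<in> ?C" using cc by simp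
      then have eC: "?e \<otimes> inv d \<in> ?C"
        using hd(2) subgroup.m_closed[OF Cs] subgroup.m_inv_closed[OF Cs] by blast
      have fC: "h \<otimes> (?e \<otimes> inv d) \<otimes> inv h \<in> ?C"
      proof (rule conj_centralizer[OF As cc(1) _ eC])
        fix a assume "a \<in> A"
        then show "inv h \<otimes> a \<otimes> h \<in> A"
          using AH[of "inv h" a] hd(1) subgroup.m_inv_closed[OF H] cc by auto
      qed
      have "k \<otimes> x \<otimes> inv k = h \<otimes> x \<otimes> inv h \<otimes> (h \<otimes> (?e \<otimes> inv d) \<otimes> inv h)"
      proof -
        have "h \<otimes> x \<otimes> inv h \<otimes> (h \<otimes> (?e \<otimes> inv d) \<otimes> inv h)
          = h \<otimes> x \<otimes> (inv h \<otimes> h) \<otimes> (?e \<otimes> inv d) \<otimes> inv h"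
          using cc by (simp add: m_assoc inv_mult_cancel)
        also have "\<dots> = h \<otimes> (x \<otimes> inv x) \<otimes> d \<otimes> x \<otimes> inv d \<otimes> inv h"
          using cc by (simp add: m_assoc inv_mult_cancel)
        also have "\<dots> = k \<otimes> x \<otimes> inv k"
          using cc hd(3) by (simp add: m_assoc inv_mult_group)
        finally show ?thesis by simp
      qed
      also have "\<dots> = y \<otimes> (c \<otimes> (h \<otimes> (?e \<otimes> inv d) \<otimes> inv h))"
        unfolding yc(3) using cc by (simp add: m_assoc)
      finally show ?thesis
        using yc(1) subgroup.m_closed[OF Cs yc(2) fC] by blast
    qed
    then show ?thesis
      by (intro Ared[THEN spec, THEN mp, THEN mp, THEN mp, OF P] ballI)
  qed
  show ?thesis
    unfolding YH
  proof (intro conjI)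
    show "subgroup A G" "A \<subseteq> S" by (rule As, rule AS)
    show "\<forall>k\<in>H. \<forall>a\<in>A. k \<otimes> a \<otimes> inv k \<in> A" using AH by blast
    show "\<forall>a\<in>A. \<forall>b\<in>A. a \<otimes> b = b \<otimes> a" "\<forall>a\<in>A. a [^] p = \<one>"
      using A unfolding YK by simp_all
  qed (use red in simp)
qed

text \<open>A \<open>p\<close>-group is its own Sylow subgroup, so it centralizes its
  \<open>Y_sub\<close>. For non-triviality, the central elements with p-th power 1 form a candidate;
  since everything centralizes them, p-reducedness is automatic.\<close>

lemma
  assumes ord: "order G = p ^ n"
  shows p_group_Y_sub_central: "Y_sub p G \<subseteq> group_center G"
    and p_group_Y_sub_nontrivial: "carrier G \<noteq> {\<one>} \<Longrightarrow> Y_sub p G \<noteq> {\<one>}"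
proof -
  have S: "sylow_subgroup p G (carrier G)"
  proof (rule maximal_p_subgroup_sylow)
    show "p_subgroup p G (carrier G)"
      using ord subgroup_self by (auto simp: p_subgroup_def order_def)
  qed (auto simp: p_subgroup_def dest: subgroup.subset)
  have Yc: "Y_sub p G \<subseteq> carrier G"
    using Y_sub_candidate unfolding Y_candidate_iff[OF S] by simp
  have "carrier G \<subseteq> group_centralizer G (Y_sub p G)"
    by (rule Y_candidate_centralizes[OF S Y_sub_candidate carrier_normal order_refl])
  then show "Y_sub p G \<subseteq> group_center G"
    using Yc by (auto simp: group_center_def group_centralizer_def)
  assume nt: "carrier G \<noteq> {\<one>}"
  let ?E = "carrier G - {\<one>}"
  have "n \<noteq> 0"
  proof
    assume "n = 0"
    then have "card (carrier G) = 1" using ord by (simp add: order_def)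
    then show False using nt one_closed by (metis card_1_singletonE singletonD)
  qed
  then have pd: "p dvd p ^ n" by simp
  have cE: "card ?E = p ^ n - 1"
    using ord finite_carrier by (simp add: order_def)
  have ndvd: "\<not> p dvd card ?E"
  proof
    assume "p dvd card ?E"
    then have "p dvd p ^ n - (p ^ n - 1)" using pd cE by (metis dvd_diff_nat)
    moreover have "p ^ n > 0" using prime prime_gt_0_nat by simp
    ultimately have "p dvd 1" by simp
    then show False using prime by (simp add: prime_nat_iff)
  qed
  \<comment> \<open>Conjugation fixes the identity, so it is removed from the set acted on: p^n - 1
    is prime to \<open>p\<close>, and a fixed point is a central element different from 1.\<close>
  obtain z where z: "z \<in> ?E" and fixz: "\<And>g. g \<in> carrier G \<Longrightarrow> g \<otimes> z \<otimes> inv g = z"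
  proof (rule p_group_fixed_point[OF is_group prime ord _ ndvd, where \<phi> = "\<lambda>g x. g \<otimes> x \<otimes> inv g"])
    fix g x assume g: "g \<in> carrier G" and x: "x \<in> ?E"
    have "x = \<one>" if "g \<otimes> x \<otimes> inv g = \<one>"
      using conjugation_is_inj[of g x \<one>] that g x by simp
    then show "g \<otimes> x \<otimes> inv g \<in> ?E" using g x by auto
  next
    fix g h x assume "g \<in> carrier G" "h \<in> carrier G" "x \<in> ?E"
    then show "g \<otimes> h \<otimes> x \<otimes> inv (g \<otimes> h) = g \<otimes> (h \<otimes> x \<otimes> inv h) \<otimes> inv g"
      by (simp add: m_assoc inv_mult_group)
  qed (use finite_carrier in auto)
  have zc: "z \<in> carrier G" "z \<noteq> \<one>" using z by auto
  have zcen: "g \<otimes> z = z \<otimes> g" if "g \<in> carrier G" for g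
    using fixz[OF that] that zc by (metis inv_solve_right m_closed)
  define A where "A = {x \<in> group_center G. x [^] p = \<one>}"
  have cen: "group_center G = {x \<in> carrier G. \<forall>g\<in>carrier G. x \<otimes> g = g \<otimes> x}"
    by (simp add: group_center_def group_centralizer_def)
  have Zs: "subgroup (group_center G) G"
    unfolding group_center_def by (rule group_centralizer_subgroup) simp
  have As: "subgroup A G"
  proof (rule subgroupI)
    show "A \<subseteq> carrier G" by (auto simp: A_def cen)
    have "\<one> \<in> A" using subgroup.one_closed[OF Zs] by (simp add: A_def)
    then show "A \<noteq> {}" by blast
    fix a assume a: "a \<in> A"
    then have ac: "a \<in> carrier G" by (simp add: A_def cen)
    then show "inv a \<in> A"
      using a subgroup.m_inv_closed[OF Zs] by (simp add: A_def nat_pow_inv)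
    fix b assume b: "b \<in> A"
    then have bc: "b \<in> carrier G" by (simp add: A_def cen)
    have "a \<otimes> b = b \<otimes> a" using a bc by (simp add: A_def cen)
    then show "a \<otimes> b \<in> A"
      using a b ac bc subgroup.m_closed[OF Zs] pow_mult_distrib[of a b p] by (simp add: A_def)
  qed
  have An: "A \<lhd> G"
  proof (rule normal_invI[OF As])
    fix x h assume x: "x \<in> carrier G" and "h \<in> A"
    then have "h \<in> carrier G" "x \<otimes> h = h \<otimes> x" by (auto simp: A_def cen)
    then have "x \<otimes> h \<otimes> inv x = h" using x by (simp add: m_assoc)
    then show "x \<otimes> h \<otimes> inv x \<in> A" using \<open>h \<in> A\<close> by simp
  qed
  have "P \<subseteq> group_centralizer G A" if "subgroup P G" for P
    using subgroup.subset[OF that] by (auto simp: group_centralizer_def A_def cen)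
  moreover have "A \<subseteq> carrier G" by (rule subgroup.subset[OF As])
  moreover have "\<forall>a\<in>A. \<forall>b\<in>A. a \<otimes> b = b \<otimes> a" "\<forall>a\<in>A. a [^] p = \<one>"
    using \<open>A \<subseteq> carrier G\<close> unfolding A_def cen by blast+
  ultimately have "Y_candidate p G A"
    unfolding Y_candidate_iff[OF S] using An by blast
  then have AY: "A \<subseteq> Y_sub p G" by (rule Y_sub_upper)
  have "z [^] (p ^ n) = \<one>"
    using pow_order_eq_1[OF zc(1)] ord by simp
  then obtain k where k: "z [^] (p ^ k) = \<one>" and least: "\<And>j. j < k \<Longrightarrow> z [^] (p ^ j) \<noteq> \<one>"
    using exists_least_iff[of "\<lambda>k. z [^] (p ^ k) = \<one>"] by blast
  have "k \<noteq> 0"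
  proof
    assume "k = 0"
    with k zc show False by simp
  qed
  then obtain j where j: "k = Suc j" by (cases k) auto
  \<comment> \<open>The order of \<open>z\<close> is p^k, so its power with exponent p^(k-1) has
    order \<open>p\<close>.\<close>
  let ?w = "z [^] (p ^ j)"
  have "?w [^] p = \<one>" using k j zc by (simp add: nat_pow_pow mult.commute)
  moreover have "z \<in> group_center G" using zcen zc by (simp add: cen)
  then have "?w \<in> group_center G"
    using monoid.nat_pow_closed[OF group.is_monoid[OF subgroup_imp_group[OF Zs]], of z "p ^ j"]
    by (simp add: nat_pow_consistent[symmetric])
  ultimately have "?w \<in> Y_sub p G" using AY by (auto simp: A_def)
  then show "Y_sub p G \<noteq> {\<one>}" using least[of j] j by auto
qed

section \<open>Minimal supplements of a normal subgroup\<close>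

lemma minimal_supplement_exists:
  assumes S: "subgroup S G" and C: "C \<lhd> G"
  obtains M where "subgroup M G" "S \<subseteq> M" "M <#> C = carrier G"
    "\<And>H. subgroup H G \<Longrightarrow> S \<subseteq> H \<Longrightarrow> H \<subseteq> M \<Longrightarrow> H <#> C = carrier G \<Longrightarrow> H = M"
proof -
  let ?Q = "\<lambda>M. subgroup M G \<and> S \<subseteq> M \<and> M <#> C = carrier G"
  have "carrier G <#> C = carrier G"
    by (rule set_mult_carrier_idem[OF normal_imp_subgroup[OF C]])
  then have "?Q (carrier G)" using subgroup_self subgroup.subset[OF S] by blast
  then obtain M where M: "?Q M" "\<And>H. ?Q H \<Longrightarrow> card M \<le> card H"
    using ex_has_least_nat[of ?Q "carrier G" card] by blast
  have "H = M" if "subgroup H G" "S \<subseteq> H" "H \<subseteq> M" "H <#> C = carrier G" for H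
    using M(2)[of H] that finite_subgroup M(1) card_seteq by blast
  with M(1) that show thesis by blast
qed

text \<open>\<open>G\<close> stands for the minimal supplement itself, so minimality says that no
  proper subgroup above \<open>S\<close> supplements \<open>C\<close>. It is used twice: for the
  normalizer of T = S \<inter> C, which gives T = O_p(G), and for a conjugate of the preimage of a
  maximal subgroup that misses an element of C/T.\<close>

lemma minimal_supplement_properties:
  assumes S: "sylow_subgroup p G S" and C: "C \<lhd> G" and QC: "p_core p G \<subseteq> C"
    and min: "\<And>H. subgroup H G \<Longrightarrow> S \<subseteq> H \<Longrightarrow> H <#> C = carrier G \<Longrightarrow> H = carrier G"
  shows "\<exists>!P. sylow_subgroup p (G\<lparr>carrier := C\<rparr>) P"
    and "carrier (G\<lparr>carrier := C\<rparr> Mod p_core p G) \<subseteq> frattini (G Mod p_core p G)"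
proof -
  have Cs: "subgroup C G" and Ss: "subgroup S G"
    using C S normal_imp_subgroup by (auto simp: sylow_subgroup_def)
  interpret C: finite_group_prime "G\<lparr>carrier := C\<rparr>" p
    by (rule finite_group_prime_subgroup[OF Cs])
  define T where "T = S \<inter> C"
  have TC: "sylow_subgroup p (G\<lparr>carrier := C\<rparr>) T"
    unfolding T_def by (rule normal_inter_sylow[OF C S])
  have Ts: "subgroup T G" unfolding T_def by (rule subgroups_Inter_pair[OF Ss Cs])
  have Tc: "T \<subseteq> carrier G" by (rule subgroup.subset[OF Ts])
  have Tp: "p_subgroup p G T"
    using p_subgroup_mono[OF sylow_imp_p_subgroup[OF S] Ts] by (simp add: T_def)
  \<comment> \<open>By the Frattini argument, the normalizer \<open>N\<close> of \<open>T\<close> supplements \<open>C\<close>; it contains \<open>S\<close>.\<close>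
  define N where "N = {g \<in> carrier G. (\<lambda>t. g \<otimes> t \<otimes> inv g) ` T \<subseteq> T}"
  have Neq: "(\<lambda>t. g \<otimes> t \<otimes> inv g) ` T = T" if g: "g \<in> N" for g
  proof -
    have "inj_on (\<lambda>t. g \<otimes> t \<otimes> inv g) T"
    proof (rule inj_onI)
      fix x y assume "x \<in> T" "y \<in> T" "g \<otimes> x \<otimes> inv g = g \<otimes> y \<otimes> inv g"
      then show "x = y" using conjugation_is_inj[of g x y] g Tc by (auto simp: N_def)
    qed
    then show ?thesis
      using g finite_subgroup[OF Ts] endo_inj_surj by (auto simp: N_def)
  qed
  have Ns: "subgroup N G"
  proof (rule subgroupI)
    show "N \<subseteq> carrier G" by (auto simp: N_def)
    have "\<one> \<in> N" using Tc by (auto simp: N_def)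
    then show "N \<noteq> {}" by blast
    fix a assume a: "a \<in> N"
    then have ac: "a \<in> carrier G" by (simp add: N_def)
    have "inv a \<otimes> t \<otimes> inv (inv a) \<in> T" if t: "t \<in> T" for t
    proof -
      obtain s where s: "s \<in> T" "t = a \<otimes> s \<otimes> inv a" using Neq[OF a] t by blast
      then have "inv a \<otimes> t \<otimes> inv (inv a) = s"
        using ac Tc by (auto simp: m_assoc inv_mult_cancel)
      then show ?thesis using s by simp
    qed
    then show "inv a \<in> N" using ac by (auto simp: N_def)
    fix b assume b: "b \<in> N"
    then have bc: "b \<in> carrier G" by (simp add: N_def)
    have "a \<otimes> b \<otimes> t \<otimes> inv (a \<otimes> b) \<in> T" if t: "t \<in> T" for t
    proof -
      have "a \<otimes> b \<otimes> t \<otimes> inv (a \<otimes> b) = a \<otimes> (b \<otimes> t \<otimes> inv b) \<otimes> inv a"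
        using ac bc t Tc by (auto simp: m_assoc inv_mult_group)
      moreover have "b \<otimes> t \<otimes> inv b \<in> T" using b t by (auto simp: N_def)
      ultimately show ?thesis using a by (auto simp: N_def)
    qed
    then show "a \<otimes> b \<in> N" using ac bc by (auto simp: N_def)
  qed
  have SN: "S \<subseteq> N"
  proof
    fix s assume s: "s \<in> S"
    have "s \<otimes> t \<otimes> inv s \<in> T" if "t \<in> T" for t
      using that s normal.inv_op_closed2[OF C] subgroup.mem_carrier[OF Ss]
        subgroup.m_closed[OF Ss] subgroup.m_inv_closed[OF Ss] by (simp add: T_def)
    then show "s \<in> N" using s subgroup.mem_carrier[OF Ss] by (auto simp: N_def)
  qed
  have "g \<in> N <#> C" if g: "g \<in> carrier G" for g
  proof -
    let ?U = "(\<lambda>t. g \<otimes> t \<otimes> inv g) ` T"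
    have "p_subgroup p G ?U" by (rule p_subgroup_conj[OF Tp g])
    moreover have "?U \<subseteq> C" using normal.inv_op_closed2[OF C g] by (auto simp: T_def)
    ultimately have "p_subgroup p (G\<lparr>carrier := C\<rparr>) ?U"
      using p_subgroup_restrict_iff[OF Cs] by blast
    then obtain c where "c \<in> carrier (G\<lparr>carrier := C\<rparr>)"
      "\<And>x. x \<in> ?U \<Longrightarrow> c \<otimes>\<^bsub>G\<lparr>carrier := C\<rparr>\<^esub> x \<otimes>\<^bsub>G\<lparr>carrier := C\<rparr>\<^esub> inv\<^bsub>G\<lparr>carrier := C\<rparr>\<^esub> c \<in> T"
      using C.sylow_conj[OF TC] by blast
    then have c: "c \<in> C" "\<And>x. x \<in> ?U \<Longrightarrow> c \<otimes> x \<otimes> inv c \<in> T"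
      by (simp_all add: m_inv_consistent[OF Cs])
    have cc: "c \<in> carrier G" using c Cs subgroup.mem_carrier by metis
    have "c \<otimes> g \<otimes> t \<otimes> inv (c \<otimes> g) \<in> T" if t: "t \<in> T" for t
    proof -
      have "c \<otimes> g \<otimes> t \<otimes> inv (c \<otimes> g) = c \<otimes> (g \<otimes> t \<otimes> inv g) \<otimes> inv c"
        using cc g t Tc by (auto simp: m_assoc inv_mult_group)
      then show ?thesis using c(2) t by simp
    qed
    then have "c \<otimes> g \<in> N" using cc g by (auto simp: N_def)
    moreover have "inv c \<in> C" using subgroup.m_inv_closed[OF Cs c(1)] .
    moreover have "g = inv c \<otimes> (c \<otimes> g)" using cc g by (simp add: inv_mult_cancel)
    ultimately have "g \<in> C <#> N" unfolding set_mult_def by blast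
    then show ?thesis using commut_normal[OF Ns C] by simp
  qed
  moreover have "N <#> C \<subseteq> carrier G"
    by (rule set_mult_closed) (use subgroup.subset[OF Ns] subgroup.subset[OF Cs] in auto)
  ultimately have "N = carrier G" using min[OF Ns SN] by blast
  then have Tn: "T \<lhd> G"
    by (intro normal_invI[OF Ts]) (auto simp: N_def)
  then have TQ: "T = p_core p G"
    using p_core_upper[OF Tn Tp] p_core_subset_sylow[OF S] QC by (auto simp: T_def)
  have TnC: "T \<lhd> G\<lparr>carrier := C\<rparr>"
    by (rule normal_restrict_supergroup[OF Cs Tn]) (simp add: T_def)
  show "\<exists>!P. sylow_subgroup p (G\<lparr>carrier := C\<rparr>) P"
  proof (rule ex1I[where a = T])
    show "sylow_subgroup p (G\<lparr>carrier := C\<rparr>) T" by (rule TC)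
    fix P assume P: "sylow_subgroup p (G\<lparr>carrier := C\<rparr>) P"
    then have "T \<subseteq> P"
      by (rule C.normal_p_subgroup_subset_sylow[OF _ C.sylow_imp_p_subgroup[OF TC] TnC])
    then show "P = T"
      by (rule C.sylow_maximal[OF TC C.sylow_imp_p_subgroup[OF P]])
  qed
  interpret Q: group "G Mod T" by (rule normal.factorgroup_is_group[OF Tn])
  have TsubC: "T \<subseteq> C" by (simp add: T_def)
  have "X \<in> \<K>" if X: "X \<in> carrier (G\<lparr>carrier := C\<rparr> Mod T)" and K: "maximal_subgroup (G Mod T) \<K>"
    for X \<K>
  proof (rule ccontr)
    assume XK: "X \<notin> \<K>"
    obtain c where c: "c \<in> C" "X = T #> c"
      using X by (auto simp: FactGroup_def RCOSETS_def)
    have Ks: "subgroup \<K> (G Mod T)" using K by (simp add: maximal_subgroup_def)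
    define K where "K = \<Union>\<K>"
    have KsG: "subgroup K G"
      unfolding K_def by (rule normal.factgroup_subgroup_union_subgroup[OF Tn Ks])
    have Kchar: "K = {x \<in> carrier G. T #> x \<in> \<K>}"
      unfolding K_def by (rule normal.factgroup_subgroup_union_char[OF Tn Ks])
    have "T \<in> \<K>" using subgroup.one_closed[OF Ks] by (simp add: FactGroup_def)
    then have TK: "T \<subseteq> K" unfolding K_def by blast
    let ?D = "K <#> C"
    have Ds: "subgroup ?D G" by (rule set_mult_normal_subgroup[OF KsG C])
    have KD: "K \<subseteq> ?D"
      using subgroup.one_closed[OF Cs] r_one[OF subgroup.mem_carrier[OF KsG]]
      by (force simp: set_mult_def)
    have CD: "C \<subseteq> ?D"
      using subgroup.one_closed[OF KsG] l_one[OF subgroup.mem_carrier[OF Cs]]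
      by (force simp: set_mult_def)
    let ?\<D> = "rcosets\<^bsub>G\<lparr>carrier := ?D\<rparr>\<^esub> T"
    have TD: "T \<subseteq> ?D" using TK KD by blast
    have "subgroup ?\<D> (G Mod T)" by (rule normal_subgroup_factorize[OF Tn TD Ds])
    moreover have "\<K> \<subseteq> ?\<D>"
    proof
      fix Z assume Z: "Z \<in> \<K>"
      then obtain z where "z \<in> carrier G" "Z = T #> z"
        using subgroup.mem_carrier[OF Ks Z] by (auto simp: FactGroup_def RCOSETS_def)
      then have "z \<in> ?D" using Z Kchar KD by blast
      with \<open>Z = T #> z\<close> show "Z \<in> ?\<D>" by (auto simp: RCOSETS_def)
    qed
    moreover have "X \<in> ?\<D>" using c CD by (auto simp: RCOSETS_def)
    ultimately have "?\<D> = carrier (G Mod T)"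
      using K XK unfolding maximal_subgroup_def by blast
    have KC: "?D = carrier G"
    proof
      show "carrier G \<subseteq> ?D"
      proof
        fix g assume g: "g \<in> carrier G"
        then have "T #> g \<in> ?\<D>"
          unfolding \<open>?\<D> = carrier (G Mod T)\<close> by (auto simp: FactGroup_def RCOSETS_def)
        then obtain h where h: "h \<in> ?D" "T #> g = T #> h" by (auto simp: RCOSETS_def)
        then have "g \<in> T #> h" using rcos_self[OF g Ts] by simp
        then show "g \<in> ?D"
          using TD h(1) subgroup.m_closed[OF Ds] by (auto simp: r_coset_def)
      qed
    qed (rule subgroup.subset[OF Ds])
    \<comment> \<open>\<open>K\<close> need not contain \<open>S\<close>, but its index divides \<open>|C : T|\<close>, so a conjugate of \<open>K\<close> does.\<close>
    have ind: "\<not> p dvd card (rcosets K)"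
    proof
      assume dvd: "p dvd card (rcosets K)"
      interpret second_isomorphism_grp C G K
        using C KsG by (simp add: second_isomorphism_grp_def second_isomorphism_grp_axioms_def)
      have CK: "C <#> K = carrier G" using commut_normal[OF KsG C] KC by simp
      have "card (rcosets\<^bsub>G\<lparr>carrier := K\<rparr>\<^esub> (C \<inter> K)) = card (rcosets C)"
        using normal_intersection_quotient_isom
        by (auto simp: CK iso_def FactGroup_def dest: bij_betw_same_card)
      then have "card K = card (rcosets C) * card (C \<inter> K)" "order G = card (rcosets C) * card C"
        using group.lagrange[OF subgroup_imp_group[OF KsG]
            subgroup_incl[OF subgroups_Inter_pair[OF Cs KsG] KsG]] lagrange[OF Cs]
        by (simp_all add: order_def)
      \<comment> \<open>Here r = |G : C| = |K : C \<inter> K|. Cancelling it in |G| = |G : K| |K|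
        leaves |C : T| = |G : K| |C \<inter> K : T|, and the left side is prime to
        \<open>p\<close>.\<close>
      then obtain r where r: "card K = r * card (C \<inter> K)" "order G = r * card C" by blast
      obtain i where i: "order G = card (rcosets K) * card K" using lagrange[OF KsG] by simp
      obtain j where j: "card (C \<inter> K) = j * card T"
        using card_subgroup_dvd[OF Ts subgroups_Inter_pair[OF Cs KsG]] TK TsubC
        by (metis dvd_def le_inf_iff mult.commute)
      have m: "card C = card (rcosets\<^bsub>G\<lparr>carrier := C\<rparr>\<^esub> T) * card T"
        using C.lagrange[OF subgroup_incl[OF Ts Cs TsubC]] by (simp add: order_def)
      have "order G > 0" by (rule order_pos)
      have "r * card T * card (rcosets\<^bsub>G\<lparr>carrier := C\<rparr>\<^esub> T) = r * card T * (card (rcosets K) * j)"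
        using r i j m by (auto simp: ac_simps)
      moreover have "r * card T \<noteq> 0" using \<open>order G > 0\<close> r m by auto
      ultimately have "card (rcosets\<^bsub>G\<lparr>carrier := C\<rparr>\<^esub> T) = card (rcosets K) * j"
        by (metis mult_cancel1)
      then show False using dvd C.sylow_index[OF TC] by simp
    qed
    obtain g where g: "g \<in> carrier G" "\<And>x. x \<in> S \<Longrightarrow> g \<otimes> x \<otimes> inv g \<in> K"
      using p_subgroup_conj_into[OF KsG ind sylow_imp_p_subgroup[OF S]] by blast
    define H where "H = inv g <# K #> g"
    have Hs: "subgroup H G" unfolding H_def by (rule subgroup_conjugation_is_surj1[OF g(1) KsG])
    have Hmem: "inv g \<otimes> k \<otimes> g \<in> H" if "k \<in> K" for k
      using that by (auto simp: H_def l_coset_def r_coset_def)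
    have SH: "S \<subseteq> H"
    proof
      fix x assume x: "x \<in> S"
      then have "x \<in> carrier G" using subgroup.mem_carrier[OF Ss] by blast
      then have "x = inv g \<otimes> (g \<otimes> x \<otimes> inv g) \<otimes> g"
        using g(1) by (simp add: m_assoc inv_mult_cancel)
      then show "x \<in> H" using Hmem[OF g(2)[OF x]] by simp
    qed
    \<comment> \<open>A conjugate of a supplement of a normal subgroup is again a
      supplement.\<close>
    have "x \<in> H <#> C" if x: "x \<in> carrier G" for x
    proof -
      have "g \<otimes> x \<otimes> inv g \<in> K <#> C" using KC g(1) x by simp
      then obtain k d where kd: "k \<in> K" "d \<in> C" "g \<otimes> x \<otimes> inv g = k \<otimes> d"
        by (auto simp: set_mult_def)
      have kdc: "k \<in> carrier G" "d \<in> carrier G"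
        using kd subgroup.mem_carrier[OF KsG] subgroup.mem_carrier[OF Cs] by auto
      have "x = inv g \<otimes> (g \<otimes> x \<otimes> inv g) \<otimes> g"
        using g(1) x by (simp add: m_assoc inv_mult_cancel)
      also have "\<dots> = (inv g \<otimes> k \<otimes> g) \<otimes> (inv g \<otimes> d \<otimes> g)"
        unfolding kd(3) using g(1) kdc by (simp add: m_assoc inv_mult_cancel)
      finally show ?thesis
        using Hmem[OF kd(1)] normal.inv_op_closed1[OF C g(1) kd(2)]
        unfolding set_mult_def by blast
    qed
    moreover have "H <#> C \<subseteq> carrier G"
      by (rule set_mult_closed) (use subgroup.subset[OF Hs] subgroup.subset[OF Cs] in auto)
    ultimately have HG: "H = carrier G" using min[OF Hs SH] by blast
    \<comment> \<open>As H = G, its conjugate \<open>K\<close> contains \<open>c\<close>, so the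
      coset \<open>X\<close> of \<open>c\<close> lies in \<open>\<K>\<close> after all.\<close>
    have "inv g \<otimes> c \<otimes> g \<in> H" using HG g(1) c Cs subgroup.mem_carrier by fastforce
    then obtain k where k: "k \<in> K" "inv g \<otimes> c \<otimes> g = inv g \<otimes> k \<otimes> g"
      by (auto simp: H_def l_coset_def r_coset_def)
    have "c = k"
      using conjugation_is_inj[of "inv g" c k] k g(1) subgroup.mem_carrier[OF KsG]
        subgroup.mem_carrier[OF Cs] c by auto
    then show False using k(1) Kchar c XK by blast
  qed
  moreover have "carrier (G\<lparr>carrier := C\<rparr> Mod T) \<subseteq> carrier (G Mod T)"
    using subgroup.subset[OF Cs] by (auto simp: FactGroup_def RCOSETS_def)
  ultimately show "carrier (G\<lparr>carrier := C\<rparr> Mod p_core p G) \<subseteq> frattini (G Mod p_core p G)"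
    unfolding TQ[symmetric] frattini_def by blast
qed

end

section \<open>Partial groups\<close>

context partial_group begin

lemma dom_Nil: "[] \<in> pg_dom \<L>"
  using carrier_nonempty singleton_dom dom_append[of "[]"] by fastforce

lemma dom_carrier: "w \<in> pg_dom \<L> \<Longrightarrow> set w \<subseteq> pg_carrier \<L>"
  using dom_words by blast

lemma dom_suffix: "u @ v \<in> pg_dom \<L> \<Longrightarrow> v \<in> pg_dom \<L>"
  using dom_append by blast

lemma dom_prefix: "u @ v \<in> pg_dom \<L> \<Longrightarrow> u \<in> pg_dom \<L>"
  using dom_append by blast

lemma prod_one_left: "w \<in> pg_dom \<L> \<Longrightarrow> pg_prod \<L> (pg_prod \<L> [] # w) = pg_prod \<L> w"
  using prod_assoc[of "[]" "[]" w] by simp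

lemma prod_one_right: "w \<in> pg_dom \<L> \<Longrightarrow> pg_prod \<L> (w @ [pg_prod \<L> []]) = pg_prod \<L> w"
  using prod_assoc[of w "[]" "[]"] by simp

text \<open>Nothing can be cancelled before the word (a^-1, a, b) is known to lie in the domain.
  Applying \<open>dom_inv\<close> to (a, b), and then to its formal inverse, produces it; evaluating
  it in two ways gives the claim.\<close>

lemma prod_eq_one_imp_inv:
  assumes ab: "[a, b] \<in> pg_dom \<L>" and one: "pg_prod \<L> [a, b] = pg_prod \<L> []"
  shows "b = pg_inv \<L> a"
proof -
  have c: "a \<in> pg_carrier \<L>" "b \<in> pg_carrier \<L>" using dom_carrier[OF ab] by auto
  let ?a = "pg_inv \<L> a" and ?b = "pg_inv \<L> b"
  have "[?b, ?a] \<in> pg_dom \<L>"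
    using dom_suffix[OF dom_inv[OF ab]] by simp
  from dom_inv[OF this] have "[?b] @ [?a, a, b] \<in> pg_dom \<L>" using c by (simp add: inv_inv)
  then have w: "[?a, a, b] \<in> pg_dom \<L>" by (rule dom_suffix)
  have "pg_prod \<L> [?a, a] = pg_prod \<L> []"
    using prod_inv[OF singleton_dom[OF inv_closed[OF c(1)]]] c by (simp add: inv_inv)
  then have "pg_prod \<L> [?a, a, b] = b"
    using prod_assoc[of "[]" "[?a, a]" "[b]"] w prod_one_left[OF singleton_dom[OF c(2)]]
      prod_singleton[OF c(2)] by simp
  moreover have "pg_prod \<L> [?a, a, b] = ?a"
    using prod_assoc[of "[?a]" "[a, b]" "[]"] w one inv_closed[OF c(1)]
      prod_one_right[OF singleton_dom[OF inv_closed[OF c(1)]]] prod_singleton by simp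
  ultimately show ?thesis by simp
qed

lemma prod_rev_inv:
  assumes u: "u \<in> pg_dom \<L>"
  shows "pg_prod \<L> (rev (map (pg_inv \<L>) u)) = pg_inv \<L> (pg_prod \<L> u)"
proof -
  let ?v = "rev (map (pg_inv \<L>) u)"
  have uv: "u @ ?v \<in> pg_dom \<L>" by (rule dom_inv[OF u])
  have d: "[pg_prod \<L> u] @ ?v \<in> pg_dom \<L>" using dom_assoc[of "[]" u ?v] uv by simp
  then have "[pg_prod \<L> u, pg_prod \<L> ?v] \<in> pg_dom \<L>"
    using dom_assoc[of "[pg_prod \<L> u]" ?v "[]"] by simp
  moreover have "pg_prod \<L> [pg_prod \<L> u, pg_prod \<L> ?v] = pg_prod \<L> []"
    using prod_assoc[of "[pg_prod \<L> u]" ?v "[]"] d prod_assoc[of "[]" u ?v] uv prod_inv[OF u]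
    by simp
  ultimately show ?thesis by (rule prod_eq_one_imp_inv)
qed

lemma conj_conj_inv:
  assumes x: "x \<in> pg_carrier \<L>" and y: "y \<in> conj_dom \<L> x"
  shows "pg_conj \<L> x y \<in> conj_dom \<L> (pg_inv \<L> x)"
    and "pg_conj \<L> (pg_inv \<L> x) (pg_conj \<L> x y) = y"
proof -
  let ?x = "pg_inv \<L> x" and ?y = "pg_inv \<L> y"
  have yc: "y \<in> pg_carrier \<L>" and w: "[?x, y, x] \<in> pg_dom \<L>" using y by (auto simp: conj_dom_def)
  have ic: "?x \<in> pg_carrier \<L>" "pg_inv \<L> ?x = x" "?y \<in> pg_carrier \<L>" "pg_inv \<L> ?y = y"
    using x yc by (simp_all add: inv_closed inv_inv)
  \<comment> \<open>The aim is the word (x, x^-1, y, x, x^-1), which evaluates both to the double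
    conjugate and to \<open>y\<close>. It is cut out of words supplied by \<open>dom_inv\<close> in
    three rounds, the first of which passes to y^-1.\<close>
  have "[?x, ?y, x] \<in> pg_dom \<L>"
    using dom_suffix[OF dom_inv[OF w]] ic by simp
  from dom_inv[OF this] have "[?x, ?y] @ [x, ?x, y, x] \<in> pg_dom \<L>" using ic by simp
  then have "[x, ?x, y, x] \<in> pg_dom \<L>" by (rule dom_suffix)
  from dom_inv[OF this] have "[x, ?x, y, x, ?x] @ [?y, x, ?x] \<in> pg_dom \<L>" using ic by simp
  then have W: "[x, ?x, y, x, ?x] \<in> pg_dom \<L>" by (rule dom_prefix)
  have p: "pg_conj \<L> x y \<in> pg_carrier \<L>" unfolding pg_conj_def by (rule prod_closed[OF w])
  have "[x, pg_conj \<L> x y, ?x] \<in> pg_dom \<L>"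
    using dom_assoc[of "[x]" "[?x, y, x]" "[?x]"] W by (simp add: pg_conj_def)
  then show "pg_conj \<L> x y \<in> conj_dom \<L> ?x"
    using p ic by (simp add: conj_dom_def)
  have xx: "pg_prod \<L> [x, ?x] = pg_prod \<L> []"
    using prod_inv[OF singleton_dom[OF x]] by simp
  have "pg_conj \<L> ?x (pg_conj \<L> x y) = pg_prod \<L> [x, ?x, y, x, ?x]"
    using prod_assoc[of "[x]" "[?x, y, x]" "[?x]"] W ic by (simp add: pg_conj_def)
  also have "\<dots> = pg_prod \<L> [pg_prod \<L> [], y, x, ?x]"
    using prod_assoc[of "[]" "[x, ?x]" "[y, x, ?x]"] W xx by simp
  also have "\<dots> = pg_prod \<L> [y, x, ?x]"
    using dom_suffix[of "[x, ?x]" "[y, x, ?x]"] W by (intro prod_one_left) simp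
  also have "\<dots> = pg_prod \<L> [y, pg_prod \<L> []]"
    using prod_assoc[of "[y]" "[x, ?x]" "[]"] dom_suffix[of "[x, ?x]" "[y, x, ?x]"] W xx by simp
  also have "\<dots> = y"
    using prod_one_right[OF singleton_dom[OF yc]] prod_singleton[OF yc] by simp
  finally show "pg_conj \<L> ?x (pg_conj \<L> x y) = y" .
qed

lemma prod_Cons: "x # w \<in> pg_dom \<L> \<Longrightarrow> pg_prod \<L> (x # w) = pg_prod \<L> [x, pg_prod \<L> w]"
  using prod_assoc[of "[x]" w "[]"] by simp

text \<open>Binary products suffice, since \<open>prod_Cons\<close> evaluates a word letter by
  letter.\<close>

lemma pg_subgroupI:
  assumes "H \<subseteq> pg_carrier \<L>" and dom: "lists H \<subseteq> pg_dom \<L>" and one: "pg_prod \<L> [] \<in> H"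
    and "\<And>x. x \<in> H \<Longrightarrow> pg_inv \<L> x \<in> H"
    and mult: "\<And>x y. x \<in> H \<Longrightarrow> y \<in> H \<Longrightarrow> pg_prod \<L> [x, y] \<in> H"
  shows "pg_subgroup \<L> H"
proof -
  have "pg_prod \<L> w \<in> H" if "w \<in> lists H" for w
    using that
  proof (induction w)
    case (Cons x w)
    then have "x # w \<in> lists H" by simp
    then have "x # w \<in> pg_dom \<L>" by (rule subsetD[OF dom])
    then show ?case using Cons mult by (simp add: prod_Cons)
  qed (rule one)
  with assms show ?thesis unfolding pg_subgroup_def by simp
qed

lemma pg_group_simps [simp]:
  "carrier (pg_group \<L> H) = H" "x \<otimes>\<^bsub>pg_group \<L> H\<^esub> y = pg_prod \<L> [x, y]"
  "\<one>\<^bsub>pg_group \<L> H\<^esub> = pg_prod \<L> []"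
  "(pg_group \<L> H)\<lparr>carrier := K\<rparr> = pg_group \<L> K"
  by (simp_all add: pg_group_def)

lemma pg_subgroupD:
  assumes "pg_subgroup \<L> H"
  shows "H \<subseteq> pg_carrier \<L>" "lists H \<subseteq> pg_dom \<L>" "x \<in> H \<Longrightarrow> pg_inv \<L> x \<in> H"
    "w \<in> lists H \<Longrightarrow> pg_prod \<L> w \<in> H" "pg_prod \<L> [] \<in> H"
  using assms unfolding pg_subgroup_def by (blast, blast, blast, blast, blast)

lemma pg_group_inv:
  assumes H: "pg_subgroup \<L> H" and x: "x \<in> H"
  shows "inv\<^bsub>pg_group \<L> H\<^esub> x = pg_inv \<L> x"
proof -
  note pg_inv = inv_closed inv_inv
  interpret group "pg_group \<L> H" by (rule pg_subgroup_is_group[OF H])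
  have i: "pg_inv \<L> x \<in> H" "x \<in> pg_carrier \<L>" using pg_subgroupD[OF H] x by auto
  then have "pg_prod \<L> [pg_inv \<L> x, x] = pg_prod \<L> []"
    using prod_inv[OF singleton_dom[OF pg_inv(1)[OF i(2)]]] pg_inv(2)[OF i(2)] by simp
  then show ?thesis using inv_equality i x by simp
qed

lemma pg_subgroup_conj:
  assumes H: "pg_subgroup \<L> H" and x: "x \<in> H" and y: "y \<in> H"
  shows "y \<in> conj_dom \<L> x"
    and "pg_conj \<L> x y = inv\<^bsub>pg_group \<L> H\<^esub> x \<otimes>\<^bsub>pg_group \<L> H\<^esub> y \<otimes>\<^bsub>pg_group \<L> H\<^esub> x"
proof -
  have w: "[pg_inv \<L> x, y, x] \<in> pg_dom \<L>" "y \<in> pg_carrier \<L>"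
    using subsetD[OF pg_subgroupD(2)[OF H], of "[pg_inv \<L> x, y, x]"] pg_subgroupD(1,3)[OF H] x y
    by auto
  then show "y \<in> conj_dom \<L> x" by (simp add: conj_dom_def)
  show "pg_conj \<L> x y = inv\<^bsub>pg_group \<L> H\<^esub> x \<otimes>\<^bsub>pg_group \<L> H\<^esub> y \<otimes>\<^bsub>pg_group \<L> H\<^esub> x"
    using prod_assoc[of "[]" "[pg_inv \<L> x, y]" "[x]"] w x
    by (simp add: pg_conj_def pg_group_inv[OF H x])
qed

lemma pg_subgroup_iff:
  assumes H: "pg_subgroup \<L> H"
  shows "subgroup K (pg_group \<L> H) \<longleftrightarrow> pg_subgroup \<L> K \<and> K \<subseteq> H"
proof
  assume K: "subgroup K (pg_group \<L> H)"
  have KH: "K \<subseteq> H" using subgroup.subset[OF K] by simp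
  have "pg_subgroup \<L> K"
  proof (rule pg_subgroupI)
    show "K \<subseteq> pg_carrier \<L>" "lists K \<subseteq> pg_dom \<L>"
      using KH pg_subgroupD(1,2)[OF H] lists_mono[OF KH] by auto
    show "pg_prod \<L> [] \<in> K" using subgroup.one_closed[OF K] by simp
    show "pg_prod \<L> [x, y] \<in> K" if "x \<in> K" "y \<in> K" for x y
      using subgroup.m_closed[OF K that] by simp
    show "pg_inv \<L> x \<in> K" if "x \<in> K" for x
      using subgroup.m_inv_closed[OF K that] pg_group_inv[OF H] that KH by auto
  qed
  with KH show "pg_subgroup \<L> K \<and> K \<subseteq> H" by simp
next
  assume K: "pg_subgroup \<L> K \<and> K \<subseteq> H"
  interpret group "pg_group \<L> H" by (rule pg_subgroup_is_group[OF H])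
  note KD = pg_subgroupD[OF conjunct1[OF K]]
  show "subgroup K (pg_group \<L> H)"
  proof (rule subgroupI)
    show "K \<subseteq> carrier (pg_group \<L> H)" "K \<noteq> {}" using K KD(5) by auto
    show "inv\<^bsub>pg_group \<L> H\<^esub> x \<in> K" if "x \<in> K" for x
      using KD(3)[OF that] pg_group_inv[OF H] that K by auto
    show "x \<otimes>\<^bsub>pg_group \<L> H\<^esub> y \<in> K" if "x \<in> K" "y \<in> K" for x y
      using KD(4)[of "[x, y]"] that by simp
  qed
qed

text \<open>The homomorphism clause of \<open>conj_eq\<close> concerns words of any length; inside a
  group it follows from the case of two factors by induction on the word.\<close>

lemma pg_subgroup_conj_eq:
  assumes H: "pg_subgroup \<L> H" and U: "U \<subseteq> H" and x: "x \<in> H"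
  shows "conj_eq \<L> U x (pg_conj \<L> x ` U)"
proof -
  interpret group "pg_group \<L> H" by (rule pg_subgroup_is_group[OF H])
  let ?G = "pg_group \<L> H"
  note conj = pg_subgroup_conj[OF H x]
  have ccl: "pg_conj \<L> x y \<in> H" if "y \<in> H" for y
    using conj(2)[OF that] m_closed[OF m_closed[OF inv_closed]] x that by (metis pg_group_simps(1))
  have ix: "inv\<^bsub>?G\<^esub> x \<in> carrier ?G" by (rule inv_closed) (simp add: x)
  have "map (pg_conj \<L> x) w \<in> pg_dom \<L> \<and>
      pg_prod \<L> (map (pg_conj \<L> x) w) = pg_conj \<L> x (pg_prod \<L> w)" if w: "w \<in> lists H" for w
    using w
  proof (induction w)
    case Nil
    have "pg_conj \<L> x (pg_prod \<L> []) = \<one>\<^bsub>?G\<^esub>"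
      using conj(2)[of "pg_prod \<L> []"] pg_subgroupD(5)[OF H] x r_one[OF ix] l_inv[of x] by simp
    then show ?case using dom_Nil by simp
  next
    case (Cons y w)
    have yw: "y \<in> H" "w \<in> lists H" using Cons.hyps by auto
    have pw: "pg_prod \<L> w \<in> H" using pg_subgroupD(4)[OF H yw(2)] .
    have dm: "y # w \<in> pg_dom \<L>" by (rule subsetD[OF pg_subgroupD(2)[OF H]]) (use yw in simp)
    have dc: "map (pg_conj \<L> x) (y # w) \<in> pg_dom \<L>"
      by (rule subsetD[OF pg_subgroupD(2)[OF H]]) (use ccl yw in auto)
    have "pg_prod \<L> (map (pg_conj \<L> x) (y # w)) =
        pg_conj \<L> x y \<otimes>\<^bsub>?G\<^esub> pg_conj \<L> x (pg_prod \<L> w)"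
      using Cons.IH dc prod_Cons[of "pg_conj \<L> x y" "map (pg_conj \<L> x) w"] by simp
    also have "\<dots> = inv\<^bsub>?G\<^esub> x \<otimes>\<^bsub>?G\<^esub> (y \<otimes>\<^bsub>?G\<^esub> pg_prod \<L> w) \<otimes>\<^bsub>?G\<^esub> x"
      unfolding conj(2)[OF yw(1)] conj(2)[OF pw]
      by (rule inv_conj_mult) (simp_all add: x yw(1) pw)
    also have "y \<otimes>\<^bsub>?G\<^esub> pg_prod \<L> w = pg_prod \<L> (y # w)" using prod_Cons[OF dm] by simp
    also have "inv\<^bsub>?G\<^esub> x \<otimes>\<^bsub>?G\<^esub> pg_prod \<L> (y # w) \<otimes>\<^bsub>?G\<^esub> x = pg_conj \<L> x (pg_prod \<L> (y # w))"
      using conj(2)[of "pg_prod \<L> (y # w)"] pg_subgroupD(4)[OF H, of "y # w"] yw by simp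
    finally show ?case using dc by simp
  qed
  then show ?thesis
    unfolding conj_eq_def using U conj(1) subsetD[OF lists_mono[OF U]] by blast
qed

text \<open>The bridge between normality in HOL-Algebra and the normalizer of the partial group. In
  this form normality of \<open>U\<close> passes to smaller subgroups, and it is evident for a
  subgroup of the form N(U).\<close>

lemma pg_normal_iff:
  assumes H: "pg_subgroup \<L> H" and U: "pg_subgroup \<L> U" and UH: "U \<subseteq> H"
  shows "U \<lhd> pg_group \<L> H \<longleftrightarrow> H \<subseteq> pg_normalizer \<L> U"
proof -
  note pg_inv = inv_closed inv_inv
  interpret group "pg_group \<L> H" by (rule pg_subgroup_is_group[OF H])
  have Us: "subgroup U (pg_group \<L> H)" using pg_subgroup_iff[OF H] U UH by simp
  show ?thesis
  proof
    assume N: "U \<lhd> pg_group \<L> H"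
    show "H \<subseteq> pg_normalizer \<L> U"
    proof
      fix x assume x: "x \<in> H"
      have "pg_conj \<L> x ` U = U"
      proof
        show "pg_conj \<L> x ` U \<subseteq> U"
          using normal.inv_op_closed1[OF N] pg_subgroup_conj(2)[OF H x] x UH by auto
        show "U \<subseteq> pg_conj \<L> x ` U"
        proof
          fix u assume u: "u \<in> U"
          have ix: "pg_inv \<L> x \<in> H" using pg_subgroupD(3)[OF H x] .
          have xc: "x \<in> pg_carrier \<L>" using x pg_subgroupD(1)[OF H] by blast
          have "pg_conj \<L> (pg_inv \<L> x) u \<in> U"
            using normal.inv_op_closed1[OF N] pg_subgroup_conj(2)[OF H ix] ix UH u by auto
          moreover have "pg_conj \<L> x (pg_conj \<L> (pg_inv \<L> x) u) = u"
            using conj_conj_inv(2)[OF pg_inv(1)[OF xc] pg_subgroup_conj(1)[OF H ix]] UH u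
            by (auto simp: pg_inv(2)[OF xc])
          ultimately show "u \<in> pg_conj \<L> x ` U" by (metis image_eqI)
        qed
      qed
      then show "x \<in> pg_normalizer \<L> U"
        using pg_subgroup_conj_eq[OF H UH x] x pg_subgroupD(1)[OF H]
        by (auto simp: pg_normalizer_def)
    qed
  next
    assume HN: "H \<subseteq> pg_normalizer \<L> U"
    show "U \<lhd> pg_group \<L> H"
    proof (rule normal_invI[OF Us])
      fix x h assume x: "x \<in> carrier (pg_group \<L> H)" and h: "h \<in> U"
      let ?x = "inv\<^bsub>pg_group \<L> H\<^esub> x"
      have ix: "?x \<in> H" using inv_closed[OF x] by simp
      then have "pg_conj \<L> ?x h \<in> U"
        using HN h by (auto simp: pg_normalizer_def conj_eq_def)
      moreover have "pg_conj \<L> ?x h = inv\<^bsub>pg_group \<L> H\<^esub> ?x \<otimes>\<^bsub>pg_group \<L> H\<^esub> h \<otimes>\<^bsub>pg_group \<L> H\<^esub> ?x"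
        using pg_subgroup_conj(2)[OF H ix] h UH by blast
      ultimately show "x \<otimes>\<^bsub>pg_group \<L> H\<^esub> h \<otimes>\<^bsub>pg_group \<L> H\<^esub> ?x \<in> U"
        using inv_inv[OF x] by simp
    qed
  qed
qed

lemma pg_centralizer_mono: "A \<subseteq> B \<Longrightarrow> pg_centralizer \<L> B \<subseteq> pg_centralizer \<L> A"
  by (auto simp: pg_centralizer_def)

lemma pg_centralizer_subset_normalizer:
  assumes A: "pg_subgroup \<L> A"
  shows "pg_centralizer \<L> A \<subseteq> pg_normalizer \<L> A"
proof
  fix x assume "x \<in> pg_centralizer \<L> A"
  then have x: "x \<in> pg_carrier \<L>" "\<And>u. u \<in> A \<Longrightarrow> u \<in> conj_dom \<L> x" "\<And>u. u \<in> A \<Longrightarrow> pg_conj \<L> x u = u"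
    by (auto simp: pg_centralizer_def)
  have "map (pg_conj \<L> x) w = w" if "w \<in> lists A" for w
    using that x(3) by (intro map_idI) auto
  then have "conj_eq \<L> A x A"
    using x pg_subgroupD(2,4)[OF A] by (auto simp: conj_eq_def)
  with x show "x \<in> pg_normalizer \<L> A" by (simp add: pg_normalizer_def)
qed

lemma pg_centralizer_in_subgroup:
  assumes H: "pg_subgroup \<L> H" and A: "A \<subseteq> H"
  shows "H \<inter> pg_centralizer \<L> A = group_centralizer (pg_group \<L> H) A"
proof -
  interpret group "pg_group \<L> H" by (rule pg_subgroup_is_group[OF H])
  let ?G = "pg_group \<L> H"
  have "x \<in> pg_centralizer \<L> A \<longleftrightarrow> (\<forall>a\<in>A. x \<otimes>\<^bsub>?G\<^esub> a = a \<otimes>\<^bsub>?G\<^esub> x)" if x: "x \<in> H" for x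
  proof -
    have "pg_conj \<L> x a = a \<longleftrightarrow> x \<otimes>\<^bsub>?G\<^esub> a = a \<otimes>\<^bsub>?G\<^esub> x" if a: "a \<in> A" for a
    proof -
      have c: "x \<in> carrier ?G" "a \<in> carrier ?G" using x a A by auto
      have "pg_conj \<L> x a = inv\<^bsub>?G\<^esub> x \<otimes>\<^bsub>?G\<^esub> (a \<otimes>\<^bsub>?G\<^esub> x)"
        using pg_subgroup_conj(2)[OF H x] c m_assoc[OF inv_closed[OF c(1)] c(2,1)] by simp
      then show ?thesis
        using inv_solve_left[OF c(2) c(1) m_closed[OF c(2,1)]] by metis
    qed
    then show ?thesis
      using x A pg_subgroup_conj(1)[OF H x] pg_subgroupD(1)[OF H]
      by (auto simp: pg_centralizer_def)
  qed
  then show ?thesis unfolding group_centralizer_def by auto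
qed

end

section \<open>Localities\<close>

context locality begin

section \<open>Normalizers of objects are groups\<close>

lemma object_subset_normalizer:
  assumes P: "P \<in> \<Delta>" shows "P \<subseteq> pg_normalizer \<L> P"
proof -
  have Ps: "pg_subgroup \<L> P" using objects_subgroups[OF P] by simp
  interpret group "pg_group \<L> P" by (rule pg_subgroup_is_group[OF Ps])
  have "P \<lhd> pg_group \<L> P" using carrier_normal by simp
  then show ?thesis using pg_normal_iff[OF Ps Ps] by simp
qed

lemma pg_normalizer_dom:
  assumes P: "P \<in> \<Delta>" shows "lists (pg_normalizer \<L> P) \<subseteq> pg_dom \<L>"
proof
  fix w assume w: "w \<in> lists (pg_normalizer \<L> P)"
  then have "w \<in> lists (pg_carrier \<L>)" by (auto simp: pg_normalizer_def)
  moreover have "conj_eq \<L> P (w ! i) P" if "i < length w" for i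
    using w that by (auto simp: pg_normalizer_def)
  \<comment> \<open>Every letter normalizes \<open>P\<close>, so the constant chain of objects is a
    witness.\<close>
  ultimately show "w \<in> pg_dom \<L>"
    using P dom_iff_objects by (auto intro!: exI[of _ "\<lambda>_. P"])
qed

text \<open>All words over N(P) lie in the domain, and \<open>P\<close> itself lies in N(P). So
  (y^-1, x^-1, z, x, y) with \<open>z\<close> in \<open>P\<close> may be bracketed freely, which
  shows that conjugation by the product xy is conjugation by \<open>x\<close> followed by
  \<open>y\<close>. The homomorphism clause of \<open>conj_eq\<close> has to be carried along for
  inverses and products.\<close>

lemma pg_normalizer_subgroup:
  assumes P: "P \<in> \<Delta>" shows "pg_subgroup \<L> (pg_normalizer \<L> P)"
proof -
  let ?N = "pg_normalizer \<L> P"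
  have Ps: "pg_subgroup \<L> P" using objects_subgroups[OF P] by simp
  note PD = pg_subgroupD[OF Ps]
  have PN: "P \<subseteq> ?N" by (rule object_subset_normalizer[OF P])
  have dom: "w \<in> pg_dom \<L>" if "w \<in> lists ?N" for w
    using pg_normalizer_dom[OF P] that by blast
  have mapP: "map f w \<in> lists P" if "f ` P = P" "w \<in> lists P" for f w
    using that(2) imageI[of _ P f, unfolded that(1)] by auto
  \<comment> \<open>An introduction rule without the domain part of \<open>conj_eq\<close>:
    conjugating a word over \<open>P\<close> letter by letter gives a word over \<open>P\<close>
    again.\<close>
  have NI: "x \<in> ?N" if "x \<in> pg_carrier \<L>" "P \<subseteq> conj_dom \<L> x" "pg_conj \<L> x ` P = P"
    "\<And>w. w \<in> lists P \<Longrightarrow> pg_prod \<L> (map (pg_conj \<L> x) w) = pg_conj \<L> x (pg_prod \<L> w)" for x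
  proof -
    have "map (pg_conj \<L> x) w \<in> lists P" if "w \<in> lists P" for w
      by (rule mapP[OF \<open>pg_conj \<L> x ` P = P\<close> that])
    then have "map (pg_conj \<L> x) w \<in> pg_dom \<L>" if "w \<in> lists P" for w
      using that subsetD[OF PD(2)] by blast
    then show ?thesis using that by (simp add: pg_normalizer_def conj_eq_def)
  qed
  have ND: "x \<in> pg_carrier \<L>" "P \<subseteq> conj_dom \<L> x" "pg_conj \<L> x ` P = P"
    "w \<in> lists P \<Longrightarrow> pg_prod \<L> (map (pg_conj \<L> x) w) = pg_conj \<L> x (pg_prod \<L> w)"
    if "x \<in> ?N" for x w
    using that Ps by (auto simp: pg_normalizer_def conj_eq_def)
  have inv: "pg_inv \<L> x \<in> ?N" if x: "x \<in> ?N" for x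
  proof (rule NI)
    note xD = ND[OF x]
    have bwd: "pg_conj \<L> (pg_inv \<L> x) (pg_conj \<L> x y) = y" if "y \<in> P" for y
      using conj_conj_inv(2)[OF xD(1)] xD(2) that by blast
    show "pg_inv \<L> x \<in> pg_carrier \<L>" by (rule inv_closed[OF xD(1)])
    show "P \<subseteq> conj_dom \<L> (pg_inv \<L> x)"
    proof
      fix z assume "z \<in> P"
      then obtain y where "y \<in> P" "z = pg_conj \<L> x y" using xD(3) by blast
      then show "z \<in> conj_dom \<L> (pg_inv \<L> x)" using conj_conj_inv(1)[OF xD(1)] xD(2) by blast
    qed
    have "pg_conj \<L> (pg_inv \<L> x) ` (pg_conj \<L> x ` P) = (\<lambda>y. y) ` P"
      unfolding image_image by (rule image_cong) (use bwd in auto)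
    then show "pg_conj \<L> (pg_inv \<L> x) ` P = P" using xD(3) by simp
    fix w assume w: "w \<in> lists P"
    let ?v = "map (pg_conj \<L> (pg_inv \<L> x)) w"
    have v: "?v \<in> lists P" by (rule mapP[OF \<open>pg_conj \<L> (pg_inv \<L> x) ` P = P\<close> w])
    have fwd: "pg_conj \<L> x (pg_conj \<L> (pg_inv \<L> x) z) = z" if z: "z \<in> P" for z
    proof -
      have "z \<in> pg_conj \<L> x ` P" using z xD(3) by simp
      then obtain y where "y \<in> P" "z = pg_conj \<L> x y" by blast
      then show ?thesis using bwd by simp
    qed
    have "map (pg_conj \<L> x) ?v = w"
      using w fwd by (auto simp: map_idI)
    then have "pg_prod \<L> w = pg_conj \<L> x (pg_prod \<L> ?v)"
      using xD(4)[OF v] by simp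
    then show "pg_prod \<L> ?v = pg_conj \<L> (pg_inv \<L> x) (pg_prod \<L> w)"
      using bwd[OF PD(4)[OF v]] by simp
  qed
  have mult: "pg_prod \<L> [x, y] \<in> ?N" if x: "x \<in> ?N" and y: "y \<in> ?N" for x y
  proof -
    note xD = ND[OF x] and yD = ND[OF y]
    have xy: "[x, y] \<in> pg_dom \<L>" using dom[of "[x, y]"] x y by simp
    have i: "pg_inv \<L> (pg_prod \<L> [x, y]) = pg_prod \<L> [pg_inv \<L> y, pg_inv \<L> x]"
      using prod_rev_inv[OF xy] by simp
    have c: "z \<in> conj_dom \<L> (pg_prod \<L> [x, y]) \<and>
      pg_conj \<L> (pg_prod \<L> [x, y]) z = pg_conj \<L> y (pg_conj \<L> x z)" if z: "z \<in> P" for z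
    proof -
      let ?x = "pg_inv \<L> x" and ?y = "pg_inv \<L> y"
      have w: "[?y, ?x, z, x, y] \<in> pg_dom \<L>"
        using dom[of "[?y, ?x, z, x, y]"] x y inv z PN by auto
      have w2: "[pg_prod \<L> [?y, ?x], z, x, y] \<in> pg_dom \<L>"
        using dom_assoc[of "[]" "[?y, ?x]" "[z, x, y]"] w by simp
      have w3: "[pg_prod \<L> [?y, ?x], z, pg_prod \<L> [x, y]] \<in> pg_dom \<L>"
        using dom_assoc[of "[pg_prod \<L> [?y, ?x], z]" "[x, y]" "[]"] w2 by simp
      have "pg_conj \<L> (pg_prod \<L> [x, y]) z = pg_prod \<L> [?y, ?x, z, x, y]"
        using prod_assoc[of "[pg_prod \<L> [?y, ?x], z]" "[x, y]" "[]"] w2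
          prod_assoc[of "[]" "[?y, ?x]" "[z, x, y]"] w by (simp add: pg_conj_def i)
      also have "\<dots> = pg_conj \<L> y (pg_conj \<L> x z)"
        using prod_assoc[of "[?y]" "[?x, z, x]" "[y]"] w by (simp add: pg_conj_def)
      finally show ?thesis using w3 z PD(1) by (auto simp: conj_dom_def i)
    qed
    show ?thesis
    proof (rule NI)
      show "pg_prod \<L> [x, y] \<in> pg_carrier \<L>" by (rule prod_closed[OF xy])
      show "P \<subseteq> conj_dom \<L> (pg_prod \<L> [x, y])" using c by blast
      have "pg_conj \<L> (pg_prod \<L> [x, y]) ` P = pg_conj \<L> y ` pg_conj \<L> x ` P"
        unfolding image_image by (rule image_cong) (use c in auto)
      then show "pg_conj \<L> (pg_prod \<L> [x, y]) ` P = P" using xD(3) yD(3) by simp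
      fix w assume w: "w \<in> lists P"
      have wx: "map (pg_conj \<L> x) w \<in> lists P" by (rule mapP[OF xD(3) w])
      have "map (pg_conj \<L> (pg_prod \<L> [x, y])) w = map (pg_conj \<L> y) (map (pg_conj \<L> x) w)"
        using w c by auto
      then have "pg_prod \<L> (map (pg_conj \<L> (pg_prod \<L> [x, y])) w) =
          pg_prod \<L> (map (pg_conj \<L> y) (map (pg_conj \<L> x) w))"
        by (simp only:)
      also have "\<dots> = pg_conj \<L> y (pg_conj \<L> x (pg_prod \<L> w))"
        by (simp only: yD(4)[OF wx] xD(4)[OF w])
      also have "\<dots> = pg_conj \<L> (pg_prod \<L> [x, y]) (pg_prod \<L> w)"
        using c[OF PD(4)[OF w]] by simp
      finally show "pg_prod \<L> (map (pg_conj \<L> (pg_prod \<L> [x, y])) w) =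
          pg_conj \<L> (pg_prod \<L> [x, y]) (pg_prod \<L> w)" .
    qed
  qed
  show ?thesis
  proof (rule pg_subgroupI)
    show "?N \<subseteq> pg_carrier \<L>" by (auto simp: pg_normalizer_def)
    show "lists ?N \<subseteq> pg_dom \<L>" using dom by blast
    show "pg_prod \<L> [] \<in> ?N" using PN PD(5) by blast
  qed (use inv mult in auto)
qed

lemma S_subgroup: "pg_subgroup \<L> S"
  using S_p_subgroup by (simp add: pg_p_subgroup_def)

lemma S_parabolic: "parabolic \<L> S S"
  using S_subgroup by (simp add: parabolic_def)

lemma parabolic_subgroup: "parabolic \<L> S H \<Longrightarrow> pg_subgroup \<L> H"
  by (simp add: parabolic_def)

lemma parabolic_superset: "parabolic \<L> S H \<Longrightarrow> S \<subseteq> H"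
  by (simp add: parabolic_def)

text \<open>Along the word \<open>(h\<^sub>1, h\<^sub>1\<^sup>-\<^sup>1, h\<^sub>2, h\<^sub>2\<^sup>-\<^sup>1, \<dots>)\<close> the first object of a chain witnessing
  membership in the domain returns to itself after every second step.\<close>

lemma object_chain_conj_subset:
  assumes H: "pg_subgroup \<L> H" and SH: "S \<subseteq> H" and hs: "set hs \<subseteq> H"
    and "\<And>i. i \<le> length (concat (map (\<lambda>h. [h, pg_inv \<L> h]) hs)) \<Longrightarrow> P i \<in> \<Delta>"
    and "\<And>i. i < length (concat (map (\<lambda>h. [h, pg_inv \<L> h]) hs)) \<Longrightarrow>
      conj_eq \<L> (P i) (concat (map (\<lambda>h. [h, pg_inv \<L> h]) hs) ! i) (P (Suc i))"
    and "h \<in> set hs"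
  shows "pg_conj \<L> h ` P 0 \<subseteq> S"
  using assms(3-)
proof (induction hs arbitrary: P)
  case (Cons g hs)
  let ?w = "concat (map (\<lambda>h. [h, pg_inv \<L> h]) hs)"
  note P = Cons.prems(2) and c = Cons.prems(3)
  have P0: "P 0 \<subseteq> S" "P 1 \<subseteq> S"
    using P[of 0] P[of 1] objects_subgroups by auto
  have c1: "pg_conj \<L> g ` P 0 = P 1" and c2: "pg_conj \<L> (pg_inv \<L> g) ` P 1 = P 2"
    using c[of 0] c[of 1] by (auto simp: conj_eq_def numeral_2_eq_2)
  have g: "g \<in> H" "g \<in> pg_carrier \<L>" using Cons.prems(1) pg_subgroupD(1)[OF H] by auto
  have "pg_conj \<L> (pg_inv \<L> g) (pg_conj \<L> g y) = y" if "y \<in> P 0" for y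
    using conj_conj_inv(2)[OF g(2) pg_subgroup_conj(1)[OF H g(1)]] that P0 SH by blast
  then have "pg_conj \<L> (pg_inv \<L> g) ` pg_conj \<L> g ` P 0 = (\<lambda>y. y) ` P 0"
    unfolding image_image by (intro image_cong) auto
  then have P2: "P 2 = P 0" using c1 c2 by simp
  show ?case
  proof (cases "h = g")
    case True
    then show ?thesis using c1 P0 by simp
  next
    case False
    have "pg_conj \<L> h ` P (0 + 2) \<subseteq> S"
    proof (rule Cons.IH)
      show "set hs \<subseteq> H" "h \<in> set hs" using Cons.prems False by auto
      show "P (i + 2) \<in> \<Delta>" if "i \<le> length ?w" for i
        using P[of "i + 2"] that by simp
      show "conj_eq \<L> (P (i + 2)) (?w ! i) (P (Suc i + 2))" if "i < length ?w" for i
        using c[of "i + 2"] that by simp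
    qed
    then show ?thesis by (simp only: add_0 P2)
  qed
qed simp

end

section \<open>Parabolic subgroups\<close>

locale prime_locality = locality p \<L> \<Delta> S for p \<L> \<Delta> S +
  assumes prime: "prime p"
begin

lemma subgroup_finite_group_prime:
  assumes H: "pg_subgroup \<L> H" shows "finite_group_prime (pg_group \<L> H) p"
  using pg_subgroup_is_group[OF H] finite_subset[OF pg_subgroupD(1)[OF H] finite_carrier] prime
  by (simp add: finite_group_prime_def finite_group_prime_axioms_def)

lemma p_subgroup_pg_group_iff:
  assumes H: "pg_subgroup \<L> H"
  shows "p_subgroup p (pg_group \<L> H) P \<longleftrightarrow> pg_p_subgroup p \<L> P \<and> P \<subseteq> H"
  using pg_subgroup_iff[OF H] by (auto simp: p_subgroup_def pg_p_subgroup_def)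

lemma S_sylow:
  assumes H: "parabolic \<L> S H" shows "sylow_subgroup p (pg_group \<L> H) S"
proof -
  note Hs = parabolic_subgroup[OF H] and SH = parabolic_superset[OF H]
  interpret finite_group_prime "pg_group \<L> H" p by (rule subgroup_finite_group_prime[OF Hs])
  show ?thesis
    using maximal_p_subgroup_sylow[of S] S_maximal S_p_subgroup SH
    unfolding p_subgroup_pg_group_iff[OF Hs] by blast
qed

lemma p_core_parabolic:
  assumes H: "parabolic \<L> S H"
  shows "pg_p_core p \<L> H \<lhd> pg_group \<L> H" "pg_p_core p \<L> H \<subseteq> S"
    "pg_subgroup \<L> (pg_p_core p \<L> H)"
    "U \<lhd> pg_group \<L> H \<Longrightarrow> U \<subseteq> S \<Longrightarrow> U \<subseteq> pg_p_core p \<L> H"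
proof -
  note Hs = parabolic_subgroup[OF H]
  interpret finite_group_prime "pg_group \<L> H" p by (rule subgroup_finite_group_prime[OF Hs])
  note S = S_sylow[OF H]
  show n: "pg_p_core p \<L> H \<lhd> pg_group \<L> H" by (rule p_core_normal)
  show "pg_p_core p \<L> H \<subseteq> S" by (rule p_core_subset_sylow[OF S])
  show "pg_subgroup \<L> (pg_p_core p \<L> H)"
    using normal_imp_subgroup[OF n] pg_subgroup_iff[OF Hs] by simp
  show "U \<subseteq> pg_p_core p \<L> H" if U: "U \<lhd> pg_group \<L> H" "U \<subseteq> S"
    by (rule p_core_upper[OF U(1) p_subgroup_mono[OF sylow_imp_p_subgroup[OF S]
          normal_imp_subgroup[OF U(1)] U(2)]])
qed

lemma normal_parabolic:
  assumes "parabolic \<L> S H" "pg_subgroup \<L> U" "U \<subseteq> S"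
  shows "U \<lhd> pg_group \<L> H \<longleftrightarrow> H \<subseteq> pg_normalizer \<L> U"
  using assms by (intro pg_normal_iff) (auto simp: parabolic_def)

lemma p_core_object:
  assumes H: "parabolic \<L> S H" shows "pg_p_core p \<L> H \<in> \<Delta>"
proof -
  note Hs = parabolic_subgroup[OF H] and SH = parabolic_superset[OF H]
  have fin: "finite H" using finite_subset[OF pg_subgroupD(1)[OF Hs] finite_carrier] .
  then obtain hs where hs: "set hs = H" using finite_list by blast
  let ?w = "concat (map (\<lambda>h. [h, pg_inv \<L> h]) hs)"
  have w: "?w \<in> lists H" using hs pg_subgroupD(3)[OF Hs] by auto
  then have "?w \<in> pg_dom \<L>" "?w \<in> lists (pg_carrier \<L>)"
    using pg_subgroupD(1,2)[OF Hs] by blast+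
  then obtain P where P: "\<And>i. i \<le> length ?w \<Longrightarrow> P i \<in> \<Delta>"
    "\<And>i. i < length ?w \<Longrightarrow> conj_eq \<L> (P i) (?w ! i) (P (Suc i))"
    using dom_iff_objects by blast
  have P0: "P 0 \<in> \<Delta>" using P(1) by simp
  have conjS: "pg_conj \<L> h y \<in> S" if "h \<in> H" "y \<in> P 0" for h y
    using object_chain_conj_subset[OF Hs SH _ P] hs that by blast
  interpret group "pg_group \<L> H" by (rule pg_subgroup_is_group[OF Hs])
  let ?G = "pg_group \<L> H"
  have P0H: "P 0 \<subseteq> H" using objects_subgroups[OF P0] SH by blast
  \<comment> \<open>The subgroup generated by the \<open>H\<close>-conjugates of \<open>P 0\<close>
    is normal in \<open>H\<close> and contained in \<open>S\<close>, so O_p(H) is an overgroup of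
    the object \<open>P 0\<close>.\<close>
  define X where "X = (\<Union>h\<in>H. pg_conj \<L> h ` P 0)"
  define U where "U = generate ?G X"
  have XS: "X \<subseteq> S" using conjS by (auto simp: X_def)
  have US: "U \<subseteq> S"
    unfolding U_def
    by (rule generate_subgroup_incl[OF XS]) (use pg_subgroup_iff[OF Hs] S_subgroup SH in simp)
  have Un: "U \<lhd> ?G"
    unfolding U_def
  proof (rule normal_generateI)
    show "X \<subseteq> carrier ?G" using XS SH by simp
    fix x g assume "x \<in> X" and g: "g \<in> carrier ?G"
    then obtain h y where hy: "h \<in> H" "y \<in> P 0" "x = pg_conj \<L> h y" by (auto simp: X_def)
    \<comment> \<open>\<open>pg_conj\<close> conjugates from the right, whereas
      \<open>normal_generateI\<close> asks for g x g^-1; hence the new conjugating element h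
      g^-1.\<close>
    let ?k = "h \<otimes>\<^bsub>?G\<^esub> inv\<^bsub>?G\<^esub> g"
    have c: "h \<in> carrier ?G" "y \<in> carrier ?G" "g \<in> carrier ?G" using hy g P0H by auto
    have k: "?k \<in> H" using m_closed[OF c(1) inv_closed[OF c(3)]] by simp
    have yH: "y \<in> H" using hy P0H by blast
    have "g \<otimes>\<^bsub>?G\<^esub> (inv\<^bsub>?G\<^esub> h \<otimes>\<^bsub>?G\<^esub> y \<otimes>\<^bsub>?G\<^esub> h) \<otimes>\<^bsub>?G\<^esub> inv\<^bsub>?G\<^esub> g =
        inv\<^bsub>?G\<^esub> ?k \<otimes>\<^bsub>?G\<^esub> y \<otimes>\<^bsub>?G\<^esub> ?k"
      using c by (simp del: pg_group_simps add: m_assoc inv_mult_group)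
    then have "g \<otimes>\<^bsub>?G\<^esub> x \<otimes>\<^bsub>?G\<^esub> inv\<^bsub>?G\<^esub> g = pg_conj \<L> ?k y"
      unfolding hy(3) pg_subgroup_conj(2)[OF Hs hy(1) yH] pg_subgroup_conj(2)[OF Hs k yH] .
    then show "g \<otimes>\<^bsub>?G\<^esub> x \<otimes>\<^bsub>?G\<^esub> inv\<^bsub>?G\<^esub> g \<in> X"
      unfolding X_def using k hy(2) by blast
  qed
  have "P 0 \<subseteq> X"
  proof
    fix y assume y: "y \<in> P 0"
    then have yH: "y \<in> H" using P0H by blast
    have "pg_conj \<L> \<one>\<^bsub>?G\<^esub> y = y"
      using pg_subgroup_conj(2)[OF Hs _ yH, of "\<one>\<^bsub>?G\<^esub>"] pg_subgroupD(5)[OF Hs]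
        l_one[of y] r_one[of y] inv_one yH by (simp del: inv_one)
    then show "y \<in> X" unfolding X_def using y pg_subgroupD(5)[OF Hs]
      by (metis UN_I image_eqI pg_group_simps(3))
  qed
  then have "P 0 \<subseteq> U" unfolding U_def by (auto intro: generate.incl)
  also have "U \<subseteq> pg_p_core p \<L> H" by (rule p_core_parabolic(4)[OF H Un US])
  finally show ?thesis
    using objects_overgroup_closed[OF P0] p_core_parabolic[OF H] by blast
qed

text \<open>C(A) is contained in N(A), where both notions of centralizer agree. From here on
  centralizers of objects can be treated inside a finite group.\<close>

lemma centralizer_object:
  assumes A: "A \<in> \<Delta>"
  shows "pg_centralizer \<L> A = group_centralizer (pg_group \<L> (pg_normalizer \<L> A)) A"
  using pg_centralizer_in_subgroup[OF pg_normalizer_subgroup[OF A] object_subset_normalizer[OF A]]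
    pg_centralizer_subset_normalizer[of A] objects_subgroups[OF A] by blast

lemma normalizer_parabolic:
  assumes A: "A \<in> \<Delta>" and H: "parabolic \<L> S H" and HN: "H \<subseteq> pg_normalizer \<L> A"
  shows "parabolic \<L> S (pg_normalizer \<L> A)"
  using pg_normalizer_subgroup[OF A] H HN by (auto simp: parabolic_def)

text \<open>The hypothesis speaks of N(P) for objects P. For P = O_p(H) one has O_p(N(P)) = P: the
  left side lies in \<open>S\<close> and is normalized by H \<subseteq> N(P), so it is contained in
  O_p(H); conversely P is normal in N(P). Therefore C(P) \<subseteq> P, as required for
  \<open>H\<close>.\<close>

lemma parabolic_char_p:
  assumes oc: "objective_characteristic p \<L> \<Delta>" and H: "parabolic \<L> S H"
  shows "H \<in> char_p_subgroups p \<L>" and "characteristic_p p (pg_group \<L> H)"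
proof -
  let ?P = "pg_p_core p \<L> H" and ?N = "pg_normalizer \<L> (pg_p_core p \<L> H)"
  note Hs = parabolic_subgroup[OF H]
  note core = p_core_parabolic[OF H] and obj = p_core_object[OF H]
  have HN: "H \<subseteq> ?N" using normal_parabolic[OF H core(3,2)] core(1) by simp
  have N: "parabolic \<L> S ?N" by (rule normalizer_parabolic[OF obj H HN])
  note Ns = parabolic_subgroup[OF N]
  have "?P \<subseteq> pg_p_core p \<L> ?N"
    using p_core_parabolic(4)[OF N] normal_parabolic[OF N core(3,2)] core(2) by blast
  moreover have "pg_p_core p \<L> ?N \<subseteq> ?P"
  proof (rule core(4))
    show "pg_p_core p \<L> ?N \<subseteq> S" by (rule p_core_parabolic(2)[OF N])
    show "pg_p_core p \<L> ?N \<lhd> pg_group \<L> H"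
      using normal_parabolic[OF H p_core_parabolic(3,2)[OF N]] HN
        normal_parabolic[OF N p_core_parabolic(3,2)[OF N]] p_core_parabolic(1)[OF N] by blast
  qed
  ultimately have "pg_p_core p \<L> ?N = ?P" by blast
  moreover have "group_centralizer (pg_group \<L> ?N) (pg_p_core p \<L> ?N) \<subseteq> pg_p_core p \<L> ?N"
    using oc obj unfolding objective_characteristic_def characteristic_p_def by blast
  ultimately have "group_centralizer (pg_group \<L> ?N) ?P \<subseteq> ?P" by simp
  then have C: "pg_centralizer \<L> ?P \<subseteq> ?P" using centralizer_object[OF obj] by simp
  then show "H \<in> char_p_subgroups p \<L>" using Hs by (simp add: char_p_subgroups_def)
  have "?P \<subseteq> H" using core(2) parabolic_superset[OF H] by blast
  then show "characteristic_p p (pg_group \<L> H)"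
    using C pg_centralizer_in_subgroup[OF Hs] by (auto simp: characteristic_p_def)
qed

lemma Y_parabolic:
  assumes H: "parabolic \<L> S H"
  shows "pg_Y p \<L> H \<lhd> pg_group \<L> H" "pg_Y p \<L> H \<subseteq> S" "pg_subgroup \<L> (pg_Y p \<L> H)"
    "Y_candidate p (pg_group \<L> H) (pg_Y p \<L> H)"
    "Y_candidate p (pg_group \<L> H) A \<Longrightarrow> A \<subseteq> pg_Y p \<L> H"
    "H \<subseteq> pg_normalizer \<L> (pg_Y p \<L> H)"
proof -
  note Hs = parabolic_subgroup[OF H]
  interpret finite_group_prime "pg_group \<L> H" p by (rule subgroup_finite_group_prime[OF Hs])
  show Y: "Y_candidate p (pg_group \<L> H) (pg_Y p \<L> H)" by (rule Y_sub_candidate)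
  then show n: "pg_Y p \<L> H \<lhd> pg_group \<L> H" by (simp add: Y_candidate_def)
  show YS: "pg_Y p \<L> H \<subseteq> S" using Y unfolding Y_candidate_iff[OF S_sylow[OF H]] by simp
  show sub: "pg_subgroup \<L> (pg_Y p \<L> H)"
    using normal_imp_subgroup[OF n] pg_subgroup_iff[OF Hs] by simp
  show "Y_candidate p (pg_group \<L> H) A \<Longrightarrow> A \<subseteq> pg_Y p \<L> H" by (rule Y_sub_upper)
  show "H \<subseteq> pg_normalizer \<L> (pg_Y p \<L> H)" using normal_parabolic[OF H sub YS] n by simp
qed

lemma Y_parabolic_mono:
  assumes oc: "objective_characteristic p \<L> \<Delta>"
    and H: "parabolic \<L> S H" and K: "parabolic \<L> S K" and HK: "H \<subseteq> K"
  shows "pg_Y p \<L> H \<subseteq> pg_Y p \<L> K"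
proof -
  note Ks = parabolic_subgroup[OF K]
  interpret finite_group_prime "pg_group \<L> K" p by (rule subgroup_finite_group_prime[OF Ks])
  show ?thesis
    using Y_sub_mono[OF parabolic_char_p(2)[OF oc K] S_sylow[OF K], of H]
      pg_subgroup_iff[OF Ks] parabolic_subgroup[OF H] parabolic_superset[OF H] HK by simp
qed

text \<open>\<open>N\<close> supplies the group in which both products are formed; the two
  inclusions say that \<open>H\<close> and \<open>K\<close> agree modulo C_N(Y_K).\<close>

lemma Y_transfer:
  assumes H: "parabolic \<L> S H" and K: "parabolic \<L> S K" and N: "pg_subgroup \<L> N"
    and HN: "H \<subseteq> N" and KN: "K \<subseteq> N"
    and HK: "H \<subseteq> K <#>\<^bsub>pg_group \<L> N\<^esub> group_centralizer (pg_group \<L> N) (pg_Y p \<L> K)"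
    and KH: "K \<subseteq> H <#>\<^bsub>pg_group \<L> N\<^esub> group_centralizer (pg_group \<L> N) (pg_Y p \<L> K)"
  shows "pg_Y p \<L> K \<subseteq> pg_Y p \<L> H"
proof -
  interpret finite_group_prime "pg_group \<L> N" p by (rule subgroup_finite_group_prime[OF N])
  have "Y_candidate p (pg_group \<L> H) (pg_Y p \<L> K)"
    using Y_candidate_transfer[of K H S "pg_Y p \<L> K"] pg_subgroup_iff[OF N]
      parabolic_subgroup[OF H] parabolic_subgroup[OF K] HN KN S_sylow[OF H] S_sylow[OF K]
      Y_parabolic(4)[OF K] HK KH by simp
  then show ?thesis by (rule Y_parabolic(5)[OF H])
qed

end

section \<open>Large subgroups\<close>

locale large_locality = prime_locality p \<L> \<Delta> S for p \<L> \<Delta> S +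
  fixes Q :: "'a set"
  assumes char_p: "objective_characteristic p \<L> \<Delta>"
    and Q_subgroup: "pg_subgroup \<L> Q" and Q_subset: "Q \<subseteq> S"
    and Q_large: "large \<L> Q" and Q_replete: "replete \<L> \<Delta> S Q"
begin

lemma
  shows Y_S_object: "pg_Y p \<L> S \<in> \<Delta>" and Q_object: "Q \<in> \<Delta>"
    and Y_S_normalizer: "pg_normalizer \<L> (pg_Y p \<L> S) \<subseteq> pg_normalizer \<L> Q"
proof -
  let ?Z = "pg_Y p \<L> S" and ?one = "{pg_prod \<L> []}"
  note Z = Y_parabolic[OF S_parabolic]
  interpret S: finite_group_prime "pg_group \<L> S" p
    by (rule subgroup_finite_group_prime[OF S_subgroup])
  have "?Z \<in> \<Delta> \<and> Q \<in> \<Delta> \<and> pg_normalizer \<L> ?Z \<subseteq> pg_normalizer \<L> Q"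
  proof (cases "S = ?one")
    \<comment> \<open>Largeness and repleteness speak of non-trivial subgroups only. If S = 1, the
      trivial subgroup is the unique object, and it is also \<open>Q\<close> and Y_S.\<close>
    case True
    have one: "U = ?one" if "pg_subgroup \<L> U" "U \<subseteq> S" for U
      using pg_subgroupD(5)[OF that(1)] that(2) True by blast
    obtain P where "P \<in> \<Delta>" using objects_nonempty by blast
    then have "?one \<in> \<Delta>" using one objects_subgroups by blast
    then show ?thesis using one[OF Z(3,2)] one[OF Q_subgroup Q_subset] by simp
  next
    case False
    obtain n where n: "order (pg_group \<L> S) = p ^ n"
      using S_p_subgroup by (auto simp: pg_p_subgroup_def order_def)
    have nt: "?Z \<noteq> ?one" using S.p_group_Y_sub_nontrivial[OF n] False by simp
    have "?Z \<subseteq> group_center (pg_group \<L> S)" by (rule S.p_group_Y_sub_central[OF n])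
    then have cen: "?Z \<subseteq> group_centralizer (pg_group \<L> S) S"
      by (simp add: group_center_def)
    then have ZC: "?Z \<subseteq> group_centralizer (pg_group \<L> S) Q"
      using Q_subset by (auto simp: group_centralizer_def)
    then have Zo: "?Z \<in> \<Delta>" using Q_replete Z(3) nt by (auto simp: replete_def)
    \<comment> \<open>Largeness applies to subgroups of Z(Q). Y_S is one of them: it centralizes
      \<open>Q\<close>, and C(Q) \<subseteq> Q puts it inside.\<close>
    have "?Z \<subseteq> pg_centralizer \<L> Q"
      using ZC pg_centralizer_in_subgroup[OF S_subgroup Q_subset] by blast
    then have ZQ: "?Z \<subseteq> Q" using Q_large by (auto simp: large_def)
    then have "?Z \<subseteq> group_center (pg_group \<L> Q)"
      using cen Q_subset by (auto simp: group_center_def group_centralizer_def)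
    then have "pg_normalizer \<L> ?Z \<subseteq> pg_normalizer \<L> Q"
      using Q_large Z(3) nt by (auto simp: large_def)
    with Zo objects_overgroup_closed[OF Zo Q_subgroup ZQ Q_subset] show ?thesis by blast
  qed
  then show "?Z \<in> \<Delta>" "Q \<in> \<Delta>" "pg_normalizer \<L> ?Z \<subseteq> pg_normalizer \<L> Q" by auto
qed

lemma Y_object:
  assumes H: "parabolic \<L> S H"
  shows "pg_Y p \<L> H \<in> \<Delta>" and "pg_centralizer \<L> (pg_Y p \<L> H) \<subseteq> pg_normalizer \<L> Q"
    and "parabolic \<L> S (pg_normalizer \<L> (pg_Y p \<L> H))"
proof -
  have ZY: "pg_Y p \<L> S \<subseteq> pg_Y p \<L> H"
    by (rule Y_parabolic_mono[OF char_p S_parabolic H parabolic_superset[OF H]])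
  show obj: "pg_Y p \<L> H \<in> \<Delta>"
    by (rule objects_overgroup_closed[OF Y_S_object Y_parabolic(3)[OF H] ZY Y_parabolic(2)[OF H]])
  show "pg_centralizer \<L> (pg_Y p \<L> H) \<subseteq> pg_normalizer \<L> Q"
    using pg_centralizer_mono[OF ZY] Y_S_normalizer
      pg_centralizer_subset_normalizer[OF Y_parabolic(3)[OF S_parabolic]] by blast
  show "parabolic \<L> S (pg_normalizer \<L> (pg_Y p \<L> H))"
    by (rule normalizer_parabolic[OF obj H Y_parabolic(6)[OF H]])
qed

lemma Q_normal_iff:
  assumes H: "parabolic \<L> S H" shows "Q \<lhd> pg_group \<L> H \<longleftrightarrow> H \<subseteq> pg_normalizer \<L> Q"
  by (rule normal_parabolic[OF H Q_subgroup Q_subset])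

lemma pg_set_mult_in_subgroup:
  assumes R: "pg_subgroup \<L> R" and "H \<subseteq> R" "C \<subseteq> R"
  shows "pg_set_mult \<L> H C = H <#>\<^bsub>pg_group \<L> R\<^esub> C"
proof -
  have "[a, b] \<in> pg_dom \<L>" if "a \<in> H" "b \<in> C" for a b
    using assms that subsetD[OF pg_subgroupD(2)[OF R], of "[a, b]"] by auto
  then show ?thesis by (auto simp: pg_set_mult_def set_mult_def)
qed

text \<open>\<open>conj_closure\<close> generates inside \<open>K\<close>; generating inside one
  common \<open>R\<close> makes the closures for several subgroups comparable.\<close>

lemma conj_closure_generate:
  assumes R: "pg_subgroup \<L> R" and K: "parabolic \<L> S K" and KR: "K \<subseteq> R"
  shows "conj_closure \<L> Q K = generate (pg_group \<L> R) (\<Union>k\<in>K. pg_conj \<L> k ` Q)"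
proof -
  note Ks = parabolic_subgroup[OF K]
  interpret R: group "pg_group \<L> R" by (rule pg_subgroup_is_group[OF R])
  interpret K: group "pg_group \<L> K" by (rule pg_subgroup_is_group[OF Ks])
  have QK: "Q \<subseteq> K" using Q_subset parabolic_superset[OF K] by blast
  have X: "(\<Union>k\<in>K. pg_conj \<L> k ` Q) \<subseteq> K"
  proof clarify
    fix k q assume k: "k \<in> K" and "q \<in> Q"
    then have q: "q \<in> K" using QK by blast
    show "pg_conj \<L> k q \<in> K"
      unfolding pg_subgroup_conj(2)[OF Ks k q]
      using K.m_closed[OF K.m_closed[OF K.inv_closed]] k q by simp
  qed
  have "subgroup K (pg_group \<L> R)" using pg_subgroup_iff[OF R] Ks KR by simp
  from R.generate_consistent[OF X this] show ?thesis by (simp add: conj_closure_def)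
qed

lemma conj_closure_mono:
  assumes H: "parabolic \<L> S H" and K: "parabolic \<L> S K" and HK: "H \<subseteq> K"
  shows "conj_closure \<L> Q H \<subseteq> conj_closure \<L> Q K"
proof -
  note Ks = parabolic_subgroup[OF K]
  interpret K: group "pg_group \<L> K" by (rule pg_subgroup_is_group[OF Ks])
  show ?thesis
    unfolding conj_closure_generate[OF Ks H HK] conj_closure_generate[OF Ks K order_refl]
    by (rule K.mono_generate) (use HK in blast)
qed

text \<open>Turns normality of \<open>Q\<close> into an equation, so that it transfers between
  subgroups with equal closures.\<close>

lemma Q_normal_iff_conj_closure:
  assumes H: "parabolic \<L> S H"
  shows "Q \<lhd> pg_group \<L> H \<longleftrightarrow> conj_closure \<L> Q H = Q"
proof
  note Hs = parabolic_subgroup[OF H]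
  interpret H: group "pg_group \<L> H" by (rule pg_subgroup_is_group[OF Hs])
  have QH: "Q \<subseteq> H" using Q_subset parabolic_superset[OF H] by blast
  have Qs: "subgroup Q (pg_group \<L> H)" using pg_subgroup_iff[OF Hs] Q_subgroup QH by simp
  {
    assume "Q \<lhd> pg_group \<L> H"
    then have HN: "H \<subseteq> pg_normalizer \<L> Q" using Q_normal_iff[OF H] by simp
    then have "pg_conj \<L> h ` Q = Q" if "h \<in> H" for h
      using that by (auto simp: pg_normalizer_def conj_eq_def)
    then have "(\<Union>k\<in>H. pg_conj \<L> k ` Q) = Q" using pg_subgroupD(5)[OF Hs] by auto
    moreover have "generate (pg_group \<L> H) Q = Q"
    proof
      show "generate (pg_group \<L> H) Q \<subseteq> Q" by (rule H.generate_subgroup_incl[OF order_refl Qs])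
      show "Q \<subseteq> generate (pg_group \<L> H) Q" by (rule subsetI) (rule generate.incl)
    qed
    ultimately show "conj_closure \<L> Q H = Q" by (simp add: conj_closure_def)
  }
  assume Q: "conj_closure \<L> Q H = Q"
  have conj: "pg_conj \<L> h q \<in> Q" if "h \<in> H" "q \<in> Q" for h q
  proof -
    have "pg_conj \<L> h q \<in> conj_closure \<L> Q H"
      unfolding conj_closure_def by (rule generate.incl) (use that in blast)
    then show ?thesis using Q by simp
  qed
  show "Q \<lhd> pg_group \<L> H"
  proof (rule H.normal_invI[OF Qs])
    fix x q assume x: "x \<in> carrier (pg_group \<L> H)" and q: "q \<in> Q"
    let ?x = "inv\<^bsub>pg_group \<L> H\<^esub> x"
    have ix: "?x \<in> H" using H.inv_closed[OF x] by simp
    have qH: "q \<in> H" using q QH by blast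
    have "pg_conj \<L> ?x q = x \<otimes>\<^bsub>pg_group \<L> H\<^esub> q \<otimes>\<^bsub>pg_group \<L> H\<^esub> ?x"
      unfolding pg_subgroup_conj(2)[OF Hs ix qH] H.inv_inv[OF x] ..
    then show "x \<otimes>\<^bsub>pg_group \<L> H\<^esub> q \<otimes>\<^bsub>pg_group \<L> H\<^esub> ?x \<in> Q"
      using conj[OF ix q] by simp
  qed
qed

text \<open>If a = c b with \<open>c\<close> centralizing Y_H, then \<open>c\<close> normalizes
  \<open>Q\<close>, so \<open>a\<close> and \<open>b\<close> conjugate \<open>Q\<close> to the same
  subgroup. The sets of conjugates therefore coincide even before generating.\<close>

lemma conj_closure_cong:
  assumes H: "parabolic \<L> S H" and K: "parabolic \<L> S K"
    and Y: "pg_Y p \<L> H = pg_Y p \<L> K"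
    and eq: "pg_set_mult \<L> H (pg_centralizer \<L> (pg_Y p \<L> H)) =
      pg_set_mult \<L> K (pg_centralizer \<L> (pg_Y p \<L> H))"
  shows "conj_closure \<L> Q H = conj_closure \<L> Q K"
proof -
  let ?Y = "pg_Y p \<L> H"
  let ?R = "pg_normalizer \<L> ?Y"
  let ?C = "pg_centralizer \<L> ?Y"
  let ?G = "pg_group \<L> ?R"
  note R = Y_object(3)[OF H]
  note Rs = parabolic_subgroup[OF R]
  interpret R: group ?G by (rule pg_subgroup_is_group[OF Rs])
  have HR: "H \<subseteq> ?R" and KR: "K \<subseteq> ?R" using Y_parabolic(6)[OF H] Y_parabolic(6)[OF K] Y by auto
  have CR: "?C \<subseteq> ?R" by (rule pg_centralizer_subset_normalizer[OF Y_parabolic(3)[OF H]])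
  have C: "?C = group_centralizer ?G ?Y" by (rule centralizer_object[OF Y_object(1)[OF H]])
  have "?Y \<lhd> ?G"
    using normal_parabolic[OF R Y_parabolic(3,2)[OF H]] by simp
  then have Cn: "?C \<lhd> ?G" unfolding C by (rule R.group_centralizer_normal)
  have QR: "Q \<subseteq> ?R" using Q_subset parabolic_superset[OF R] by blast
  have sub: "(\<Union>k\<in>A. pg_conj \<L> k ` Q) \<subseteq> (\<Union>k\<in>B. pg_conj \<L> k ` Q)"
    if A: "parabolic \<L> S A" "A \<subseteq> ?R" and B: "B \<subseteq> ?R" and e: "A <#>\<^bsub>?G\<^esub> ?C = B <#>\<^bsub>?G\<^esub> ?C"
      and Bs: "pg_subgroup \<L> B" for A B
  proof clarify
    fix a q assume a: "a \<in> A" and q: "q \<in> Q"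
    have "a \<in> A <#>\<^bsub>?G\<^esub> ?C"
    proof -
      have "a = a \<otimes>\<^bsub>?G\<^esub> \<one>\<^bsub>?G\<^esub>" using R.r_one[of a] a A(2) by auto
      moreover have "\<one>\<^bsub>?G\<^esub> \<in> ?C" by (rule subgroup.one_closed[OF normal_imp_subgroup[OF Cn]])
      ultimately show ?thesis using a unfolding set_mult_def by blast
    qed
    \<comment> \<open>With right conjugation the left factor acts first. Normality of the
      centralizer moves the centralizing factor to the left, where it meets \<open>Q\<close>
      itself.\<close>
    also have "A <#>\<^bsub>?G\<^esub> ?C = ?C <#>\<^bsub>?G\<^esub> B"
      unfolding e by (rule R.commut_normal[OF _ Cn]) (use pg_subgroup_iff[OF Rs] Bs B in simp)
    finally obtain c b where cb: "c \<in> ?C" "b \<in> B" "a = c \<otimes>\<^bsub>?G\<^esub> b"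
      by (auto simp: set_mult_def)
    have car: "c \<in> ?R" "b \<in> ?R" "a \<in> ?R" "q \<in> ?R" using cb a A B CR q QR by auto
    have "c \<in> pg_normalizer \<L> Q" using Y_object(2)[OF H] cb(1) by blast
    then have cq: "pg_conj \<L> c q \<in> Q" using q by (auto simp: pg_normalizer_def conj_eq_def)
    then have cqR: "pg_conj \<L> c q \<in> ?R" using QR by blast
    have car': "c \<in> carrier ?G" "b \<in> carrier ?G" "q \<in> carrier ?G" using car by simp_all
    have "pg_conj \<L> a q = inv\<^bsub>?G\<^esub> a \<otimes>\<^bsub>?G\<^esub> q \<otimes>\<^bsub>?G\<^esub> a"
      by (rule pg_subgroup_conj(2)[OF Rs car(3,4)])
    also have "\<dots> = inv\<^bsub>?G\<^esub> b \<otimes>\<^bsub>?G\<^esub> (inv\<^bsub>?G\<^esub> c \<otimes>\<^bsub>?G\<^esub> q \<otimes>\<^bsub>?G\<^esub> c) \<otimes>\<^bsub>?G\<^esub> b"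
      unfolding cb(3) using car' by (simp del: pg_group_simps add: R.m_assoc R.inv_mult_group)
    also have "\<dots> = inv\<^bsub>?G\<^esub> b \<otimes>\<^bsub>?G\<^esub> pg_conj \<L> c q \<otimes>\<^bsub>?G\<^esub> b"
      by (simp only: pg_subgroup_conj(2)[OF Rs car(1,4)])
    also have "\<dots> = pg_conj \<L> b (pg_conj \<L> c q)"
      by (rule pg_subgroup_conj(2)[OF Rs car(2) cqR, symmetric])
    finally have "pg_conj \<L> a q = pg_conj \<L> b (pg_conj \<L> c q)" .
    then show "pg_conj \<L> a q \<in> (\<Union>k\<in>B. pg_conj \<L> k ` Q)" using cb(2) cq by blast
  qed
  have "H <#>\<^bsub>?G\<^esub> ?C = K <#>\<^bsub>?G\<^esub> ?C"
    using eq pg_set_mult_in_subgroup[OF Rs HR CR] pg_set_mult_in_subgroup[OF Rs KR CR] by simp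
  then have "(\<Union>k\<in>H. pg_conj \<L> k ` Q) = (\<Union>k\<in>K. pg_conj \<L> k ` Q)"
    using sub[OF H HR KR] sub[OF K KR HR] parabolic_subgroup[OF H] parabolic_subgroup[OF K] by blast
  then show ?thesis
    using conj_closure_generate[OF Rs H HR] conj_closure_generate[OF Rs K KR] by simp
qed

text \<open>The relation between \<open>L\<close>, \<open>L\<^sup>*\<close> and \<open>M\<close> in part (a), except that \<open>Y\<^sub>L \<le> Y\<^sub>M\<close>, which follows.\<close>

definition dominated :: "'a set \<Rightarrow> 'a set \<Rightarrow> 'a set \<Rightarrow> bool" where
  "dominated L Ls H \<longleftrightarrow> parabolic \<L> S Ls \<and> Ls \<subseteq> H \<and>
     pg_set_mult \<L> L (pg_centralizer \<L> (pg_Y p \<L> L)) =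
       pg_set_mult \<L> Ls (pg_centralizer \<L> (pg_Y p \<L> L)) \<and>
     pg_Y p \<L> L = pg_Y p \<L> Ls"

lemma exists_frakM:
  assumes L: "parabolic \<L> S L"
  obtains M Ls where "M \<in> frakM p \<L> S" "parabolic \<L> S M" "dominated L Ls M"
proof -
  have finS: "finite S"
    using finite_subset[OF pg_subgroupD(1)[OF S_subgroup] finite_carrier] .
  \<comment> \<open>\<open>L\<close> qualifies with Ls = L. The witness \<open>Ls\<close> may depend
    on \<open>H\<close>, but every larger parabolic subgroup inherits it.\<close>
  let ?dom = "\<lambda>H. parabolic \<L> S H \<and> (\<exists>Ls. dominated L Ls H)"
  have "?dom L" using L by (auto simp: dominated_def)
  moreover have "\<forall>H. ?dom H \<longrightarrow> card (pg_Y p \<L> H) \<le> card S"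
    using card_mono[OF finS Y_parabolic(2)] by blast
  ultimately obtain H where H: "?dom H"
    and Hmax: "\<And>K. ?dom K \<Longrightarrow> card (pg_Y p \<L> K) \<le> card (pg_Y p \<L> H)"
    using ex_has_greatest_nat[of ?dom L "\<lambda>H. card (pg_Y p \<L> H)" "Suc (card S)"]
    by (metis less_Suc_eq_le)
  define Y where "Y = pg_Y p \<L> H"
  have max: "pg_Y p \<L> K = Y" if K: "?dom K" and sub: "Y \<subseteq> pg_Y p \<L> K" for K
    using Hmax[OF K] sub finite_subset[OF Y_parabolic(2) finS] K card_seteq
    unfolding Y_def by metis
  define N where "N = pg_normalizer \<L> Y"
  have Hp: "parabolic \<L> S H" using H by simp
  have Np: "parabolic \<L> S N" unfolding N_def Y_def by (rule Y_object(3)[OF Hp])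
  have HN: "H \<subseteq> N" unfolding N_def Y_def by (rule Y_parabolic(6)[OF Hp])
  obtain Ls where Ls: "dominated L Ls H" using H by blast
  have LsN: "dominated L Ls N" using Ls HN by (auto simp: dominated_def)
  have domN: "?dom K" if "parabolic \<L> S K" "N \<subseteq> K" for K
  proof -
    have "dominated L Ls K" using LsN that(2) by (auto simp: dominated_def)
    with that(1) show ?thesis by blast
  qed
  have YN: "pg_Y p \<L> N = Y"
    using max[OF domN[OF Np]] Y_parabolic_mono[OF char_p Hp Np HN] by (simp add: Y_def)
  have Ys: "pg_subgroup \<L> Y" "Y \<subseteq> S" "Y \<in> \<Delta>"
    using Y_parabolic(3,2)[OF Hp] Y_object(1)[OF Hp] by (simp_all add: Y_def)
  have Kin: "K \<subseteq> N" if "parabolic \<L> S K" "pg_Y p \<L> K = Y" for K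
    using Y_parabolic(6)[OF that(1)] that(2) by (simp add: N_def)
  note Ns = parabolic_subgroup[OF Np] and SN = parabolic_superset[OF Np]
  let ?G = "pg_group \<L> N"
  interpret N: finite_group_prime ?G p by (rule subgroup_finite_group_prime[OF Ns])
  let ?C = "group_centralizer ?G Y"
  have Yn: "Y \<lhd> ?G" using Y_parabolic(1)[OF Np] YN by simp
  have Cn: "?C \<lhd> ?G" by (rule N.group_centralizer_normal[OF Yn])
  have Cs: "subgroup ?C ?G" by (rule normal_imp_subgroup[OF Cn])
  have CL: "pg_centralizer \<L> Y = ?C"
    unfolding N_def by (rule centralizer_object[OF Ys(3)])
  have CN: "?C \<subseteq> N" using subgroup.subset[OF Cs] by simp
  have Nmul: "A <#>\<^bsub>?G\<^esub> ?C \<subseteq> N" if "A \<subseteq> N" for A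
    using N.set_mult_closed[of A ?C] that CN by simp
  have Ssub: "subgroup S ?G" using pg_subgroup_iff[OF Ns] S_subgroup SN by simp
  obtain M where Ms: "subgroup M ?G" and SM: "S \<subseteq> M" and MC: "M <#>\<^bsub>?G\<^esub> ?C = carrier ?G"
    and Mmin: "\<And>K. subgroup K ?G \<Longrightarrow> S \<subseteq> K \<Longrightarrow> K \<subseteq> M \<Longrightarrow> K <#>\<^bsub>?G\<^esub> ?C = carrier ?G \<Longrightarrow> K = M"
    using N.minimal_supplement_exists[OF Ssub Cn] by blast
  have Mp: "parabolic \<L> S M" and MN: "M \<subseteq> N"
    using Ms SM pg_subgroup_iff[OF Ns] by (auto simp: parabolic_def)
  note Msub = parabolic_subgroup[OF Mp]
  have subC: "A \<subseteq> A <#>\<^bsub>?G\<^esub> ?C" if "A \<subseteq> N" for A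
  proof
    fix a assume a: "a \<in> A"
    then have "a = a \<otimes>\<^bsub>?G\<^esub> \<one>\<^bsub>?G\<^esub>" using N.r_one[of a] that by auto
    then show "a \<in> A <#>\<^bsub>?G\<^esub> ?C"
      using a subgroup.one_closed[OF Cs] unfolding set_mult_def by blast
  qed
  \<comment> \<open>The inclusion from right to left is the transfer from \<open>N\<close> to
    \<open>M\<close>, which agree modulo C_N(Y) because M C_N(Y) = N.\<close>
  have YM: "pg_Y p \<L> M = Y"
  proof
    show "pg_Y p \<L> M \<subseteq> Y" using Y_parabolic_mono[OF char_p Mp Np MN] YN by simp
    have "M \<subseteq> N <#>\<^bsub>?G\<^esub> ?C" using subC[of N] MN by blast
    then show "Y \<subseteq> pg_Y p \<L> M"
      using Y_transfer[OF Mp Np Ns MN order_refl] MC YN by simp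
  qed
  have dag: "dagger p \<L> M = N"
    using pg_set_mult_in_subgroup[OF Ns MN CN] MC by (simp add: dagger_def YM CL)
  have charN: "N \<in> char_p_subgroups p \<L>" and charM: "M \<in> char_p_subgroups p \<L>"
    using parabolic_char_p(1)[OF char_p] Np Mp by auto
  have char_par: "parabolic \<L> S K" if "K \<in> char_p_subgroups p \<L>" "S \<subseteq> K" for K
    using that by (simp add: char_p_subgroups_def parabolic_def)
  have Nmax: "N \<in> max_char_p_subgroups p \<L>"
  proof -
    have "K = N" if K: "K \<in> char_p_subgroups p \<L>" "N \<subseteq> K" for K
    proof -
      have Kp: "parabolic \<L> S K" using char_par[OF K(1)] SN K(2) by blast
      have "pg_Y p \<L> K = Y"
        using max[OF domN[OF Kp K(2)]] Y_parabolic_mono[OF char_p Np Kp K(2)] YN by simp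
      then show ?thesis using Kin[OF Kp] K(2) by blast
    qed
    with charN show ?thesis by (simp add: max_char_p_subgroups_def)
  qed
  \<comment> \<open>\<open>M\<close> need not contain \<open>Ls\<close>. Since M C = N, this
    intersection has the same product with C = C_N(Y) as \<open>Ls\<close>, and it lies in
    \<open>M\<close>.\<close>
  define Lss where "Lss = M \<inter> (Ls <#>\<^bsub>?G\<^esub> ?C)"
  have Lsp: "parabolic \<L> S Ls" and LsNs: "Ls \<subseteq> N" and YL: "pg_Y p \<L> L = pg_Y p \<L> Ls"
    using LsN by (auto simp: dominated_def)
  have LsG: "subgroup Ls ?G" using pg_subgroup_iff[OF Ns] parabolic_subgroup[OF Lsp] LsNs by simp
  have LssG: "subgroup Lss ?G"
    unfolding Lss_def
    by (rule N.subgroups_Inter_pair[OF Ms N.set_mult_normal_subgroup[OF LsG Cn]])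
  have LssM: "Lss \<subseteq> M" by (simp add: Lss_def)
  have LssN: "Lss \<subseteq> N" using LssM MN by blast
  have Lssp: "parabolic \<L> S Lss"
    using LssG SM subC[OF LsNs] parabolic_superset[OF Lsp] pg_subgroup_iff[OF Ns]
    by (auto simp: parabolic_def Lss_def)
  have Lss_sub: "Lss \<subseteq> Ls <#>\<^bsub>?G\<^esub> ?C" by (simp add: Lss_def)
  have Ls_sub: "Ls \<subseteq> Lss <#>\<^bsub>?G\<^esub> ?C"
  proof
    fix l assume l: "l \<in> Ls"
    then have "l \<in> M <#>\<^bsub>?G\<^esub> ?C" using MC LsNs by auto
    then obtain m c where mc: "m \<in> M" "c \<in> ?C" "l = m \<otimes>\<^bsub>?G\<^esub> c" by (auto simp: set_mult_def)
    have car: "m \<in> carrier ?G" "c \<in> carrier ?G" "l \<in> carrier ?G"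
      using mc l MN CN LsNs by auto
    have "m = l \<otimes>\<^bsub>?G\<^esub> inv\<^bsub>?G\<^esub> c"
      unfolding mc(3) using car(1,2) by (simp del: pg_group_simps add: N.m_assoc)
    then have "m \<in> Ls <#>\<^bsub>?G\<^esub> ?C"
      using l subgroup.m_inv_closed[OF Cs mc(2)] unfolding set_mult_def by blast
    then have "m \<in> Lss" using mc(1) by (simp add: Lss_def)
    then show "l \<in> Lss <#>\<^bsub>?G\<^esub> ?C" using mc(2,3) unfolding set_mult_def by blast
  qed
  \<comment> \<open>\<open>Y_transfer\<close> will ask for products with the centralizers of Y_Ls
    and Y_Lss. These contain C_N(Y), because both subgroups lie in \<open>Y\<close>.\<close>
  have Cmono: "?C \<subseteq> group_centralizer ?G A" if "A \<subseteq> Y" for A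
    using that by (auto simp: group_centralizer_def)
  have mulmono: "A <#>\<^bsub>?G\<^esub> ?C \<subseteq> A <#>\<^bsub>?G\<^esub> group_centralizer ?G B" if "B \<subseteq> Y" for A B
    by (rule mono_set_mult[OF order_refl Cmono[OF that]])
  have YLss: "pg_Y p \<L> Lss = pg_Y p \<L> Ls"
  proof
    have "pg_Y p \<L> Lss \<subseteq> Y" using Y_parabolic_mono[OF char_p Lssp Mp LssM] YM by simp
    note m = mulmono[OF this]
    show "pg_Y p \<L> Lss \<subseteq> pg_Y p \<L> Ls"
      by (rule Y_transfer[OF Lsp Lssp Ns LsNs LssN subset_trans[OF Ls_sub m]
            subset_trans[OF Lss_sub m]])
    have "pg_Y p \<L> Ls \<subseteq> Y" using Y_parabolic_mono[OF char_p Lsp Np LsNs] YN by simp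
    note m = mulmono[OF this]
    show "pg_Y p \<L> Ls \<subseteq> pg_Y p \<L> Lss"
      by (rule Y_transfer[OF Lssp Lsp Ns LssN LsNs subset_trans[OF Lss_sub m]
            subset_trans[OF Ls_sub m]])
  qed
  have dom: "dominated L Lss M"
  proof -
    \<comment> \<open>C(Y_L) need not lie in \<open>N\<close>, so these products are compared in
      N(Y_L). The multiplication is that of \<open>\<L>\<close> in either group.\<close>
    let ?Y = "pg_Y p \<L> L"
    let ?D = "pg_centralizer \<L> ?Y" and ?R = "pg_normalizer \<L> ?Y"
    note R = Y_object(3)[OF L]
    note Rs = parabolic_subgroup[OF R]
    interpret R: group "pg_group \<L> ?R" by (rule pg_subgroup_is_group[OF Rs])
    have DR: "?D \<subseteq> ?R" by (rule pg_centralizer_subset_normalizer[OF Y_parabolic(3)[OF L]])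
    have Ds: "subgroup ?D (pg_group \<L> ?R)"
      unfolding centralizer_object[OF Y_object(1)[OF L]]
      by (rule R.group_centralizer_subgroup)
        (use Y_parabolic(2)[OF L] parabolic_superset[OF R] in auto)
    have "?Y \<subseteq> Y" using Y_parabolic_mono[OF char_p Lsp Np LsNs] YN YL by simp
    then have CD: "?C \<subseteq> ?D" using pg_centralizer_mono[of ?Y Y] CL by simp
    have LsR: "Ls \<subseteq> ?R" and LssR: "Lss \<subseteq> ?R"
      using Y_parabolic(6)[OF Lsp] Y_parabolic(6)[OF Lssp] YL YLss by auto
    have sub: "A <#>\<^bsub>pg_group \<L> ?R\<^esub> ?D \<subseteq> B <#>\<^bsub>pg_group \<L> ?R\<^esub> ?D"
      if A: "A \<subseteq> B <#>\<^bsub>?G\<^esub> ?C" and B: "B \<subseteq> ?R" for A B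
    proof
      fix x assume "x \<in> A <#>\<^bsub>pg_group \<L> ?R\<^esub> ?D"
      then obtain a d where ad: "a \<in> A" "d \<in> ?D" "x = a \<otimes>\<^bsub>pg_group \<L> ?R\<^esub> d"
        by (auto simp: set_mult_def)
      obtain b c where bc: "b \<in> B" "c \<in> ?C" "a = b \<otimes>\<^bsub>pg_group \<L> ?R\<^esub> c"
        using A ad(1) by (auto simp: set_mult_def)
      have car: "b \<in> carrier (pg_group \<L> ?R)" "c \<in> carrier (pg_group \<L> ?R)"
        "d \<in> carrier (pg_group \<L> ?R)"
        using bc ad B CD DR by auto
      have "x = b \<otimes>\<^bsub>pg_group \<L> ?R\<^esub> (c \<otimes>\<^bsub>pg_group \<L> ?R\<^esub> d)"
        unfolding ad(3) bc(3) by (rule R.m_assoc[OF car])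
      moreover have "c \<otimes>\<^bsub>pg_group \<L> ?R\<^esub> d \<in> ?D"
        by (rule subgroup.m_closed[OF Ds]) (use bc ad CD in auto)
      ultimately show "x \<in> B <#>\<^bsub>pg_group \<L> ?R\<^esub> ?D"
        using bc(1) unfolding set_mult_def by blast
    qed
    have "Lss <#>\<^bsub>pg_group \<L> ?R\<^esub> ?D = Ls <#>\<^bsub>pg_group \<L> ?R\<^esub> ?D"
      using sub[OF Lss_sub LsR] sub[OF Ls_sub LssR] by blast
    then have "pg_set_mult \<L> Lss ?D = pg_set_mult \<L> Ls ?D"
      using pg_set_mult_in_subgroup[OF Rs LsR DR] pg_set_mult_in_subgroup[OF Rs LssR DR] by simp
    moreover have "pg_set_mult \<L> L ?D = pg_set_mult \<L> Ls ?D"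
      using LsN unfolding dominated_def by blast
    ultimately show ?thesis
      unfolding dominated_def using Lssp LssM YL YLss by metis
  qed
  have uniq: "{K \<in> max_char_p_subgroups p \<L>. M \<subseteq> K} = {dagger p \<L> M}"
  proof -
    have "K = N" if K: "K \<in> max_char_p_subgroups p \<L>" "M \<subseteq> K" for K
    proof -
      have "K \<in> char_p_subgroups p \<L>" using K(1) by (simp add: max_char_p_subgroups_def)
      then have Kp: "parabolic \<L> S K" using char_par SM K(2) by blast
      \<comment> \<open>\<open>K\<close> contains \<open>M\<close> but perhaps not
        \<open>Ls\<close>; having \<open>Lss\<close> inside \<open>M\<close> is what lets
        \<open>K\<close> compete in the maximization.\<close>
      have "dominated L Lss K" using dom K(2) by (auto simp: dominated_def)
      with Kp have "?dom K" by blast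
      then have "pg_Y p \<L> K = Y"
        using max[of K] Y_parabolic_mono[OF char_p Mp Kp K(2)] YM by simp
      then have "K \<subseteq> N" using Kin[OF Kp] by simp
      then show ?thesis using K(1) charN by (auto simp: max_char_p_subgroups_def)
    qed
    then show ?thesis unfolding dag using Nmax MN by blast
  qed
  have "M \<in> frakM p \<L> S"
  proof -
    interpret M: finite_group_prime "pg_group \<L> M" p by (rule subgroup_finite_group_prime[OF Msub])
    let ?GM = "pg_group \<L> M"
    let ?CM = "group_centralizer ?GM Y"
    have CMn: "?CM \<lhd> ?GM"
      using M.group_centralizer_normal[of Y] Y_parabolic(1)[OF Mp] YM by simp
    have core: "pg_p_core p \<L> M \<subseteq> ?CM"
      using M.Y_candidate_centralizes[OF S_sylow[OF Mp] Y_parabolic(4)[OF Mp]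
          p_core_parabolic(1,2)[OF Mp]] YM by simp
    have CMeq: "?CM = M \<inter> ?C"
      using N.group_centralizer_restrict[of M Y] MN by simp
    \<comment> \<open>\<open>M\<close> was chosen minimal for supplements of C = C_N(Y) in
      \<open>N\<close>. A supplement of M \<inter> C in \<open>M\<close> is also a supplement of C
      in \<open>N\<close>, because M C = N.\<close>
    have min: "K = carrier ?GM"
      if K: "subgroup K ?GM" "S \<subseteq> K" "K <#>\<^bsub>?GM\<^esub> ?CM = carrier ?GM" for K
    proof -
      have KM: "K \<subseteq> M" using subgroup.subset[OF K(1)] by simp
      have KG: "subgroup K ?G"
        using K(1) pg_subgroup_iff[OF Msub] pg_subgroup_iff[OF Ns] MN by auto
      have "M \<subseteq> K <#>\<^bsub>?G\<^esub> ?C"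
      proof
        fix m assume "m \<in> M"
        then have "m \<in> K <#>\<^bsub>?GM\<^esub> ?CM" using K(3) by simp
        then show "m \<in> K <#>\<^bsub>?G\<^esub> ?C" unfolding CMeq by (auto simp: set_mult_def)
      qed
      then have "M <#>\<^bsub>?G\<^esub> ?C \<subseteq> (K <#>\<^bsub>?G\<^esub> ?C) <#>\<^bsub>?G\<^esub> ?C"
        by (rule mono_set_mult) simp
      also have "\<dots> = K <#>\<^bsub>?G\<^esub> ?C"
        using N.set_mult_assoc[of K ?C ?C] KM MN CN N.subgroup_mult_id[OF Cs] by auto
      finally have "K <#>\<^bsub>?G\<^esub> ?C = carrier ?G" using MC Nmul[of K] KM MN by auto
      then show ?thesis using Mmin[OF KG K(2) KM] by simp
    qed
    note props = M.minimal_supplement_properties[OF S_sylow[OF Mp] CMn core min]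
    then have "\<exists>!P. sylow_subgroup p (pg_group \<L> ?CM) P"
      "carrier (pg_group \<L> ?CM Mod pg_p_core p \<L> M) \<subseteq> frattini (?GM Mod pg_p_core p \<L> M)"
      unfolding pg_group_simps(4) by blast+
    then show ?thesis
      using charM SM uniq YM YN dag by (simp add: frakM_def Let_def)
  qed
  with that Mp dom show thesis by blast
qed

lemma dominated_conj_closure:
  assumes "parabolic \<L> S L" "dominated L Ls M" "parabolic \<L> S M"
  shows "conj_closure \<L> Q L = conj_closure \<L> Q Ls" "conj_closure \<L> Q Ls \<subseteq> conj_closure \<L> Q M"
  using assms conj_closure_cong[of L Ls] conj_closure_mono[of Ls M]
  by (auto simp: dominated_def)

text \<open>The contrapositive of (b). The case of \<open>M\<close> reduces to that of
  \<open>Ls\<close>, since Ls \<subseteq> M \<subseteq> N(Q).\<close>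

lemma dominated_Q_normal:
  assumes L: "parabolic \<L> S L" and dom: "dominated L Ls M" and M: "parabolic \<L> S M"
  shows "Q \<lhd> pg_group \<L> Ls \<Longrightarrow> Q \<lhd> pg_group \<L> L" and "Q \<lhd> pg_group \<L> M \<Longrightarrow> Q \<lhd> pg_group \<L> L"
proof -
  have Ls: "parabolic \<L> S Ls" "Ls \<subseteq> M" using dom by (auto simp: dominated_def)
  show 1: "Q \<lhd> pg_group \<L> L" if "Q \<lhd> pg_group \<L> Ls"
    using that dominated_conj_closure(1)[OF L dom M]
      Q_normal_iff_conj_closure[OF L] Q_normal_iff_conj_closure[OF Ls(1)] by simp
  show "Q \<lhd> pg_group \<L> L" if "Q \<lhd> pg_group \<L> M"
    using that 1 Q_normal_iff[OF M] Q_normal_iff[OF Ls(1)] Ls(2) by blast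
qed

lemma frakM_parabolic: "M \<in> frakM p \<L> S \<Longrightarrow> parabolic \<L> S M"
  by (simp add: frakM_def char_p_subgroups_def parabolic_def)

text \<open>If the second alternative fails, (a) and (b) applied to an arbitrary parabolic subgroup
  put it into N(Q). So N(Q) is the largest parabolic subgroup, and as it belongs to
  \<open>char_p_subgroups\<close> it is the only maximal member above \<open>S\<close>.\<close>

lemma frakM_alternative:
  "max_char_p_over p \<L> S = {pg_normalizer \<L> Q} \<or> (\<exists>M\<in>frakM p \<L> S. \<not> Q \<lhd> pg_group \<L> M)"
proof (rule disjCI)
  let ?N = "pg_normalizer \<L> Q"
  assume "\<not> (\<exists>M\<in>frakM p \<L> S. \<not> Q \<lhd> pg_group \<L> M)"
  then have all: "Q \<lhd> pg_group \<L> M" if "M \<in> frakM p \<L> S" for M using that by blast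
  have inN: "K \<subseteq> ?N" if K: "parabolic \<L> S K" for K
  proof -
    obtain M Ls where "M \<in> frakM p \<L> S" "parabolic \<L> S M" "dominated K Ls M"
      using exists_frakM[OF K] by blast
    then show ?thesis using dominated_Q_normal(2)[OF K] all Q_normal_iff[OF K] by blast
  qed
  have N: "parabolic \<L> S ?N"
    by (rule normalizer_parabolic[OF Q_object S_parabolic inN[OF S_parabolic]])
  have char_par: "parabolic \<L> S K" if "K \<in> char_p_subgroups p \<L>" "S \<subseteq> K" for K
    using that by (simp add: char_p_subgroups_def parabolic_def)
  have Nc: "?N \<in> char_p_subgroups p \<L>" by (rule parabolic_char_p(1)[OF char_p N])
  have SN: "S \<subseteq> ?N" by (rule parabolic_superset[OF N])
  have "K = ?N" if K: "K \<in> char_p_subgroups p \<L>" "?N \<subseteq> K" for K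
    using K(2) inN[OF char_par[OF K(1) subset_trans[OF SN K(2)]]] by (rule equalityI[rotated])
  then have Nmax: "?N \<in> max_char_p_subgroups p \<L>"
    using Nc unfolding max_char_p_subgroups_def by blast
  have "K = ?N" if K: "K \<in> max_char_p_over p \<L> S" for K
  proof -
    have c: "K \<in> char_p_subgroups p \<L>" "S \<subseteq> K"
      and m: "\<And>H. H \<in> char_p_subgroups p \<L> \<Longrightarrow> K \<subseteq> H \<Longrightarrow> H = K"
      using K unfolding max_char_p_over_def max_char_p_subgroups_def by blast+
    show ?thesis using m[OF Nc inN[OF char_par[OF c]]] by simp
  qed
  moreover have "?N \<in> max_char_p_over p \<L> S"
    using Nmax SN unfolding max_char_p_over_def by blast
  ultimately show "max_char_p_over p \<L> S = {?N}" by blast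
qed

end

theorem theorem5p9:
  fixes p :: nat and \<L> :: "'a partial_group" and \<Delta> :: "'a set set" and S Q L :: "'a set"
  assumes "prime p"
    and "locality p \<L> \<Delta> S"
    and "objective_characteristic p \<L> \<Delta>"
    and "pg_subgroup \<L> Q" and "Q \<subseteq> S"
    and "large \<L> Q"
    and "replete \<L> \<Delta> S Q"
    and "parabolic \<L> S L"
  shows
    \<comment> \<open>(a)\<close>
    "((\<exists>M Ls. M \<in> frakM p \<L> S \<and> parabolic \<L> S Ls \<and> Ls \<subseteq> M \<and>
         pg_set_mult \<L> L (pg_centralizer \<L> (pg_Y p \<L> L)) =
           pg_set_mult \<L> Ls (pg_centralizer \<L> (pg_Y p \<L> L)) \<and>
         pg_Y p \<L> L = pg_Y p \<L> Ls \<and> pg_Y p \<L> Ls \<subseteq> pg_Y p \<L> M) \<and>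
      (\<forall>M Ls. M \<in> frakM p \<L> S \<and> parabolic \<L> S Ls \<and> Ls \<subseteq> M \<and>
         pg_set_mult \<L> L (pg_centralizer \<L> (pg_Y p \<L> L)) =
           pg_set_mult \<L> Ls (pg_centralizer \<L> (pg_Y p \<L> L)) \<and>
         pg_Y p \<L> L = pg_Y p \<L> Ls \<and> pg_Y p \<L> Ls \<subseteq> pg_Y p \<L> M \<longrightarrow>
         conj_closure \<L> Q L = conj_closure \<L> Q Ls \<and>
         conj_closure \<L> Q Ls \<subseteq> conj_closure \<L> Q M)) \<and>
     \<comment> \<open>(b)\<close>
     (\<not> Q \<lhd> pg_group \<L> L \<longrightarrow>
      (\<forall>M Ls. M \<in> frakM p \<L> S \<and> parabolic \<L> S Ls \<and> Ls \<subseteq> M \<and>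
         pg_set_mult \<L> L (pg_centralizer \<L> (pg_Y p \<L> L)) =
           pg_set_mult \<L> Ls (pg_centralizer \<L> (pg_Y p \<L> L)) \<and>
         pg_Y p \<L> L = pg_Y p \<L> Ls \<and> pg_Y p \<L> Ls \<subseteq> pg_Y p \<L> M \<longrightarrow>
         \<not> Q \<lhd> pg_group \<L> Ls \<and> \<not> Q \<lhd> pg_group \<L> M)) \<and>
     \<comment> \<open>(c)\<close>
     (max_char_p_over p \<L> S = {pg_normalizer \<L> Q} \<or>
      (\<exists>M\<in>frakM p \<L> S. \<not> Q \<lhd> pg_group \<L> M))"
proof -
  interpret large_locality p \<L> \<Delta> S Q
    using assms by (simp add: large_locality_def large_locality_axioms_def
        prime_locality_def prime_locality_axioms_def)
  note L = \<open>parabolic \<L> S L\<close>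
  show ?thesis
  proof (intro conjI allI impI)
    obtain M Ls where M: "M \<in> frakM p \<L> S" "parabolic \<L> S M" and dom: "dominated L Ls M"
      using exists_frakM[OF L] by blast
    have "pg_Y p \<L> Ls \<subseteq> pg_Y p \<L> M"
      using Y_parabolic_mono[OF char_p _ M(2)] dom by (simp add: dominated_def)
    with M dom show "\<exists>M Ls. M \<in> frakM p \<L> S \<and> parabolic \<L> S Ls \<and> Ls \<subseteq> M \<and>
           pg_set_mult \<L> L (pg_centralizer \<L> (pg_Y p \<L> L)) =
             pg_set_mult \<L> Ls (pg_centralizer \<L> (pg_Y p \<L> L)) \<and>
           pg_Y p \<L> L = pg_Y p \<L> Ls \<and> pg_Y p \<L> Ls \<subseteq> pg_Y p \<L> M"
      unfolding dominated_def by blast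
  next
    fix M Ls
    assume "M \<in> frakM p \<L> S \<and> parabolic \<L> S Ls \<and> Ls \<subseteq> M \<and>
           pg_set_mult \<L> L (pg_centralizer \<L> (pg_Y p \<L> L)) =
             pg_set_mult \<L> Ls (pg_centralizer \<L> (pg_Y p \<L> L)) \<and>
           pg_Y p \<L> L = pg_Y p \<L> Ls \<and> pg_Y p \<L> Ls \<subseteq> pg_Y p \<L> M"
    then have dom: "dominated L Ls M" and M: "parabolic \<L> S M"
      using frakM_parabolic by (auto simp: dominated_def)
    show "conj_closure \<L> Q L = conj_closure \<L> Q Ls"
      and "conj_closure \<L> Q Ls \<subseteq> conj_closure \<L> Q M"
      using dominated_conj_closure[OF L dom M] .
    show "\<not> Q \<lhd> pg_group \<L> Ls" and "\<not> Q \<lhd> pg_group \<L> M" if "\<not> Q \<lhd> pg_group \<L> L"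
      using that dominated_Q_normal[OF L dom M] by blast+
  qed (rule frakM_alternative)
qed

end
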